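(* Let $p$ be an odd prime and let $G$ be a group of order $p^5$ in the isoclinism family $\Phi_{10}$. Then the Wedderburn decomposition of $\mathbb{Q}G$ is as follows: (1) for $p\ge5$, $$\mathbb{Q}G\cong\mathbb{Q}(G/G')\oplus(p+1)M_p(\mathbb{Q}(\zeta_p))\oplus M_{p^2}(\mathbb{Q}(\zeta_p));$$ (2) for $p=3$, $$\mathbb{Q}G\cong\mathbb{Q}(G/G')\oplus M_3(\mathbb{Q}(\zeta_3))\oplus M_3(\mathbb{Q}(\zeta_9))\oplus M_9(\mathbb{Q}(\zeta_3)).$$
   Context: $\zeta_d$ is a primitive $d$-th root of unity; $M_n(D)$ is the ring of $n\times n$ matrices over $D$; $aR$ denotes the direct sum of $a$ copies of the algebra $R$. Two groups $G,H$ are isoclinic if there are isomorphisms $G/Z(G)\to H/Z(H)$ and $G'\to H'$ compatible with the commutator maps. $\Phi_{10}$ (R. James) is the isoclinism family of the order-$p^5$ group $\Phi_{10}(1^5)=\langle\alpha,\alpha_1,\dots,\alpha_4:[\alpha_i,\alpha]=\alpha_{i+1}\ (i=1,2,3),\ [\alpha_1,\alpha_2]=\alpha_4,\ \alpha^p=\alpha_j^{(p)}=1\ (j=1,2,3,4)\rangle$, with $[x,y]=x^{-1}y^{-1}xy$, unlisted commutators of generators trivial, and $\alpha_j^{(p)}=\alpha_j^{p}\alpha_{j+1}^{\binom p2}\cdots\alpha_{j+k-1}^{\binom pk}\cdots\alpha_{j+p-1}$ where $\alpha_l=1$ for $l>4$ (so the power relations amount to $\alpha_j^p=1$ when $p\ge5$,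 and for $p=3$ read $\alpha_1^3\alpha_2^3\alpha_3=\alpha_2^3\alpha_3^3\alpha_4=\alpha_3^3\alpha_4^3=\alpha_4^3=1$). For groups of order $p^5$ in $\Phi_{10}$, $Z(G)\cong C_p$ and $G/Z(G)\cong\Phi_3(1^4)=\langle\alpha,\alpha_1,\alpha_2,\alpha_3:[\alpha_1,\alpha]=\alpha_2,[\alpha_2,\alpha]=\alpha_3,\ \alpha^p=\alpha_1^{(p)}=\alpha_2^p=\alpha_3^p=1\rangle$, where $\alpha_1^{(p)}=\alpha_1^p$ for $p\geq 5$ and $\alpha_1^{(3)}=\alpha_1^3\alpha_2^3\alpha_3$. *)

theory Defs
  imports
    "HOL-Algebra.Algebra"
    "HOL-Algebra.Algebraic_Closure_Type"
    "HOL-Computational_Algebra.Primes"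
    Complex_Main
    "Jordan_Normal_Form.Matrix"
begin

section \<open>Groups given by a presentation\<close>

text \<open>The letter \<open>(x, True)\<close> is the generator \<open>x\<close>, the letter \<open>(x, False)\<close> its formal inverse.\<close>

type_synonym 'x word = "('x \<times> bool) list"

definition word_inv :: "'x word \<Rightarrow> 'x word" where
  "word_inv w = rev (map (\<lambda>(x, b). (x, \<not> b)) w)"

definition word_pow :: "'x word \<Rightarrow> nat \<Rightarrow> 'x word" where
  "word_pow w n = concat (replicate n w)"

definition word_comm :: "'x word \<Rightarrow> 'x word \<Rightarrow> 'x word" where
  "word_comm u v = word_inv u @ word_inv v @ u @ v"

definition words_over :: "'x set \<Rightarrow> 'x word set" where
  "words_over S = lists (S \<times> UNIV)"

inductive word_eq :: "'x set \<Rightarrow> 'x word set \<Rightarrow> 'x word \<Rightarrow> 'x word \<Rightarrow> bool"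
  for S R where
  refl:   "w \<in> words_over S \<Longrightarrow> word_eq S R w w"
| sym:    "word_eq S R u v \<Longrightarrow> word_eq S R v u"
| trans:  "word_eq S R u v \<Longrightarrow> word_eq S R v w \<Longrightarrow> word_eq S R u w"
| append: "word_eq S R u u' \<Longrightarrow> word_eq S R v v' \<Longrightarrow> word_eq S R (u @ v) (u' @ v')"
| cancel: "x \<in> S \<Longrightarrow> word_eq S R [(x, b), (x, \<not> b)] []"
| rel:    "r \<in> R \<Longrightarrow> r \<in> words_over S \<Longrightarrow> word_eq S R r []"

definition word_rel :: "'x set \<Rightarrow> 'x word set \<Rightarrow> ('x word \<times> 'x word) set" where
  "word_rel S R = {(u, v). word_eq S R u v}"

definition presented_group :: "'x set \<Rightarrow> 'x word set \<Rightarrow> 'x word set monoid" where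
  "presented_group S R = \<lparr>
     carrier = words_over S // word_rel S R,
     monoid.mult = (\<lambda>A B. \<Union>u\<in>A. \<Union>v\<in>B. word_rel S R `` {u @ v}),
     one = word_rel S R `` {[]}\<rparr>"

lemma word_eq_words:
  assumes "word_eq S R u v"
  shows "u \<in> words_over S" "v \<in> words_over S"
  using assms by (induction rule: word_eq.induct) (auto simp: words_over_def)

lemma equiv_word_rel: "equiv (words_over S) (word_rel S R)"
proof (rule equivI)
  show "word_rel S R \<subseteq> words_over S \<times> words_over S"
    by (auto simp: word_rel_def dest: word_eq_words)
  show "refl_on (words_over S) (word_rel S R)"
    by (auto simp: refl_on_def word_rel_def intro: word_eq.refl)
  show "sym (word_rel S R)"
    by (auto simp: sym_def word_rel_def intro: word_eq.sym)
  show "Relation.trans (word_rel S R)"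
    by (auto simp: trans_def word_rel_def intro: word_eq.trans)
qed

lemma presented_group_mult:
  assumes "u \<in> words_over S" "v \<in> words_over S"
  shows "word_rel S R `` {u} \<otimes>\<^bsub>presented_group S R\<^esub> word_rel S R `` {v}
           = word_rel S R `` {u @ v}"
proof -
  have "congruent2 (word_rel S R) (word_rel S R) (\<lambda>u v. word_rel S R `` {u @ v})"
    by (intro congruent2I'  equiv_class_eq[OF equiv_word_rel])
       (auto simp: word_rel_def intro: word_eq.append)
  then show ?thesis
    using UN_equiv_class2[OF equiv_word_rel equiv_word_rel] assms
    by (simp add: presented_group_def)
qed

lemma word_inv_words: "w \<in> words_over S \<Longrightarrow> word_inv w \<in> words_over S"
  by (auto simp: words_over_def word_inv_def)

lemma word_inv_left: "w \<in> words_over S \<Longrightarrow> word_eq S R (word_inv w @ w) []"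
proof (induction w)
  case Nil
  then show ?case by (simp add: word_inv_def word_eq.refl)
next
  case (Cons a w)
  obtain x b where a: "a = (x, b)" by (cases a)
  have x: "x \<in> S" and w: "w \<in> words_over S" using Cons.prems by (auto simp: words_over_def a)
  have "word_eq S R ([(x, \<not> b), (x, b)] @ w) ([] @ w)"
    using word_eq.cancel[OF x, of R "\<not> b"] word_eq.refl[OF w] by (intro word_eq.append) auto
  then have "word_eq S R (word_inv w @ [(x, \<not> b), (x, b)] @ w) (word_inv w @ w)"
    using word_eq.append[OF word_eq.refl[OF word_inv_words[OF w]]] by fastforce
  then have "word_eq S R (word_inv w @ [(x, \<not> b), (x, b)] @ w) []"
    using Cons.IH[OF w] word_eq.trans by blast
  then show ?case by (simp add: word_inv_def a)
qed

lemma group_presented_group: "group (presented_group S R)"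
proof (rule groupI)
  let ?P = "presented_group S R" and ?c = "\<lambda>w. word_rel S R `` {w}"
  have car: "carrier ?P = ?c ` words_over S" and one: "\<one>\<^bsub>?P\<^esub> = ?c []"
    by (auto simp: presented_group_def quotient_def)
  have nil: "[] \<in> words_over S" by (simp add: words_over_def)
  have app: "u @ v \<in> words_over S" if "u \<in> words_over S" "v \<in> words_over S" for u v
    using that by (simp add: words_over_def)
  note m = presented_group_mult[of _ S _ R]
  show "\<one>\<^bsub>?P\<^esub> \<in> carrier ?P" using nil by (auto simp: car one)
  show "x \<otimes>\<^bsub>?P\<^esub> y \<in> carrier ?P" if "x \<in> carrier ?P" "y \<in> carrier ?P" for x y
    using that by (auto simp: car m app)
  show "x \<otimes>\<^bsub>?P\<^esub> y \<otimes>\<^bsub>?P\<^esub> z = x \<otimes>\<^bsub>?P\<^esub> (y \<otimes>\<^bsub>?P\<^esub> z)"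
    if "x \<in> carrier ?P" "y \<in> carrier ?P" "z \<in> carrier ?P" for x y z
    using that by (auto simp: car m app)
  show "\<one>\<^bsub>?P\<^esub> \<otimes>\<^bsub>?P\<^esub> x = x" if "x \<in> carrier ?P" for x
    using that by (auto simp: car one m nil)
  show "\<exists>y\<in>carrier ?P. y \<otimes>\<^bsub>?P\<^esub> x = \<one>\<^bsub>?P\<^esub>" if x: "x \<in> carrier ?P" for x
  proof -
    obtain w where w: "w \<in> words_over S" "x = ?c w" using x unfolding car by blast
    have "?c (word_inv w @ w) = ?c []"
      using word_inv_left[OF w(1), of R]
      by (intro equiv_class_eq[OF equiv_word_rel]) (auto simp: word_rel_def)
    then have "?c (word_inv w) \<otimes>\<^bsub>?P\<^esub> x = \<one>\<^bsub>?P\<^esub>"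
      by (simp add: w m word_inv_words one)
    then show ?thesis using word_inv_words[OF w(1)] by (auto simp: car)
  qed
qed


section \<open>Isoclinism and the family \<open>\<Phi>\<^sub>1\<^sub>0\<close>\<close>

definition center :: "('a, 'b) monoid_scheme \<Rightarrow> 'a set" where
  "center G = {z \<in> carrier G. \<forall>g\<in>carrier G. z \<otimes>\<^bsub>G\<^esub> g = g \<otimes>\<^bsub>G\<^esub> z}"

definition commutator :: "('a, 'b) monoid_scheme \<Rightarrow> 'a \<Rightarrow> 'a \<Rightarrow> 'a" where
  "commutator G x y = inv\<^bsub>G\<^esub> x \<otimes>\<^bsub>G\<^esub> inv\<^bsub>G\<^esub> y \<otimes>\<^bsub>G\<^esub> x \<otimes>\<^bsub>G\<^esub> y"

abbreviation commutator_subgroup :: "('a, 'b) monoid_scheme \<Rightarrow> 'a set" where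
  "commutator_subgroup G \<equiv> derived G (carrier G)"

definition isoclinic :: "('a, 'b) monoid_scheme \<Rightarrow> ('c, 'd) monoid_scheme \<Rightarrow> bool" where
  "isoclinic G H \<longleftrightarrow>
     (\<exists>\<phi> \<in> iso (G Mod center G) (H Mod center H).
      \<exists>\<psi> \<in> iso (G\<lparr>carrier := commutator_subgroup G\<rparr>) (H\<lparr>carrier := commutator_subgroup H\<rparr>).
        \<forall>x\<in>carrier G. \<forall>y\<in>carrier G. \<forall>x'\<in>carrier H. \<forall>y'\<in>carrier H.
          \<phi> (center G #>\<^bsub>G\<^esub> x) = center H #>\<^bsub>H\<^esub> x' \<longrightarrow>
          \<phi> (center G #>\<^bsub>G\<^esub> y) = center H #>\<^bsub>H\<^esub> y' \<longrightarrow>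
          \<psi> (commutator G x y) = commutator H x' y')"

text \<open>Generator \<open>0\<close> is \<open>\<alpha>\<close> and generator \<open>j\<close>, for \<open>1 \<le> j \<le> 4\<close>, is \<open>\<alpha>\<^sub>j\<close>;
  \<open>\<alpha>\<^sub>l = 1\<close> for \<open>l > 4\<close>.\<close>

definition phi10_gen :: "nat \<Rightarrow> nat word" where
  "phi10_gen l = (if l \<le> 4 then [(l, True)] else [])"

text \<open>James's symbol
  \<open>\<alpha>\<^sub>j\<^sup>(\<^sup>p\<^sup>) = \<alpha>\<^sub>j\<^sup>p \<alpha>\<^bsub>j+1\<^esub>\<^bsup>p choose 2\<^esup> \<dots> \<alpha>\<^bsub>j+k-1\<^esub>\<^bsup>p choose k\<^esup> \<dots> \<alpha>\<^bsub>j+p-1\<^esub>\<close>.\<close>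

definition phi10_ppow :: "nat \<Rightarrow> nat \<Rightarrow> nat word" where
  "phi10_ppow p j = concat (map (\<lambda>k. word_pow (phi10_gen (j + k - 1)) (p choose k)) [1..<p + 1])"

text \<open>All relators of \<open>\<Phi>\<^sub>1\<^sub>0(1\<^sup>5)\<close>. The second and fourth set say that the commutators
  of generators not listed in the presentation are trivial.\<close>

definition phi10_relators :: "nat \<Rightarrow> nat word set" where
  "phi10_relators p =
     {word_comm (phi10_gen i) (phi10_gen 0) @ word_inv (phi10_gen (i + 1)) |i. i \<in> {1, 2, 3}}
   \<union> {word_comm (phi10_gen 4) (phi10_gen 0)}
   \<union> {word_comm (phi10_gen 1) (phi10_gen 2) @ word_inv (phi10_gen 4)}
   \<union> {word_comm (phi10_gen i) (phi10_gen j) |i j. 1 \<le> i \<and> i < j \<and> j \<le> 4 \<and> (i, j) \<noteq> (1, 2)}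
   \<union> {word_pow (phi10_gen 0) p}
   \<union> {phi10_ppow p j |j. j \<in> {1, 2, 3, 4}}"

definition Phi10_1_5 :: "nat \<Rightarrow> nat word set monoid" where
  "Phi10_1_5 p = presented_group {0..4} (phi10_relators p)"

definition in_Phi10 :: "nat \<Rightarrow> ('a, 'b) monoid_scheme \<Rightarrow> bool" where
  "in_Phi10 p G \<longleftrightarrow> isoclinic G (Phi10_1_5 p)"


section \<open>Algebras over the rationals\<close>

text \<open>A \<open>\<rat>\<close>-algebra, not necessarily commutative, is represented by the record
  \<^typ>\<open>(rat, 'a) module\<close>, which carries ring operations and the scalar multiplication.\<close>

type_synonym 'a rat_algebra = "(rat, 'a) module"

definition rat_algebra_iso :: "'a rat_algebra \<Rightarrow> 'b rat_algebra \<Rightarrow> ('a \<Rightarrow> 'b) set" where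
  "rat_algebra_iso A B =
     {h \<in> ring_iso A B. \<forall>q. \<forall>x\<in>carrier A. h (q \<odot>\<^bsub>A\<^esub> x) = q \<odot>\<^bsub>B\<^esub> h x}"

definition rat_algebra_isomorphic :: "'a rat_algebra \<Rightarrow> 'b rat_algebra \<Rightarrow> bool"
  (infix \<open>\<cong>\<^sub>\<rat>\<close> 50) where
  "A \<cong>\<^sub>\<rat> B \<longleftrightarrow> rat_algebra_iso A B \<noteq> {}"

definition algebra_sum :: "'a rat_algebra \<Rightarrow> 'b rat_algebra \<Rightarrow> ('a \<times> 'b) rat_algebra"
  (infixr \<open>\<oplus>\<^sub>\<rat>\<close> 65) where
  "A \<oplus>\<^sub>\<rat> B = ring.extend (RDirProd A B)
     (module.fields (\<lambda>q (x, y). (q \<odot>\<^bsub>A\<^esub> x, q \<odot>\<^bsub>B\<^esub> y)))"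

definition algebra_copies :: "nat \<Rightarrow> 'a rat_algebra \<Rightarrow> (nat \<Rightarrow> 'a) rat_algebra" where
  "algebra_copies a A = \<lparr>
     carrier = (\<Pi>\<^sub>E i\<in>{..<a}. carrier A),
     monoid.mult = (\<lambda>f g. \<lambda>i\<in>{..<a}. f i \<otimes>\<^bsub>A\<^esub> g i),
     one = (\<lambda>i\<in>{..<a}. \<one>\<^bsub>A\<^esub>),
     ring.zero = (\<lambda>i\<in>{..<a}. \<zero>\<^bsub>A\<^esub>),
     ring.add = (\<lambda>f g. \<lambda>i\<in>{..<a}. f i \<oplus>\<^bsub>A\<^esub> g i),
     module.smult = (\<lambda>q f. \<lambda>i\<in>{..<a}. q \<odot>\<^bsub>A\<^esub> f i)\<rparr>"

text \<open>The group algebra \<open>\<rat>G\<close>: finitely supported functions on \<open>G\<close> under convolution.\<close>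

definition rat_group_algebra :: "('a, 'b) monoid_scheme \<Rightarrow> ('a \<Rightarrow> rat) rat_algebra" where
  "rat_group_algebra G = \<lparr>
     carrier = {f. finite {x. f x \<noteq> 0} \<and> {x. f x \<noteq> 0} \<subseteq> carrier G},
     monoid.mult = (\<lambda>f g x. if x \<in> carrier G
                     then \<Sum>y | f y \<noteq> 0. f y * g (inv\<^bsub>G\<^esub> y \<otimes>\<^bsub>G\<^esub> x) else 0),
     one = (\<lambda>x. if x = \<one>\<^bsub>G\<^esub> then 1 else 0),
     ring.zero = (\<lambda>x. 0),
     ring.add = (\<lambda>f g x. f x + g x),
     module.smult = (\<lambda>q f x. q * f x)\<rparr>"

text \<open>The cyclotomic field \<open>\<rat>(\<zeta>\<^sub>d)\<close> is the subfield of \<open>\<complex>\<close> generated by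
  \<open>\<zeta>\<^sub>d = exp (2\<pi>\<i>/d)\<close>; it contains \<open>\<rat>\<close> because every subfield does.\<close>

definition cyclotomic_field :: "nat \<Rightarrow> complex set" where
  "cyclotomic_field d = generate_field ring_of_type_algebra {cis (2 * pi / real d)}"

definition matrix_algebra :: "nat \<Rightarrow> complex set \<Rightarrow> complex mat rat_algebra" where
  "matrix_algebra n K = (ring_mat TYPE(complex) n (module.fields (\<lambda>q A. of_rat q \<cdot>\<^sub>m A)))
     \<lparr>carrier := {A \<in> carrier_mat n n. elements_mat A \<subseteq> K}\<rparr>"

end

theory Submission
  imports Defs "HOL-Library.Function_Algebras" "Jordan_Normal_Form.Char_Poly"
begin

text \<open>
  In a group \<open>G\<close> of order \<open>p\<^sup>5\<close> in \<open>\<Phi>\<^sub>1\<^sub>0\<close> lifts of \<open>\<alpha>\<close>, \<open>\<alpha>\<^sub>1\<close> and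
  the commutators \<open>a\<^sub>2\<close>, \<open>a\<^sub>3\<close>, \<open>a\<^sub>4\<close> of these lifts give a chain \<open>Z(G) < C\<^sub>3 < E < N < G\<close> of normal
  subgroups, adjoining \<open>a\<^sub>3\<close>, \<open>a\<^sub>2\<close>, \<open>a\<^sub>1\<close> and the lift \<open>a\<close> of \<open>\<alpha>\<close> in turn, each step of index \<open>p\<close>, and \<open>E = G'\<close>.
  A linear character that is stable under the next generator extends over that step. Inducing suitable
  linear characters of \<open>N\<close> (trivial on the centre, nontrivial on \<open>E\<close>) and of a subgroup of order \<open>p\<^sup>3\<close>
  (faithful on the centre) yields monomial representations over cyclotomic fields, and hence a homomorphism
  from \<open>\<rat>G\<close> to the right-hand side. An element of its kernel is peeled down the chain: each family of
  characters forces it to be invariant under one more step, until the component at \<open>\<rat>(G/G')\<close> kills it.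
  Both sides have rational dimension \<open>p\<^sup>5\<close>, so injectivity suffices. For \<open>p = 3\<close> the relation
  \<open>a\<^sub>1\<^sup>3 a\<^sub>3 \<in> Z(G)\<close> makes the extensions to \<open>N\<close> of a character that is nontrivial on \<open>a\<^sub>3\<close> take values in
  \<open>\<rat>(\<zeta>\<^sub>9)\<close>, where one block replaces \<open>p\<close> of them.

  The isoclinism transports the commutator relations to \<open>G\<close>, and the power relations modulo the centre.
  That \<open>\<alpha>\<^sub>4 \<noteq> 1\<close> holds in the presented group is seen in a permutation model.
\<close>

subsection \<open>Roots of unity over the rationals\<close>

text \<open>No irreducibility, Schur index or Galois descent is ever established. Elements of QG
  have rational coefficients, so a vanishing sum against one character already carries the vanishing
  against its Galois conjugates; the rational relations among \<open>p\<close>-th and ninth roots of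
  unity do this work. The other side is only bounded above in dimension: for
  \<open>p \<ge> 5\<close> by p^2 + (p + 1) p^2 (p - 1) + p^4 (p - 1) = p^5, for
  \<open>p = 3\<close> by 9 + 18 + 54 + 162 = 243. One obstacle shapes the case
  \<open>p = 3\<close>. There a_2^3 is the inverse of a_4, so a faithful character of the centre
  takes a value of order 9 at \<open>a2\<close> in any extension, which leaves the field of cube
  roots of unity. It is extended along \<open>a3\<close> and \<open>a1\<close> instead: since a_1^3
  a_3 is central, the free value at \<open>a3\<close> can be chosen so that a_1^3 is sent to 1. For
  \<open>p \<ge> 5\<close> the \<open>p\<close>-th power of \<open>a2\<close> is 1, and
  \<open>a2\<close> serves.\<close>

abbreviation eval_int_poly :: "int poly \<Rightarrow> complex \<Rightarrow> complex" where
  "eval_int_poly f x \<equiv> poly (of_int_poly f) x"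

text \<open>Modulo \<open>p\<close> the monic \<open>f\<close> is a power of X. The first
  coefficient of \<open>g\<close> that survives modulo \<open>p\<close> meets the surviving constant
  term of \<open>h\<close>, so its index cannot lie below the degree of \<open>f\<close>. The
  statement is asymmetric in the factors so that either one can take either role below.\<close>

lemma eisenstein_degree_factor:
  fixes f g h :: "int poly" and p :: int
  assumes p: "Factorial_Ring.prime p" and fgh: "f = g * h"
    and monic: "Polynomial.lead_coeff f = 1"
    and dv: "\<And>i. i < Polynomial.degree f \<Longrightarrow> p dvd poly.coeff f i"
    and h0: "\<not> p dvd poly.coeff h 0"
  shows "Polynomial.degree f \<le> Polynomial.degree g"
proof -
  have "Polynomial.lead_coeff g * Polynomial.lead_coeff h = 1"
    using monic by (simp add: fgh lead_coeff_mult)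
  then have "\<not> p dvd Polynomial.lead_coeff g"
    using p by (metis dvd_mult2 not_prime_unit)
  then have ex: "\<exists>i. \<not> p dvd poly.coeff g i" by blast
  define i where "i = (LEAST i. \<not> p dvd poly.coeff g i)"
  have gi: "\<not> p dvd poly.coeff g i" unfolding i_def by (rule LeastI_ex[OF ex])
  have below: "p dvd poly.coeff g j" if "j < i" for j
    using not_less_Least that unfolding i_def by blast
  have "poly.coeff f i = (\<Sum>j<i. poly.coeff g j * poly.coeff h (i - j)) + poly.coeff g i * poly.coeff h 0"
    unfolding fgh coeff_mult by (simp add: lessThan_Suc_atMost[symmetric])
  moreover have "p dvd (\<Sum>j<i. poly.coeff g j * poly.coeff h (i - j))"
    by (intro dvd_sum) (simp add: below)
  moreover have "\<not> p dvd poly.coeff g i * poly.coeff h 0"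
    using gi h0 p by (simp add: prime_dvd_mult_iff)
  ultimately have "\<not> p dvd poly.coeff f i"
    by (simp add: dvd_add_right_iff)
  then have "\<not> i < Polynomial.degree f" using dv by blast
  moreover have "i \<le> Polynomial.degree g" using gi le_degree by force
  ultimately show ?thesis by simp
qed

text \<open>Eisenstein's criterion as a lower bound for the degree of every integer polynomial
  vanishing at \<open>x\<close>. One of least degree, made primitive, divides \<open>f\<close> over
  the integers, and Eisenstein's argument leaves no room for a proper factor.\<close>

lemma eisenstein_minimal_degree:
  fixes f g :: "int poly" and p :: int
  assumes p: "Factorial_Ring.prime p"
    and monic: "Polynomial.lead_coeff f = 1"
    and dv: "\<And>i. i < Polynomial.degree f \<Longrightarrow> p dvd poly.coeff f i"
    and p2: "\<not> p ^ 2 dvd poly.coeff f 0"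
    and f0: "eval_int_poly f x = 0" and g0: "eval_int_poly g x = 0" and g: "g \<noteq> 0"
  shows "Polynomial.degree f \<le> Polynomial.degree g"
proof -
  define S where "S = {n. \<exists>g. g \<noteq> 0 \<and> eval_int_poly g x = 0 \<and> Polynomial.degree g = n}"
  define n where "n = (LEAST n. n \<in> S)"
  have "Polynomial.degree g \<in> S" using g g0 by (auto simp: S_def)
  then have nS: "n \<in> S" and ng: "n \<le> Polynomial.degree g"
    unfolding n_def by (auto intro: LeastI Least_le)
  obtain k where k: "k \<noteq> 0" "eval_int_poly k x = 0" "Polynomial.degree k = n"
    using nS by (auto simp: S_def)
  define m where "m = primitive_part k"
  have km: "k = Polynomial.smult (content k) m" by (simp add: m_def)
  have m: "m \<noteq> 0" "Polynomial.degree m = n" "content m = 1"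
    using k by (auto simp: m_def)
  have "eval_int_poly (Polynomial.smult (content k) m) x = 0"
    using k(2) km by metis
  then have m0: "eval_int_poly m x = 0"
    using k(1) by (simp add: of_int_hom.map_poly_hom_smult)
  \<comment> \<open>Pseudo-division stays within integer polynomials; the remainder vanishes at
    \<open>x\<close> and is too short, hence zero.\<close>
  obtain a q where a: "a \<noteq> 0" "Polynomial.smult a f = m * q + pseudo_mod f m"
    using pseudo_mod(1)[OF m(1)] by blast
  have "eval_int_poly (Polynomial.smult a f) x = eval_int_poly (m * q + pseudo_mod f m) x"
    using a(2) by simp
  then have r0: "eval_int_poly (pseudo_mod f m) x = 0"
    by (simp add: of_int_poly_hom.hom_mult of_int_poly_hom.hom_add of_int_hom.map_poly_hom_smult f0 m0)
  have "pseudo_mod f m = 0"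
  proof (rule ccontr)
    assume nz: "pseudo_mod f m \<noteq> 0"
    then have "Polynomial.degree (pseudo_mod f m) < n" using pseudo_mod(2)[OF m(1), of f] m(2) by simp
    moreover have "Polynomial.degree (pseudo_mod f m) \<in> S" using nz r0 by (auto simp: S_def)
    ultimately show False using not_less_Least unfolding n_def by blast
  qed
  with a(2) have aq: "Polynomial.smult a f = m * q" by simp
  \<comment> \<open>Gauss: \<open>m\<close> is primitive, so the factor \<open>a\<close> introduced
    by pseudo-division divides \<open>q\<close> and cancels.\<close>
  have "\<bar>a\<bar> * content f = content q"
    using arg_cong[OF aq, of content] m(3) by (simp add: content_mult)
  then have "\<bar>a\<bar> dvd content q" by (metis dvd_triv_left)
  then have "[:a:] dvd q" by (simp add: const_poly_dvd_iff_dvd_content)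
  then obtain h where h: "q = [:a:] * h" by (rule dvdE)
  have fmh: "f = m * h"
    using aq a(1) unfolding h by (simp add: poly_eq_iff)
  have c0: "poly.coeff f 0 = poly.coeff m 0 * poly.coeff h 0"
    by (simp add: fmh coeff_mult)
  have "f \<noteq> 0" using monic by auto
  have "\<not> (p dvd poly.coeff m 0 \<and> p dvd poly.coeff h 0)"
    using p2 by (auto simp: c0 power2_eq_square intro: mult_dvd_mono)
  then consider "\<not> p dvd poly.coeff h 0" | "\<not> p dvd poly.coeff m 0" by blast
  then show ?thesis
  proof cases
    case 1
    then show ?thesis using eisenstein_degree_factor[OF p fmh monic dv] ng m(2) by simp
  next
    case 2
    \<comment> \<open>Here the cofactor \<open>h\<close> has full degree, so \<open>m\<close> is a
      nonzero constant and cannot vanish at \<open>x\<close>.\<close>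
    have "f = h * m" using fmh by simp
    from eisenstein_degree_factor[OF p this monic dv 2]
    have "Polynomial.degree f \<le> Polynomial.degree h" .
    moreover have "Polynomial.degree f = Polynomial.degree m + Polynomial.degree h"
      using \<open>f \<noteq> 0\<close> unfolding fmh by (intro degree_mult_eq) auto
    ultimately have "Polynomial.degree m = 0" by simp
    then obtain c where "m = [:c:]" by (rule degree_eq_zeroE)
    then show ?thesis using m0 m(1) by simp
  qed
qed

lemma int_poly_of_rat_coeffs:
  fixes q :: "nat \<Rightarrow> rat"
  obtains g d where "d > 0" "\<And>k. of_int (poly.coeff g k) = (if k < n then of_int d * q k else 0)"
proof -
  define d where "d = (\<Prod>k<n. snd (quotient_of (q k)))"
  have d: "d > 0" unfolding d_def by (intro prod_pos) (simp add: quotient_of_denom_pos')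
  have "\<exists>z::int. of_int z = of_int d * q k" if "k < n" for k
  proof -
    have "snd (quotient_of (q k)) dvd d"
      unfolding d_def using that by (intro dvd_prodI) auto
    then obtain e where e: "d = snd (quotient_of (q k)) * e" by (rule dvdE)
    obtain m n where mn: "quotient_of (q k) = (m, n)" by fastforce
    have "q k = of_int m / of_int n" "n > 0"
      using quotient_of_div[OF mn] quotient_of_denom_pos[OF mn] by auto
    moreover have "d = n * e" using e by (simp add: mn)
    ultimately have "of_int (m * e) = of_int d * q k" by simp
    then show ?thesis by metis
  qed
  then obtain z where z: "\<And>k. k < n \<Longrightarrow> of_int (z k) = of_int d * q k" by metis
  define g where "g = (\<Sum>k<n. monom (z k) k)"
  have "poly.coeff g k = (if k < n then z k else 0)" for k
    by (simp add: g_def coeff_sum)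
  then show thesis using that[of d g] d z by auto
qed

text \<open>Clearing denominators in a rational relation among the first \<open>n\<close> powers
  gives an integer polynomial with coefficients only below \<open>n\<close> that vanishes at
  \<open>x\<close>.\<close>

lemma powers_rat_independent:
  fixes f :: "int poly" and q :: "nat \<Rightarrow> rat"
  assumes min: "\<And>g. g \<noteq> 0 \<Longrightarrow> eval_int_poly g x = 0 \<Longrightarrow> n \<le> Polynomial.degree g"
    and sum0: "(\<Sum>k<n. of_rat (q k) * x ^ k) = 0" and "k < n"
  shows "q k = 0"
proof -
  obtain g d where d: "d > 0" and g: "\<And>k. of_int (poly.coeff g k) = (if k < n then of_int d * q k else 0)"
    using int_poly_of_rat_coeffs by metis
  have gn: "poly.coeff g k = 0" if "k \<ge> n" for k
    using g[of k] that by simp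
  have gC: "(of_int (poly.coeff g k) :: complex) = of_int d * of_rat (q k)" if "k < n" for k
    using arg_cong[OF g[of k], of "of_rat :: rat \<Rightarrow> complex"] that by (simp add: of_rat_mult)
  have "eval_int_poly g x = (\<Sum>k<n. of_int (poly.coeff g k) * x ^ k)"
  proof -
    have "eval_int_poly g x = (\<Sum>k\<le>Polynomial.degree g. of_int (poly.coeff g k) * x ^ k)"
      by (simp add: poly_altdef)
    also have "\<dots> = (\<Sum>k<n + Suc (Polynomial.degree g). of_int (poly.coeff g k) * x ^ k)"
      by (intro sum.mono_neutral_left) (auto intro: coeff_eq_0)
    also have "\<dots> = (\<Sum>k<n. of_int (poly.coeff g k) * x ^ k)"
      by (intro sum.mono_neutral_right) (auto simp: gn)
    finally show ?thesis .
  qed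
  also have "\<dots> = of_int d * (\<Sum>k<n. of_rat (q k) * x ^ k)"
    by (simp add: gC sum_distrib_left mult.assoc)
  finally have "eval_int_poly g x = 0" using sum0 by simp
  then have "g = 0"
    using min[of g] gn[of "Polynomial.degree g"] by fastforce
  then show ?thesis using g[of k] d \<open>k < n\<close> by simp
qed

text \<open>The cyclotomic polynomials in question are Eisenstein only after X is replaced by X + 1,
  which moves the root from \<open>x\<close> to \<open>x - 1\<close> and leaves degrees
  alone.\<close>

lemma shifted_eisenstein_minimal_degree:
  fixes f g :: "int poly" and p :: int
  assumes "Factorial_Ring.prime p"
    and "Polynomial.lead_coeff (f \<circ>\<^sub>p [:1, 1:]) = 1"
    and "\<And>i. i < Polynomial.degree f \<Longrightarrow> p dvd poly.coeff (f \<circ>\<^sub>p [:1, 1:]) i"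
    and "\<not> p ^ 2 dvd poly.coeff (f \<circ>\<^sub>p [:1, 1:]) 0"
    and "eval_int_poly f x = 0" "g \<noteq> 0" "eval_int_poly g x = 0"
  shows "Polynomial.degree f \<le> Polynomial.degree g"
proof -
  have shift: "eval_int_poly (h \<circ>\<^sub>p [:1, 1:]) (x - 1) = eval_int_poly h x" for h
    by (simp add: of_int_hom.map_poly_pcompose poly_pcompose)
  have deg: "Polynomial.degree (h \<circ>\<^sub>p [:1, 1:]) = Polynomial.degree h" for h :: "int poly"
    by (simp add: degree_pcompose)
  have "g \<circ>\<^sub>p [:1, 1:] \<noteq> 0"
    using assms(6) by (simp add: pcompose_eq_0_iff)
  then have "Polynomial.degree (f \<circ>\<^sub>p [:1, 1:]) \<le> Polynomial.degree (g \<circ>\<^sub>p [:1, 1:])"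
    using assms by (intro eisenstein_minimal_degree[of p _ "x - 1"]) (auto simp: shift deg)
  then show ?thesis by (simp add: deg)
qed

lemma prime_root_of_unity_minimal_degree:
  fixes g :: "int poly" and x :: complex
  assumes p: "Factorial_Ring.prime (p::nat)" and x: "x ^ p = 1" "x \<noteq> 1"
    and g: "g \<noteq> 0" "eval_int_poly g x = 0"
  shows "p - 1 \<le> Polynomial.degree g"
proof -
  have p1: "p > 1" using p prime_gt_1_nat by blast
  define f :: "int poly" where "f = (\<Sum>k<p. monom 1 k)"
  have coeff_f: "poly.coeff f k = (if k < p then 1 else 0)" for k
    by (simp add: f_def coeff_sum)
  have deg: "Polynomial.degree f = p - 1"
    using p1 by (intro antisym degree_le le_degree) (auto simp: coeff_f)
  have ev: "eval_int_poly f x = (\<Sum>k<p. x ^ k)"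
    by (simp add: f_def of_int_poly_hom.hom_sum poly_sum poly_monom)
  have f0: "eval_int_poly f x = 0"
    using x by (simp add: ev sum_gp_strict)
  define h where "h = f \<circ>\<^sub>p [:1, 1:]"
  have "f = (\<Sum>k<p. [:0, 1:] ^ k)" by (simp add: f_def monom_altdef)
  then have hs: "h = (\<Sum>k<p. [:1, 1:] ^ k)"
    unfolding h_def by (simp add: pcompose_sum pcompose_hom.hom_power pcompose_pCons)
  \<comment> \<open>\<open>h\<close> is ((1 + X)^p - 1) / X, so its coefficients are the binomials p
    choose i + 1: \<open>p\<close> divides all but the leading one, and the constant term is
    \<open>p\<close> itself.\<close>
  have "[:0, 1:] * h = [:1, 1:] ^ p - 1"
    using power_diff_1_eq[of "[:1, 1 :: int:]" p] unfolding hs by (simp add: one_pCons)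
  then have "poly.coeff ([:0, 1:] * h) (Suc i) = poly.coeff ([:1, 1:] ^ p - 1) (Suc i)" for i
    by simp
  then have coeff_h: "poly.coeff h i = int (p choose Suc i)" if "i < p" for i
    using coeff_linear_poly_power[of "Suc i" p "1::int" 1] that by (simp add: one_pCons coeff_pCons)
  have degh: "Polynomial.degree h = p - 1" unfolding h_def by (simp add: degree_pcompose deg)
  have "Polynomial.degree f \<le> Polynomial.degree g"
  proof (rule shifted_eisenstein_minimal_degree[of "int p" f x g])
    show "Factorial_Ring.prime (int p)" using p by simp
    show "Polynomial.lead_coeff (f \<circ>\<^sub>p [:1, 1:]) = 1"
      unfolding h_def[symmetric] degh using p1 by (simp add: coeff_h)
    show "int p dvd poly.coeff (f \<circ>\<^sub>p [:1, 1:]) i" if "i < Polynomial.degree f" for i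
      unfolding h_def[symmetric] using that p by (auto simp: coeff_h deg intro!: dvd_choose_prime)
    have "\<not> int p * int p dvd int p"
      using p1 by (simp add: zdvd_not_zless)
    then show "\<not> (int p)\<^sup>2 dvd poly.coeff (f \<circ>\<^sub>p [:1, 1:]) 0"
      unfolding h_def[symmetric] using p1 by (simp add: coeff_h power2_eq_square)
  qed (use f0 g in auto)
  then show ?thesis by (simp add: deg)
qed

lemma ninth_root_of_unity_minimal_degree:
  fixes g :: "int poly" and x :: complex
  assumes x: "x ^ 6 + x ^ 3 + 1 = 0" and g: "g \<noteq> 0" "eval_int_poly g x = 0"
  shows "6 \<le> Polynomial.degree g"
proof -
  define f :: "int poly" where "f = [:1, 0, 0, 1, 0, 0, 1:]"
  \<comment> \<open>The shifted ninth cyclotomic polynomial: 3 divides every coefficient but the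
    leading one, and 9 does not divide the constant term.\<close>
  have h: "f \<circ>\<^sub>p [:1, 1:] = [:3, 9, 18, 21, 15, 6, 1:]"
    by (simp add: f_def pcompose_pCons)
  have deg: "Polynomial.degree f = 6" by (simp add: f_def)
  have "Polynomial.degree f \<le> Polynomial.degree g"
  proof (rule shifted_eisenstein_minimal_degree[of 3 f x g])
    show "3 dvd poly.coeff (f \<circ>\<^sub>p [:1, 1:]) i" if "i < Polynomial.degree f" for i
    proof -
      have "i \<in> {0, 1, 2, 3, 4, 5}" using that deg by auto
      then show ?thesis by (auto simp: h coeff_pCons split: nat.split)
    qed
    show "eval_int_poly f x = 0"
      using x by (simp add: f_def algebra_simps eval_nat_numeral)
  qed (use g in \<open>auto simp: h\<close>)
  then show ?thesis by (simp add: deg)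
qed

lemma prime_root_power_ne_1:
  fixes w :: complex and p :: nat
  assumes p: "Factorial_Ring.prime p" and w: "w ^ p = 1" "w \<noteq> 1" and i: "\<not> p dvd i"
  shows "w ^ i \<noteq> 1"
proof
  assume i1: "w ^ i = 1"
  have "coprime p i" using i by (rule prime_imp_coprime[OF p])
  then have "coprime i p" by (subst coprime_commute)
  then obtain j k where jk: "i * j = p * k + 1" using coprime_bezout_strong[of i p] p
    by (metis One_nat_def not_prime_1)
  have "w ^ (i * j) = w ^ (p * k) * w" by (simp add: jk)
  then show False using i1 w by (simp add: power_mult)
qed

text \<open>All \<open>p\<close> powers are involved, one more than are independent, and the only
  relation is that their sum vanishes. Subtracting the last coefficient times this sum leaves the
  first \<open>p - 1\<close> powers.\<close>

lemma prime_root_of_unity_rat_relation: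
  fixes q :: "nat \<Rightarrow> rat" and x :: complex
  assumes p: "Factorial_Ring.prime (p::nat)" and x: "x ^ p = 1" "x \<noteq> 1"
    and s: "(\<Sum>k<p. of_rat (q k) * x ^ k) = 0" and k: "k < p"
  shows "q k = q 0"
proof -
  obtain n where n: "p = Suc n" using p by (metis not0_implies_Suc not_prime_0)
  have g0: "(\<Sum>k<p. x ^ k) = 0" using x by (simp add: sum_gp_strict)
  have "(\<Sum>k<p. of_rat (q k - q n) * x ^ k) = (\<Sum>k<p. of_rat (q k) * x ^ k) - of_rat (q n) * (\<Sum>k<p. x ^ k)"
    by (simp add: of_rat_diff left_diff_distrib sum_subtractf sum_distrib_left)
  then have "(\<Sum>k<n. of_rat (q k - q n) * x ^ k) = 0" using s g0 by (simp add: n)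
  then have "q k = q n" if "k < n" for k
    using powers_rat_independent[of x n "\<lambda>k. q k - q n"] prime_root_of_unity_minimal_degree[OF p x] that n
    by auto
  then show ?thesis using k n by (metis less_Suc_eq not_gr_zero)
qed

text \<open>Each residue class of exponents modulo 3 carries its own relation x^(k+6) + x^(k+3) +
  x^k = 0. Only the class of 0 is recorded, because its exponents are those of the values taken on
  the derived subgroup.\<close>

lemma ninth_root_of_unity_rat_relation:
  fixes q :: "nat \<Rightarrow> rat" and x :: complex
  assumes x: "x ^ 6 + x ^ 3 + 1 = 0" and s: "(\<Sum>k<9. of_rat (q k) * x ^ k) = 0"
  shows "q 0 = q 6" "q 3 = q 6"
proof -
  have x3: "x ^ (6 + i) = - (x ^ (3 + i)) - x ^ i" for i
  proof -
    have "x ^ 6 = (x ^ 6 + x ^ 3 + 1) - x ^ 3 - 1" by simp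
    also have "\<dots> = - (x ^ 3) - 1" by (simp only: x) simp
    finally have "x ^ 6 = - (x ^ 3) - 1" .
    then show ?thesis by (simp only: power_add) (simp add: algebra_simps)
  qed
  have e: "x ^ 6 = - (x ^ 3) - 1" "x ^ 7 = - (x ^ 4) - x" "x ^ 8 = - (x ^ 5) - x ^ 2"
    using x3[of 0] x3[of 1] x3[of 2] by simp_all
  \<comment> \<open>Each of the powers 6, 7, 8 is rewritten as minus the two lower powers of its
    class, so the coefficient at \<open>k < 6\<close> loses the one at
    \<open>6 + k mod 3\<close>.\<close>
  have "(\<Sum>k<6. of_rat (q k - q (6 + k mod 3)) * x ^ k) = (\<Sum>k<9. of_rat (q k) * x ^ k)"
    by (simp add: lessThan_nat_numeral lessThan_Suc of_rat_diff e) (simp add: algebra_simps)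
  then have "q k - q (6 + k mod 3) = 0" if "k < 6" for k
    using powers_rat_independent[of x 6 "\<lambda>k. q k - q (6 + k mod 3)"]
      ninth_root_of_unity_minimal_degree[OF x] that s by auto
  from this[of 0] this[of 3] show "q 0 = q 6" "q 3 = q 6" by auto
qed

section \<open>Dimension counting and rational spans of complex numbers\<close>

lemma injective_linear_onto_span:
  assumes lin: "Vector_Spaces.linear sA sB L" and ind: "\<not> module.dependent sA A"
    and inj: "inj_on L (module.span sA A)" and sub: "L ` module.span sA A \<subseteq> module.span sB T"
    and fin: "finite A" "finite T" and card: "card T \<le> card A"
  shows "module.span sB T \<subseteq> L ` module.span sA A"
proof -
  interpret Vector_Spaces.linear sA sB L by (rule lin)
  have indB: "vs2.independent (L ` A)"
    using ind inj by (rule independent_injective_image)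
  have "inj_on L A" using inj vs1.span_superset by (rule inj_on_subset)
  then have cardB: "card (L ` A) = card A" by (rule card_image)
  have "L ` A \<subseteq> vs2.span T" using sub vs1.span_superset[of A] by blast
  \<comment> \<open>Otherwise \<open>x\<close> could be added to the independent image of
    \<open>A\<close>, which already has at least as many elements as the spanning set
    \<open>T\<close>.\<close>
  have "x \<in> vs2.span (L ` A)" if x: "x \<in> vs2.span T" for x
  proof (rule ccontr)
    assume nx: "x \<notin> vs2.span (L ` A)"
    then have "vs2.independent (insert x (L ` A))" using indB by (rule vs2.independent_insertI)
    then have "card (insert x (L ` A)) \<le> card T"
      using vs2.independent_span_bound[OF fin(2)] x \<open>L ` A \<subseteq> vs2.span T\<close> by blast
    moreover have "x \<notin> L ` A" using nx vs2.span_base by blast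
    ultimately show False using fin card cardB by simp
  qed
  then show ?thesis by (auto simp: span_image)
qed

interpretation rat_complex: vector_space "\<lambda>(q::rat) (x::complex). of_rat q * x"
  by unfold_locales (simp_all add: algebra_simps of_rat_add of_rat_mult)

declare rat_complex.scale_scale [simp del]

text \<open>Multiplication by a nonzero \<open>y\<close> is an injective endomorphism of a
  finite-dimensional space, hence onto, and 1 is among its values.\<close>

lemma rat_subalgebra_inverse_closed:
  fixes S :: "complex set"
  assumes S: "finite S" and mult: "\<And>y z. y \<in> rat_complex.span S \<Longrightarrow> z \<in> rat_complex.span S \<Longrightarrow> y * z \<in> rat_complex.span S"
    and one: "1 \<in> rat_complex.span S" and y: "y \<in> rat_complex.span S"
  shows "inverse y \<in> rat_complex.span S"
proof (cases "y = 0")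
  case True
  then show ?thesis by (simp add: rat_complex.span_zero)
next
  case False
  obtain A where A: "A \<subseteq> S" "rat_complex.independent A" "S \<subseteq> rat_complex.span A"
    using rat_complex.maximal_independent_subset[of S] by blast
  have sp: "rat_complex.span A = rat_complex.span S"
    using A by (metis rat_complex.span_mono rat_complex.span_minimal rat_complex.subspace_span subset_antisym)
  have lin: "Vector_Spaces.linear (\<lambda>(q::rat) (x::complex). of_rat q * x) (\<lambda>q x. of_rat q * x) ((*) y)"
    unfolding Vector_Spaces.linear_iff
    by (intro conjI allI rat_complex.vector_space_axioms) (simp_all add: algebra_simps)
  have "rat_complex.span A \<subseteq> (*) y ` rat_complex.span A"
    using A S False mult y
    by (intro injective_linear_onto_span[OF lin]) (auto simp: sp intro: inj_onI finite_subset)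
  then obtain z where "z \<in> rat_complex.span S" "1 = y * z" using one sp by auto
  then show ?thesis using False by (metis inverse_unique)
qed

text \<open>The relation for \<open>x ^ m\<close> keeps the span of the first \<open>m\<close>
  powers stable under multiplication by \<open>x\<close>, hence under all products; being
  finite-dimensional it also contains inverses, and so the whole generated field. Spanning is
  enough, since only an upper bound for the dimension is wanted.\<close>

lemma generate_field_rat_span:
  fixes x :: complex
  assumes m: "m > 0" and xm: "x ^ m = (\<Sum>k<m. of_rat (r k) * x ^ k)"
    and y: "y \<in> generate_field ring_of_type_algebra {x}"
  shows "\<exists>q. y = (\<Sum>k<m. of_rat (q k) * x ^ k)"
proof -
  interpret K: field "ring_of_type_algebra :: complex ring" by (rule field_from_type_algebra)
  define S where "S = (\<lambda>k. x ^ k) ` {..<m}"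
  let ?W = "rat_complex.span S"
  have S: "finite S" by (simp add: S_def)
  have gen: "x ^ k \<in> ?W" if "k < m" for k
    using that by (auto simp: S_def intro: rat_complex.span_base)
  have "x ^ m \<in> ?W"
    unfolding xm using gen by (intro rat_complex.span_sum rat_complex.span_scale) auto
  then have gen': "x ^ Suc k \<in> ?W" if "k < m" for k
    using gen[of "Suc k"] \<open>x ^ m \<in> ?W\<close> that by (metis Suc_lessI)
  have xW: "x * z \<in> ?W" if "z \<in> ?W" for z
    using that
  proof (induction rule: rat_complex.span_induct_alt)
    case (step c u z)
    have "x * u \<in> ?W" using step(1) gen' by (auto simp: S_def)
    then have "of_rat c * (x * u) + x * z \<in> ?W"
      using step by (intro rat_complex.span_add rat_complex.span_scale) auto
    then show ?case by (simp add: algebra_simps)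
  qed (simp add: rat_complex.span_zero)
  have powW: "x ^ k * z \<in> ?W" if "z \<in> ?W" for k z
    using that xW by (induction k) (auto simp: mult.assoc)
  have mult: "u * z \<in> ?W" if "u \<in> ?W" "z \<in> ?W" for u z
    using that(1)
  proof (induction rule: rat_complex.span_induct_alt)
    case (step c v u)
    have "v * z \<in> ?W" using step(1) powW[OF that(2)] by (auto simp: S_def)
    then have "of_rat c * (v * z) + u * z \<in> ?W"
      using step by (intro rat_complex.span_add rat_complex.span_scale) auto
    then show ?case by (simp add: algebra_simps)
  qed (simp add: rat_complex.span_zero)
  have one: "1 \<in> ?W" using gen[of 0] m by simp
  have "y \<in> ?W"
    using y
  proof (induction rule: generate_field.induct)
    case one
    then show ?case using \<open>1 \<in> ?W\<close> by (simp add: ring_of_type_algebra_def)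
  next
    case (incl h)
    then show ?case using xW[OF one] by simp
  next
    case (a_inv h)
    have "\<ominus>\<^bsub>ring_of_type_algebra\<^esub> h = - h"
      by (rule K.minus_equality) (auto simp: ring_of_type_algebra_def)
    then show ?case using a_inv rat_complex.span_neg by simp
  next
    case (m_inv h)
    then have "inv\<^bsub>ring_of_type_algebra\<^esub> h = inverse h"
      by (intro K.comm_inv_char) (auto simp: ring_of_type_algebra_def)
    then show ?case using rat_subalgebra_inverse_closed[OF S mult one m_inv.IH] by simp
  next
    case (eng_add h1 h2)
    then show ?case by (simp add: ring_of_type_algebra_def rat_complex.span_add)
  next
    case (eng_mult h1 h2)
    then show ?case by (simp add: ring_of_type_algebra_def mult)
  qed
  then show ?thesis
  proof (induction rule: rat_complex.span_induct_alt)
    case base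
    show ?case by (rule exI[of _ "\<lambda>_. 0"]) simp
  next
    case (step c u z)
    obtain j where j: "j < m" "u = x ^ j" using step(1) by (auto simp: S_def)
    obtain q where q: "z = (\<Sum>k<m. of_rat (q k) * x ^ k)" using step(2) by blast
    have "(\<Sum>k<m. of_rat (q k + (if k = j then c else 0)) * x ^ k) = of_rat c * u + z"
    proof -
      have "(\<Sum>k<m. of_rat (q k + (if k = j then c else 0)) * x ^ k)
        = (\<Sum>k<m. of_rat (q k) * x ^ k + (if k = j then of_rat c * x ^ k else 0))"
        by (intro sum.cong) (auto simp: of_rat_add algebra_simps)
      then show ?thesis using j by (simp add: sum.distrib q)
    qed
    then show ?case by metis
  qed
qed

subsection \<open>Isomorphisms out of a group algebra by dimension count\<close>

interpretation rat_fun: vector_space "\<lambda>(q::rat) (c::'i \<Rightarrow> rat) i. q * c i"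
  by unfold_locales (simp_all add: fun_eq_iff algebra_simps)

text \<open>The coordinate space with index set \<open>I\<close>, realised by functions on the whole
  type so that subsets of one type can serve as index sets.\<close>

definition rat_supp :: "'i set \<Rightarrow> ('i \<Rightarrow> rat) set" where
  "rat_supp I = {c. \<forall>i. i \<notin> I \<longrightarrow> c i = 0}"

definition rat_delta :: "'i \<Rightarrow> 'i \<Rightarrow> rat" where
  "rat_delta i = (\<lambda>j. if j = i then 1 else 0)"

lemma sum_fun_apply: "(\<Sum>i\<in>I. F i) j = (\<Sum>i\<in>I. F i j)"
  by (induction I rule: infinite_finite_induct) simp_all

lemma sum_rat_delta:
  assumes "finite I"
  shows "(\<Sum>i\<in>I. (\<lambda>j. c i * rat_delta i j)) = (\<lambda>j. if j \<in> I then c j else 0)"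
proof
  fix j
  show "(\<Sum>i\<in>I. (\<lambda>j. c i * rat_delta i j)) j = (if j \<in> I then c j else 0)"
    using assms by (simp add: sum_fun_apply rat_delta_def if_distrib[of "(*) _"] cong: if_cong)
qed

lemma inj_rat_delta: "inj rat_delta"
  by (rule injI) (metis rat_delta_def zero_neq_one)

lemma span_rat_delta:
  assumes "finite I"
  shows "rat_fun.span (rat_delta ` I) = rat_supp I"
proof
  show "rat_fun.span (rat_delta ` I) \<subseteq> rat_supp I"
    by (rule rat_fun.span_minimal) (auto simp: rat_supp_def rat_delta_def rat_fun.subspace_def)
  show "rat_supp I \<subseteq> rat_fun.span (rat_delta ` I)"
  proof
    fix c :: "'a \<Rightarrow> rat" assume c: "c \<in> rat_supp I"
    have "c = (\<Sum>i\<in>I. (\<lambda>j. c i * rat_delta i j))"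
      using c by (auto simp: sum_rat_delta[OF assms] rat_supp_def)
    also have "\<dots> \<in> rat_fun.span (rat_delta ` I)"
      by (intro rat_fun.span_sum rat_fun.span_scale rat_fun.span_base) auto
    finally show "c \<in> rat_fun.span (rat_delta ` I)" .
  qed
qed

lemma independent_rat_delta:
  assumes "finite I"
  shows "rat_fun.independent (rat_delta ` I)"
proof (subst rat_fun.independent_explicit_finite_subsets, intro allI impI ballI)
  fix S u v assume S: "S \<subseteq> rat_delta ` I" "finite S" and s: "(\<Sum>v\<in>S. (\<lambda>i. u v * v i)) = 0" and v: "v \<in> S"
  obtain J where J: "S = rat_delta ` J" "J \<subseteq> I" using S by (meson subset_imageE)
  have fJ: "finite J" using J(2) assms by (rule finite_subset)
  obtain i where i: "i \<in> J" "v = rat_delta i" using v J by blast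
  have "(\<Sum>v\<in>S. (\<lambda>i. u v * v i)) = (\<Sum>i\<in>J. (\<lambda>j. u (rat_delta i) * rat_delta i j))"
    unfolding J using inj_rat_delta by (subst sum.reindex) (auto intro: inj_on_subset)
  then show "u v = 0"
    using s i sum_rat_delta[OF fJ, of "\<lambda>i. u (rat_delta i)"] by (metis zero_fun_apply)
qed

lemma injective_rat_fun_onto:
  fixes L :: "('g \<Rightarrow> rat) \<Rightarrow> 'i \<Rightarrow> rat"
  assumes fin: "finite A" "finite I" and card: "card I \<le> card A"
    and add: "\<And>c d. L (\<lambda>x. c x + d x) = (\<lambda>i. L c i + L d i)"
    and scale: "\<And>q c. L (\<lambda>x. q * c x) = (\<lambda>i. q * L c i)"
    and supp: "\<And>c. c \<in> rat_supp A \<Longrightarrow> L c \<in> rat_supp I"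
    and inj: "inj_on L (rat_supp A)"
  shows "rat_supp I \<subseteq> L ` rat_supp A"
proof -
  have "Vector_Spaces.linear (\<lambda>(q::rat) c (i::'g). q * c i) (\<lambda>q c (i::'i). q * c i) L"
    using add scale
    by (simp add: Vector_Spaces.linear_iff rat_fun.vector_space_axioms plus_fun_def)
  then have "rat_fun.span (rat_delta ` I) \<subseteq> L ` rat_fun.span (rat_delta ` A)"
    using fin card inj supp
    by (intro injective_linear_onto_span)
      (auto simp: independent_rat_delta span_rat_delta card_image inj_on_subset[OF inj_rat_delta])
  then show ?thesis using fin by (simp add: span_rat_delta)
qed

text \<open>Bounds the dimension of \<open>A\<close> by the size of \<open>I\<close> without a
  vector space structure on the record \<open>A\<close>: coordinate vectors are mapped linearly and
  cover the carrier, possibly with redundancy.\<close>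

definition rat_spans :: "'a rat_algebra \<Rightarrow> 'i set \<Rightarrow> (('i \<Rightarrow> rat) \<Rightarrow> 'a) \<Rightarrow> bool" where
  "rat_spans A I s \<longleftrightarrow>
     (\<forall>c d. s (\<lambda>i. c i + d i) = s c \<oplus>\<^bsub>A\<^esub> s d) \<and>
     (\<forall>q c. s (\<lambda>i. q * c i) = q \<odot>\<^bsub>A\<^esub> s c) \<and>
     carrier A \<subseteq> s ` rat_supp I"

lemma algebra_sum_simps:
  "carrier (A \<oplus>\<^sub>\<rat> B) = carrier A \<times> carrier B"
  "(x, y) \<otimes>\<^bsub>A \<oplus>\<^sub>\<rat> B\<^esub> (x', y') = (x \<otimes>\<^bsub>A\<^esub> x', y \<otimes>\<^bsub>B\<^esub> y')"
  "\<one>\<^bsub>A \<oplus>\<^sub>\<rat> B\<^esub> = (\<one>\<^bsub>A\<^esub>, \<one>\<^bsub>B\<^esub>)"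
  "(x, y) \<oplus>\<^bsub>A \<oplus>\<^sub>\<rat> B\<^esub> (x', y') = (x \<oplus>\<^bsub>A\<^esub> x', y \<oplus>\<^bsub>B\<^esub> y')"
  "q \<odot>\<^bsub>A \<oplus>\<^sub>\<rat> B\<^esub> (x, y) = (q \<odot>\<^bsub>A\<^esub> x, q \<odot>\<^bsub>B\<^esub> y)"
  by (simp_all add: algebra_sum_def RDirProd_def DirProd_def monoid.extend_def ring.extend_def module.fields_def)

lemma rat_spans_sum:
  assumes A: "rat_spans A I s" and B: "rat_spans B J t"
  shows "rat_spans (A \<oplus>\<^sub>\<rat> B) (I <+> J) (\<lambda>c. (s (c \<circ> Inl), t (c \<circ> Inr)))"
proof -
  have "\<exists>c\<in>rat_supp (I <+> J). (x, y) = (s (c \<circ> Inl), t (c \<circ> Inr))"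
    if xy: "x \<in> carrier A" "y \<in> carrier B" for x y
  proof -
    obtain c d where cd: "c \<in> rat_supp I" "x = s c" "d \<in> rat_supp J" "y = t d"
      using A B xy unfolding rat_spans_def by blast
    then have "case_sum c d \<in> rat_supp (I <+> J)"
      by (auto simp: rat_supp_def split: sum.split)
    then show ?thesis using cd by (intro bexI[of _ "case_sum c d"]) (auto simp: o_def)
  qed
  then show ?thesis
    using A B by (auto simp: rat_spans_def algebra_sum_simps o_def)
qed

lemma rat_spans_copies:
  assumes A: "rat_spans A I s"
  shows "rat_spans (algebra_copies a A) ({..<a} \<times> I) (\<lambda>c. \<lambda>i\<in>{..<a}. s (\<lambda>k. c (i, k)))"
proof -
  have "\<exists>c\<in>rat_supp ({..<a} \<times> I). x = (\<lambda>i\<in>{..<a}. s (\<lambda>k. c (i, k)))"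
    if x: "x \<in> (\<Pi>\<^sub>E i\<in>{..<a}. carrier A)" for x
  proof -
    have "\<exists>c. c \<in> rat_supp I \<and> x i = s c" if "i < a" for i
      using A x that unfolding rat_spans_def by blast
    then obtain c where c: "\<And>i. i < a \<Longrightarrow> c i \<in> rat_supp I \<and> x i = s (c i)" by metis
    define d where "d = (\<lambda>(i, k). if i < a then c i k else 0)"
    have "d \<in> rat_supp ({..<a} \<times> I)" using c by (auto simp: d_def rat_supp_def)
    moreover have "x = (\<lambda>i\<in>{..<a}. s (\<lambda>k. d (i, k)))"
      using x c by (auto simp: d_def fun_eq_iff PiE_iff extensional_def restrict_def)
    ultimately show ?thesis by blast
  qed
  then have "carrier (algebra_copies a A) \<subseteq> (\<lambda>c. \<lambda>i\<in>{..<a}. s (\<lambda>k. c (i, k))) ` rat_supp ({..<a} \<times> I)"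
    by (simp add: algebra_copies_def image_iff subset_eq del: PiE_iff)
  then show ?thesis
    using A unfolding rat_spans_def by (simp add: algebra_copies_def fun_eq_iff)
qed

lemma smult_matrix_algebra: "q \<odot>\<^bsub>matrix_algebra n K\<^esub> M = of_rat q \<cdot>\<^sub>m M"
  by (simp add: matrix_algebra_def ring_mat_def module.fields_def)

lemma rat_spans_matrix:
  assumes K: "\<And>y. y \<in> K \<Longrightarrow> \<exists>q. y = (\<Sum>k<m. of_rat (q k) * x ^ k)"
  shows "rat_spans (matrix_algebra n K) (({..<n} \<times> {..<n}) \<times> {..<m})
    (\<lambda>c. mat n n (\<lambda>ij. \<Sum>k<m. of_rat (c (ij, k)) * x ^ k))"
proof -
  let ?s = "\<lambda>c. mat n n (\<lambda>ij. \<Sum>k<m. of_rat (c (ij, k)) * x ^ k)"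
  have "\<exists>c\<in>rat_supp (({..<n} \<times> {..<n}) \<times> {..<m}). M = ?s c"
    if M: "M \<in> carrier_mat n n" "elements_mat M \<subseteq> K" for M
  proof -
    have "\<exists>q. M $$ ij = (\<Sum>k<m. of_rat (q k) * x ^ k)" if "ij \<in> {..<n} \<times> {..<n}" for ij
      using that M by (intro K) (force simp: elements_mat_def)
    then obtain q where q: "\<And>ij. ij \<in> {..<n} \<times> {..<n} \<Longrightarrow> M $$ ij = (\<Sum>k<m. of_rat (q ij k) * x ^ k)"
      by metis
    define c where "c = (\<lambda>(ij, k). if ij \<in> {..<n} \<times> {..<n} \<and> k < m then q ij k else 0)"
    have "c \<in> rat_supp (({..<n} \<times> {..<n}) \<times> {..<m})" by (auto simp: c_def rat_supp_def)
    moreover have "M = ?s c"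
      using M q by (intro eq_matI) (auto simp: c_def)
    ultimately show ?thesis by blast
  qed
  then have cover: "carrier (matrix_algebra n K) \<subseteq> ?s ` rat_supp (({..<n} \<times> {..<n}) \<times> {..<m})"
    by (auto simp: matrix_algebra_def image_iff)
  have "?s (\<lambda>i. c i + d i) = ?s c \<oplus>\<^bsub>matrix_algebra n K\<^esub> ?s d" for c d
    by (rule eq_matI) (simp_all add: matrix_algebra_def ring_mat_def of_rat_add distrib_right sum.distrib)
  moreover have "?s (\<lambda>i. q * c i) = of_rat q \<cdot>\<^sub>m ?s c" for q c
    by (rule eq_matI) (auto simp: of_rat_mult mult.assoc sum_distrib_left)
  ultimately show ?thesis
    using cover unfolding rat_spans_def smult_matrix_algebra by blast
qed

lemma rat_spans_group_algebra:
  "rat_spans (rat_group_algebra G) (carrier G) (\<lambda>c x. if x \<in> carrier G then c x else 0)"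
proof -
  have "f \<in> (\<lambda>c x. if x \<in> carrier G then c x else 0) ` rat_supp (carrier G)"
    if "{x. f x \<noteq> 0} \<subseteq> carrier G" for f
    using that by (intro image_eqI[of _ _ f]) (auto simp: rat_supp_def fun_eq_iff)
  then show ?thesis
    by (auto simp: rat_spans_def rat_group_algebra_def fun_eq_iff)
qed

text \<open>Surjectivity comes from a dimension count. On the group algebra \<open>h\<close> factors
  as \<open>s\<close> after a linear map \<open>L\<close> into coordinates, and \<open>L\<close>
  inherits injectivity from \<open>h\<close>; so \<open>L\<close> reaches every coordinate vector,
  and \<open>h\<close> every element of \<open>A\<close>.\<close>

lemma rat_group_algebra_isoI:
  assumes G: "group G" "finite (carrier G)"
    and h: "h \<in> Ring.ring_hom (rat_group_algebra G) A"
    and smult: "\<And>q f. f \<in> carrier (rat_group_algebra G) \<Longrightarrow> h (q \<odot>\<^bsub>rat_group_algebra G\<^esub> f) = q \<odot>\<^bsub>A\<^esub> h f"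
    and inj: "inj_on h (carrier (rat_group_algebra G))"
    and s: "rat_spans A I s" and I: "finite I" "card I \<le> card (carrier G)"
  shows "rat_group_algebra G \<cong>\<^sub>\<rat> A"
proof -
  let ?QG = "rat_group_algebra G"
  have car: "carrier ?QG = rat_supp (carrier G)"
    using G(2) by (auto simp: rat_group_algebra_def rat_supp_def intro: finite_subset)
  have hA: "h f \<in> carrier A" if "f \<in> carrier ?QG" for f
    using h that by (auto simp: Ring.ring_hom_def)
  have delta: "rat_delta g \<in> carrier ?QG" if "g \<in> carrier G" for g
    using that by (auto simp: car rat_supp_def rat_delta_def)
  have sadd: "s (\<lambda>i. c i + d i) = s c \<oplus>\<^bsub>A\<^esub> s d" and sscale: "s (\<lambda>i. q * c i) = q \<odot>\<^bsub>A\<^esub> s c"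
    and ssurj: "x \<in> carrier A \<Longrightarrow> \<exists>c. c \<in> rat_supp I \<and> s c = x" for c d q x
    using s unfolding rat_spans_def by blast+
  have "\<exists>c. c \<in> rat_supp I \<and> s c = h (rat_delta g)" if "g \<in> carrier G" for g
    using ssurj hA delta that by blast
  then obtain c where c: "\<And>g. g \<in> carrier G \<Longrightarrow> c g \<in> rat_supp I \<and> s (c g) = h (rat_delta g)"
    by metis
  \<comment> \<open>Coordinates are chosen for the images of the group elements and extended
    linearly; as \<open>s\<close> may be redundant, \<open>L\<close> is one of possibly many lifts
    of \<open>h\<close>.\<close>
  define L where "L = (\<lambda>f i. \<Sum>g\<in>carrier G. f g * c g i)"
  have part: "s (\<lambda>i. \<Sum>g\<in>S. f g * c g i) = h (\<lambda>x. if x \<in> S then f x else 0)"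
    if "finite S" "S \<subseteq> carrier G" for S and f :: "'a \<Rightarrow> rat"
    using that
  proof (induction S rule: finite_induct)
    case empty
    have one: "\<one>\<^bsub>G\<^esub> \<in> carrier G" using G(1) by (simp add: group.is_monoid)
    \<comment> \<open>\<open>A\<close> comes without additive group axioms, so the empty sum is
      reached on both sides as 0 times a basis element.\<close>
    have "s (\<lambda>i. 0 * c \<one>\<^bsub>G\<^esub> i) = h (0 \<odot>\<^bsub>?QG\<^esub> rat_delta \<one>\<^bsub>G\<^esub>)"
      using one by (simp only: sscale c smult delta)
    then show ?case by (simp add: rat_group_algebra_def)
  next
    case (insert g S)
    let ?r = "\<lambda>x. if x \<in> S then f x else 0"
    have r: "?r \<in> carrier ?QG" using insert by (auto simp: car rat_supp_def)
    have d: "f g \<odot>\<^bsub>?QG\<^esub> rat_delta g \<in> carrier ?QG"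
      using insert by (auto simp: car rat_supp_def rat_group_algebra_def rat_delta_def)
    have "s (\<lambda>i. \<Sum>g\<in>insert g S. f g * c g i) = s (\<lambda>i. f g * c g i) \<oplus>\<^bsub>A\<^esub> s (\<lambda>i. \<Sum>g\<in>S. f g * c g i)"
      using insert by (simp add: sadd)
    also have "\<dots> = h (f g \<odot>\<^bsub>?QG\<^esub> rat_delta g) \<oplus>\<^bsub>A\<^esub> h ?r"
      using insert by (simp add: sscale c smult delta)
    also have "\<dots> = h (f g \<odot>\<^bsub>?QG\<^esub> rat_delta g \<oplus>\<^bsub>?QG\<^esub> ?r)"
      using h d r by (simp add: Ring.ring_hom_def)
    also have "f g \<odot>\<^bsub>?QG\<^esub> rat_delta g \<oplus>\<^bsub>?QG\<^esub> ?r = (\<lambda>x. if x \<in> insert g S then f x else 0)"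
      using insert by (auto simp: rat_group_algebra_def rat_delta_def)
    finally show ?case .
  qed
  have sL: "s (L f) = h f" if "f \<in> carrier ?QG" for f
  proof -
    have "(\<lambda>x. if x \<in> carrier G then f x else 0) = f"
      using that by (auto simp: car rat_supp_def)
    then show ?thesis using part[of "carrier G" f] G(2) by (simp add: L_def)
  qed
  have "rat_supp I \<subseteq> L ` rat_supp (carrier G)"
  proof (rule injective_rat_fun_onto[OF G(2) I])
    show "inj_on L (rat_supp (carrier G))"
      using inj sL by (metis car inj_on_def)
    show "L f \<in> rat_supp I" if "f \<in> rat_supp (carrier G)" for f
      using c by (simp add: L_def rat_supp_def)
  qed (simp_all add: L_def fun_eq_iff algebra_simps sum.distrib sum_distrib_left)
  then have "carrier A \<subseteq> h ` carrier ?QG"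
    using ssurj sL car by (smt (verit, best) image_iff subset_iff)
  then have "bij_betw h (carrier ?QG) (carrier A)"
    using inj hA by (auto simp: bij_betw_def)
  then have "h \<in> rat_algebra_iso ?QG A"
    using h smult by (simp add: rat_algebra_iso_def ring_iso_def)
  then show ?thesis by (auto simp: rat_algebra_isomorphic_def)
qed

section \<open>Homomorphisms out of a rational group algebra\<close>

definition rat_algebra_hom :: "'a rat_algebra \<Rightarrow> 'b rat_algebra \<Rightarrow> ('a \<Rightarrow> 'b) set" where
  "rat_algebra_hom A B =
     {h \<in> Ring.ring_hom A B. \<forall>q. \<forall>x\<in>carrier A. h (q \<odot>\<^bsub>A\<^esub> x) = q \<odot>\<^bsub>B\<^esub> h x}"

lemma rat_algebra_hom_sum:
  assumes "h \<in> rat_algebra_hom R A" "k \<in> rat_algebra_hom R B"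
  shows "(\<lambda>x. (h x, k x)) \<in> rat_algebra_hom R (A \<oplus>\<^sub>\<rat> B)"
  using assms
  by (auto simp: rat_algebra_hom_def Ring.ring_hom_def algebra_sum_simps)

lemma rat_algebra_hom_copies:
  assumes "\<And>i. i < a \<Longrightarrow> h i \<in> rat_algebra_hom R A"
  shows "(\<lambda>x. \<lambda>i\<in>{..<a}. h i x) \<in> rat_algebra_hom R (algebra_copies a A)"
proof -
  have "h i x \<in> carrier A" if "i < a" "x \<in> carrier R" for i x
    using assms[OF that(1)] that(2) by (auto simp: rat_algebra_hom_def Ring.ring_hom_def)
  then show ?thesis
    using assms
    by (simp add: rat_algebra_hom_def Ring.ring_hom_def algebra_copies_def fun_eq_iff restrict_def PiE_def extensional_def)
qed

lemma rat_group_algebra_mult: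
  assumes "group G" "finite (carrier G)" and f: "f \<in> carrier (rat_group_algebra G)" and x: "x \<in> carrier G"
  shows "(f \<otimes>\<^bsub>rat_group_algebra G\<^esub> g) x = (\<Sum>y\<in>carrier G. f y * g (inv\<^bsub>G\<^esub> y \<otimes>\<^bsub>G\<^esub> x))"
  using assms by (auto simp: rat_group_algebra_def intro!: sum.mono_neutral_left)

lemma (in group) sum_left_translate:
  assumes "y \<in> carrier G"
  shows "(\<Sum>x\<in>carrier G. F (inv y \<otimes> x) x) = (\<Sum>z\<in>carrier G. F z (y \<otimes> z))"
  using assms
  by (intro sum.reindex_bij_witness[of _ "\<lambda>z. y \<otimes> z" "\<lambda>x. inv y \<otimes> x"])
    (auto simp: m_assoc[symmetric])

text \<open>The linear extension of \<open>\<pi>\<close> to the group algebras: coefficients are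
  summed over fibres.\<close>

definition rat_group_algebra_map :: "('a, 'b) monoid_scheme \<Rightarrow> ('c, 'd) monoid_scheme \<Rightarrow> ('a \<Rightarrow> 'c) \<Rightarrow> ('a \<Rightarrow> rat) \<Rightarrow> 'c \<Rightarrow> rat" where
  "rat_group_algebra_map G H \<pi> f = (\<lambda>w. \<Sum>x | x \<in> carrier G \<and> \<pi> x = w. f x)"

lemma rat_group_algebra_map_hom:
  assumes G: "group G" "finite (carrier G)" and H: "group H" "finite (carrier H)" and \<pi>: "\<pi> \<in> hom G H"
  shows "rat_group_algebra_map G H \<pi> \<in> rat_algebra_hom (rat_group_algebra G) (rat_group_algebra H)"
proof -
  interpret G: group G by fact
  interpret H: group H by fact
  let ?m = "rat_group_algebra_map G H \<pi>"
  have \<pi>H: "\<pi> x \<in> carrier H" if "x \<in> carrier G" for x using \<pi> that by (rule hom_in_carrier)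
  have supp: "{w. ?m f w \<noteq> 0} \<subseteq> carrier H" for f
    by (auto simp: rat_group_algebra_map_def intro!: sum.neutral dest: \<pi>H)
  have mapped: "?m f \<in> carrier (rat_group_algebra H)" for f
    using supp H(2) by (auto simp: rat_group_algebra_def intro: finite_subset)
  have fib: "?m f w = (\<Sum>x\<in>carrier G. if \<pi> x = w then f x else 0)" for f w
    using G(2) by (simp add: rat_group_algebra_map_def sum.If_cases Int_def)
  have "?m (f \<otimes>\<^bsub>rat_group_algebra G\<^esub> g) w = (?m f \<otimes>\<^bsub>rat_group_algebra H\<^esub> ?m g) w"
    if f: "f \<in> carrier (rat_group_algebra G)" for f g w
  proof (cases "w \<in> carrier H")
    case True
    have "?m (f \<otimes>\<^bsub>rat_group_algebra G\<^esub> g) w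
      = (\<Sum>x\<in>carrier G. \<Sum>y\<in>carrier G. if \<pi> x = w then f y * g (inv\<^bsub>G\<^esub> y \<otimes>\<^bsub>G\<^esub> x) else 0)"
      unfolding fib by (intro sum.cong) (auto simp: rat_group_algebra_mult[OF G f])
    also have "\<dots> = (\<Sum>y\<in>carrier G. \<Sum>z\<in>carrier G. if \<pi> (y \<otimes>\<^bsub>G\<^esub> z) = w then f y * g z else 0)"
    proof (subst sum.swap, rule sum.cong[OF HOL.refl])
      fix y assume "y \<in> carrier G"
      then show "(\<Sum>x\<in>carrier G. if \<pi> x = w then f y * g (inv\<^bsub>G\<^esub> y \<otimes>\<^bsub>G\<^esub> x) else 0)
        = (\<Sum>z\<in>carrier G. if \<pi> (y \<otimes>\<^bsub>G\<^esub> z) = w then f y * g z else 0)"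
        by (rule G.sum_left_translate[where F = "\<lambda>z x. if \<pi> x = w then f y * g z else 0"])
    qed
    also have "\<dots> = (\<Sum>y\<in>carrier G. \<Sum>z\<in>carrier G. if \<pi> z = inv\<^bsub>H\<^esub> \<pi> y \<otimes>\<^bsub>H\<^esub> w then f y * g z else 0)"
      using True by (intro sum.cong HOL.refl if_cong) (auto simp: hom_mult[OF \<pi>] \<pi>H H.inv_solve_left)
    also have "\<dots> = (\<Sum>y\<in>carrier G. f y * ?m g (inv\<^bsub>H\<^esub> \<pi> y \<otimes>\<^bsub>H\<^esub> w))"
      unfolding fib by (intro sum.cong HOL.refl) (auto simp: sum_distrib_left intro!: sum.cong)
    \<comment> \<open>A one-term sum over the possible values \<open>v\<close> of
      \<open>\<pi> y\<close> is inserted so that the \<open>y\<close> can be regrouped by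
      fibres.\<close>
    also have "\<dots> = (\<Sum>y\<in>carrier G. \<Sum>v\<in>carrier H. if \<pi> y = v then f y * ?m g (inv\<^bsub>H\<^esub> v \<otimes>\<^bsub>H\<^esub> w) else 0)"
      using H(2) by (intro sum.cong HOL.refl) (simp add: \<pi>H)
    also have "\<dots> = (\<Sum>v\<in>carrier H. ?m f v * ?m g (inv\<^bsub>H\<^esub> v \<otimes>\<^bsub>H\<^esub> w))"
      unfolding fib[of f] by (subst sum.swap) (auto simp: sum_distrib_right intro!: sum.cong)
    also have "\<dots> = (?m f \<otimes>\<^bsub>rat_group_algebra H\<^esub> ?m g) w"
      using True by (simp add: rat_group_algebra_mult[OF H mapped])
    finally show ?thesis .
  next
    case False
    then have "?m f w = 0" for f using supp by blast
    with False show ?thesis by (simp add: rat_group_algebra_def)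
  qed
  moreover have "?m \<one>\<^bsub>rat_group_algebra G\<^esub> = \<one>\<^bsub>rat_group_algebra H\<^esub>"
  proof
    fix w
    have "?m \<one>\<^bsub>rat_group_algebra G\<^esub> w = (\<Sum>x\<in>carrier G. if x = \<one>\<^bsub>G\<^esub> then if \<pi> x = w then 1 else 0 else 0)"
      unfolding fib by (intro sum.cong) (auto simp: rat_group_algebra_def)
    then show "?m \<one>\<^bsub>rat_group_algebra G\<^esub> w = \<one>\<^bsub>rat_group_algebra H\<^esub> w"
      using G(2) hom_one[OF \<pi> G(1) H(1)] by (auto simp: rat_group_algebra_def)
  qed
  moreover have "?m (f \<oplus>\<^bsub>rat_group_algebra G\<^esub> g) = ?m f \<oplus>\<^bsub>rat_group_algebra H\<^esub> ?m g" for f g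
    by (simp add: rat_group_algebra_def rat_group_algebra_map_def sum.distrib)
  moreover have "?m (q \<odot>\<^bsub>rat_group_algebra G\<^esub> f) = q \<odot>\<^bsub>rat_group_algebra H\<^esub> ?m f" for q f
    by (simp add: rat_group_algebra_def rat_group_algebra_map_def sum_distrib_left)
  ultimately show ?thesis using mapped by (auto simp: rat_algebra_hom_def Ring.ring_hom_def)
qed

text \<open>Closed under what representing matrices require: their entries are added, multiplied and
  scaled by rational numbers.\<close>

definition complex_subfield :: "complex set \<Rightarrow> bool" where
  "complex_subfield K \<longleftrightarrow> (\<forall>q. of_rat q \<in> K) \<and> (\<forall>x\<in>K. \<forall>y\<in>K. x + y \<in> K) \<and> (\<forall>x\<in>K. \<forall>y\<in>K. x * y \<in> K)"

lemma complex_subfield_sum: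
  assumes "complex_subfield K" "\<And>i. i \<in> I \<Longrightarrow> f i \<in> K"
  shows "sum f I \<in> K"
proof -
  have "0 \<in> K" using assms(1) of_rat_0 unfolding complex_subfield_def by metis
  then show ?thesis using assms by (induction I rule: infinite_finite_induct) (auto simp: complex_subfield_def)
qed

definition matrix_rep :: "('a, 'b) monoid_scheme \<Rightarrow> nat \<Rightarrow> complex set \<Rightarrow> ('a \<Rightarrow> nat \<Rightarrow> nat \<Rightarrow> complex) \<Rightarrow> bool" where
  "matrix_rep G n K \<rho> \<longleftrightarrow>
     (\<forall>x\<in>carrier G. \<forall>r<n. \<forall>c<n. \<rho> x r c \<in> K) \<and>
     (\<forall>x\<in>carrier G. \<forall>y\<in>carrier G. \<forall>r<n. \<forall>c<n. \<rho> (x \<otimes>\<^bsub>G\<^esub> y) r c = (\<Sum>k<n. \<rho> x r k * \<rho> y k c)) \<and>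
     (\<forall>r<n. \<forall>c<n. \<rho> \<one>\<^bsub>G\<^esub> r c = (if r = c then 1 else 0))"

definition rep_map :: "('a, 'b) monoid_scheme \<Rightarrow> nat \<Rightarrow> ('a \<Rightarrow> nat \<Rightarrow> nat \<Rightarrow> complex) \<Rightarrow> ('a \<Rightarrow> rat) \<Rightarrow> complex mat" where
  "rep_map G n \<rho> f = mat n n (\<lambda>(r, c). \<Sum>x\<in>carrier G. of_rat (f x) * \<rho> x r c)"

lemma rep_map_hom:
  assumes G: "group G" "finite (carrier G)" and K: "complex_subfield K" and \<rho>: "matrix_rep G n K \<rho>"
  shows "rep_map G n \<rho> \<in> rat_algebra_hom (rat_group_algebra G) (matrix_algebra n K)"
proof -
  interpret G: group G by fact
  let ?m = "rep_map G n \<rho>" and ?QG = "rat_group_algebra G"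
  have ent: "?m f $$ (r, c) = (\<Sum>x\<in>carrier G. of_rat (f x) * \<rho> x r c)" if "r < n" "c < n" for f r c
    using that by (simp add: rep_map_def)
  have dim: "?m f \<in> carrier_mat n n" for f by (simp add: rep_map_def)
  have mapped: "?m f \<in> carrier (matrix_algebra n K)" for f
  proof -
    have "?m f $$ (r, c) \<in> K" if "r < n" "c < n" for r c
      using that K \<rho> unfolding ent[OF that]
      by (intro complex_subfield_sum[OF K]) (simp add: complex_subfield_def matrix_rep_def)
    then show ?thesis
      using dim[of f] by (auto simp: matrix_algebra_def ring_mat_def elements_mat_def)
  qed
  have "?m (f \<otimes>\<^bsub>?QG\<^esub> g) = ?m f * ?m g" if f: "f \<in> carrier ?QG" for f g
  proof (rule eq_matI)
    fix r c assume "r < dim_row (?m f * ?m g)" "c < dim_col (?m f * ?m g)"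
    then have rc: "r < n" "c < n" by (auto simp: rep_map_def)
    have "?m (f \<otimes>\<^bsub>?QG\<^esub> g) $$ (r, c) = (\<Sum>x\<in>carrier G. \<Sum>y\<in>carrier G. of_rat (f y) * of_rat (g (inv\<^bsub>G\<^esub> y \<otimes>\<^bsub>G\<^esub> x)) * \<rho> x r c)"
      unfolding ent[OF rc]
    proof (rule sum.cong[OF HOL.refl])
      fix x assume x: "x \<in> carrier G"
      show "of_rat ((f \<otimes>\<^bsub>?QG\<^esub> g) x) * \<rho> x r c
        = (\<Sum>y\<in>carrier G. of_rat (f y) * of_rat (g (inv\<^bsub>G\<^esub> y \<otimes>\<^bsub>G\<^esub> x)) * \<rho> x r c)"
        unfolding rat_group_algebra_mult[OF G f x] of_rat_sum of_rat_mult sum_distrib_right by (rule HOL.refl)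
    qed
    also have "\<dots> = (\<Sum>y\<in>carrier G. \<Sum>z\<in>carrier G. of_rat (f y) * of_rat (g z) * \<rho> (y \<otimes>\<^bsub>G\<^esub> z) r c)"
    proof (subst sum.swap, rule sum.cong[OF HOL.refl])
      fix y assume "y \<in> carrier G"
      then show "(\<Sum>x\<in>carrier G. of_rat (f y) * of_rat (g (inv\<^bsub>G\<^esub> y \<otimes>\<^bsub>G\<^esub> x)) * \<rho> x r c)
        = (\<Sum>z\<in>carrier G. of_rat (f y) * of_rat (g z) * \<rho> (y \<otimes>\<^bsub>G\<^esub> z) r c)"
        by (rule G.sum_left_translate[where F = "\<lambda>z x. of_rat (f y) * of_rat (g z) * \<rho> x r c"])
    qed
    also have "\<dots> = (\<Sum>y\<in>carrier G. \<Sum>z\<in>carrier G. \<Sum>k<n. of_rat (f y) * \<rho> y r k * (of_rat (g z) * \<rho> z k c))"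
      using \<rho> rc by (intro sum.cong HOL.refl) (simp add: matrix_rep_def sum_distrib_left mult.assoc mult.left_commute)
    also have "\<dots> = (\<Sum>k<n. (\<Sum>y\<in>carrier G. of_rat (f y) * \<rho> y r k) * (\<Sum>z\<in>carrier G. of_rat (g z) * \<rho> z k c))"
      unfolding sum_product by (simp only: sum.swap[where A = "carrier G" and B = "{..<n}"])
    also have "\<dots> = (\<Sum>k<n. ?m f $$ (r, k) * ?m g $$ (k, c))"
      using rc by (intro sum.cong HOL.refl) (simp add: ent)
    also have "\<dots> = (?m f * ?m g) $$ (r, c)"
      using rc dim[of f] dim[of g] by (simp add: scalar_prod_def atLeast0LessThan)
    finally show "?m (f \<otimes>\<^bsub>?QG\<^esub> g) $$ (r, c) = (?m f * ?m g) $$ (r, c)" .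
  qed (auto simp: rep_map_def)
  moreover have "?m \<one>\<^bsub>?QG\<^esub> = 1\<^sub>m n"
  proof (rule eq_matI)
    fix r c assume "r < dim_row (1\<^sub>m n :: complex mat)" "c < dim_col (1\<^sub>m n :: complex mat)"
    then have rc: "r < n" "c < n" by auto
    have "?m \<one>\<^bsub>?QG\<^esub> $$ (r, c) = (\<Sum>x\<in>carrier G. if x = \<one>\<^bsub>G\<^esub> then \<rho> x r c else 0)"
      unfolding ent[OF rc] by (intro sum.cong HOL.refl) (simp add: rat_group_algebra_def)
    then show "?m \<one>\<^bsub>?QG\<^esub> $$ (r, c) = 1\<^sub>m n $$ (r, c)"
      using rc G(2) \<rho> by (simp add: matrix_rep_def)
  qed (auto simp: rep_map_def)
  moreover have "?m (f \<oplus>\<^bsub>?QG\<^esub> g) = ?m f + ?m g" for f g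
    by (rule eq_matI)
      (auto simp: rep_map_def rat_group_algebra_def of_rat_add algebra_simps sum.distrib)
  moreover have "?m (q \<odot>\<^bsub>?QG\<^esub> f) = of_rat q \<cdot>\<^sub>m ?m f" for q f
    by (rule eq_matI)
      (auto simp: rep_map_def rat_group_algebra_def of_rat_mult mult.assoc sum_distrib_left)
  ultimately show ?thesis
    using mapped by (auto simp: rat_algebra_hom_def Ring.ring_hom_def smult_matrix_algebra) (auto simp: matrix_algebra_def ring_mat_def)
qed

subsection \<open>Monomial representations\<close>

text \<open>Extension by zero off \<open>B\<close> lets \<chi>(t_r x t_c^-1) be an entry of the
  induced representation without case distinctions.\<close>

definition linear_char :: "('a, 'b) monoid_scheme \<Rightarrow> 'a set \<Rightarrow> ('a \<Rightarrow> complex) \<Rightarrow> bool" where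
  "linear_char G B \<chi> \<longleftrightarrow> subgroup B G \<and> (\<forall>x. x \<notin> B \<longrightarrow> \<chi> x = 0) \<and>
     (\<forall>x\<in>B. \<forall>y\<in>B. \<chi> (x \<otimes>\<^bsub>G\<^esub> y) = \<chi> x * \<chi> y) \<and> \<chi> \<one>\<^bsub>G\<^esub> = 1"

text \<open>Up to nonzero factors these sums are the entries, at \<open>F\<close>, of the
  representation induced from a character \<open>\<chi>\<close>. Letting \<open>g\<close> and
  \<open>h\<close> range over the whole group removes the dependence on coset
  representatives.\<close>

definition char_null :: "('a, 'b) monoid_scheme \<Rightarrow> ('a \<Rightarrow> complex) \<Rightarrow> ('a \<Rightarrow> complex) \<Rightarrow> bool" where
  "char_null G \<chi> F \<longleftrightarrow> (\<forall>g\<in>carrier G. \<forall>h\<in>carrier G. (\<Sum>x\<in>carrier G. F (g \<otimes>\<^bsub>G\<^esub> x \<otimes>\<^bsub>G\<^esub> h) * \<chi> x) = 0)"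

context group
begin

lemma inv_cancel:
  assumes "x \<in> carrier G" "y \<in> carrier G"
  shows "inv x \<otimes> (x \<otimes> y) = y" "x \<otimes> (inv x \<otimes> y) = y"
  using assms by (simp_all add: m_assoc[symmetric])

lemmas group_word_simps = m_assoc inv_mult_group inv_cancel

lemma linear_char_subgroup: "linear_char G B \<chi> \<Longrightarrow> subgroup B G"
  by (simp add: linear_char_def)

lemma linear_char_outside: "linear_char G B \<chi> \<Longrightarrow> x \<notin> B \<Longrightarrow> \<chi> x = 0"
  by (simp add: linear_char_def)

lemma linear_char_one: "linear_char G B \<chi> \<Longrightarrow> \<chi> \<one> = 1"
  by (simp add: linear_char_def)

text \<open>One factor in \<open>B\<close> suffices: if the other lies outside, so does the product,
  and both sides vanish.\<close>

lemma linear_char_mult_left: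
  assumes \<chi>: "linear_char G B \<chi>" and x: "x \<in> B" and y: "y \<in> carrier G"
  shows "\<chi> (x \<otimes> y) = \<chi> x * \<chi> y"
proof (cases "y \<in> B")
  case False
  have sub: "subgroup B G" using \<chi> by (rule linear_char_subgroup)
  have "x \<otimes> y \<notin> B"
  proof
    assume "x \<otimes> y \<in> B"
    then have "inv x \<otimes> (x \<otimes> y) \<in> B" using sub x by (simp add: subgroup.m_closed subgroup.m_inv_closed)
    then show False using False x y sub by (simp add: m_assoc[symmetric] subgroup.mem_carrier)
  qed
  then show ?thesis using False \<chi> by (simp add: linear_char_outside)
qed (use \<chi> x in \<open>simp add: linear_char_def\<close>)

lemma linear_char_mult_right:
  assumes \<chi>: "linear_char G B \<chi>" and x: "x \<in> carrier G" and y: "y \<in> B"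
  shows "\<chi> (x \<otimes> y) = \<chi> x * \<chi> y"
proof (cases "x \<in> B")
  case False
  have sub: "subgroup B G" using \<chi> by (rule linear_char_subgroup)
  have "x \<otimes> y \<notin> B"
  proof
    assume "x \<otimes> y \<in> B"
    then have "x \<otimes> y \<otimes> inv y \<in> B" using sub y by (simp add: subgroup.m_closed subgroup.m_inv_closed)
    then show False using False x y sub by (simp add: m_assoc subgroup.mem_carrier)
  qed
  then show ?thesis using False \<chi> by (simp add: linear_char_outside)
qed (use \<chi> y in \<open>simp add: linear_char_def\<close>)

lemma linear_char_inv:
  assumes \<chi>: "linear_char G B \<chi>" and x: "x \<in> B"
  shows "\<chi> x * \<chi> (inv x) = 1"
proof -
  have "inv x \<in> B" "x \<in> carrier G"
    using \<chi> x by (auto simp: linear_char_def subgroup.m_inv_closed subgroup.mem_carrier)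
  then have "\<chi> x * \<chi> (inv x) = \<chi> (x \<otimes> inv x)"
    using \<chi> x unfolding linear_char_def by metis
  then show ?thesis using \<open>x \<in> carrier G\<close> \<chi> by (simp add: linear_char_one)
qed

lemma subgroup_transversal:
  assumes fin: "finite (carrier G)" and B: "subgroup B G" and m: "card B * m = card (carrier G)"
  obtains t :: "nat \<Rightarrow> 'a" where "\<And>r. r < m \<Longrightarrow> t r \<in> carrier G"
    "\<And>g. g \<in> carrier G \<Longrightarrow> \<exists>r<m. g \<otimes> inv t r \<in> B"
    "\<And>r s. r < m \<Longrightarrow> s < m \<Longrightarrow> t r \<otimes> inv t s \<in> B \<Longrightarrow> r = s"
proof -
  have "card B > 0"
    using fin B by (metis card_gt_0_iff empty_iff rev_finite_subset subgroup.one_closed subgroup.subset)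
  then have card: "card (rcosets B) = m"
    using lagrange[OF B, unfolded Coset.order_def] m by (metis mult.commute mult_cancel1 not_gr_zero)
  have "finite (rcosets B)"
    using fin by (auto simp: RCOSETS_def)
  then obtain C where C: "bij_betw C {..<m} (rcosets B)"
    using card ex_bij_betw_nat_finite by (metis atLeast0LessThan)
  have "\<exists>x. x \<in> carrier G \<and> C r = B #> x" if "r < m" for r
  proof -
    have "C r \<in> rcosets B" using C that by (auto simp: bij_betw_def)
    then show ?thesis by (auto simp: RCOSETS_def)
  qed
  then obtain t where t: "\<And>r. r < m \<Longrightarrow> t r \<in> carrier G \<and> C r = B #> t r" by metis
  show thesis
  proof (rule that[of t])
    show "\<exists>r<m. g \<otimes> inv t r \<in> B" if g: "g \<in> carrier G" for g
    proof -
      have "B #> g \<in> rcosets B" using B g by (auto simp: RCOSETS_def)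
      then obtain r where r: "r < m" "B #> g = C r" using C by (auto simp: bij_betw_def)
      then have "g \<in> B #> t r" using t B g by (metis rcos_self)
      then obtain b where b: "b \<in> B" "g = b \<otimes> t r" by (auto simp: r_coset_def)
      then have "g \<otimes> inv t r = b"
        using t[OF r(1)] B by (simp add: m_assoc subgroup.mem_carrier)
      then show ?thesis using b r by blast
    qed
    show "r = s" if rs: "r < m" "s < m" "t r \<otimes> inv t s \<in> B" for r s
    proof -
      have "t r = (t r \<otimes> inv t s) \<otimes> t s" using t rs by (simp add: m_assoc)
      then have "t r \<in> B #> t s" using rs(3) by (auto simp: r_coset_def)
      then have "B #> t r = B #> t s" using t rs B by (metis repr_independence)
      then have "C r = C s" using t rs by simp
      then show ?thesis using C rs by (auto simp: bij_betw_def inj_on_def)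
    qed
  qed (use t in auto)
qed

lemma sum_two_sided_translate:
  assumes "g \<in> carrier G" "h \<in> carrier G"
  shows "(\<Sum>x\<in>carrier G. F x) = (\<Sum>x\<in>carrier G. F (g \<otimes> x \<otimes> h))"
  using assms
  by (intro sum.reindex_bij_witness[of _ "\<lambda>x. g \<otimes> x \<otimes> h" "\<lambda>x. inv g \<otimes> x \<otimes> inv h"])
    (simp_all add: group_word_simps)

text \<open>The induced representation. Each row of each matrix has a single nonzero entry, and that
  entry is a value of \<open>\<chi>\<close>; hence the matrices have entries in any \<open>K\<close>
  that contains the values of \<open>\<chi>\<close>.\<close>

lemma monomial_rep:
  assumes fin: "finite (carrier G)" and \<chi>: "linear_char G B \<chi>" and m: "card B * m = card (carrier G)"
    and K: "\<And>x. \<chi> x \<in> K"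
  obtains \<rho> where "matrix_rep G m K \<rho>"
    "\<And>F. (\<And>r c. r < m \<Longrightarrow> c < m \<Longrightarrow> (\<Sum>x\<in>carrier G. F x * \<rho> x r c) = 0) \<Longrightarrow> char_null G \<chi> F"
proof -
  have B: "subgroup B G" using \<chi> by (rule linear_char_subgroup)
  obtain t where t: "\<And>r. r < m \<Longrightarrow> t r \<in> carrier G"
    and ex: "\<And>g. g \<in> carrier G \<Longrightarrow> \<exists>r<m. g \<otimes> inv t r \<in> B"
    and uniq: "\<And>r s. r < m \<Longrightarrow> s < m \<Longrightarrow> t r \<otimes> inv t s \<in> B \<Longrightarrow> r = s"
    using subgroup_transversal[OF fin B m] by metis
  define \<rho> where "\<rho> x r c = \<chi> (t r \<otimes> x \<otimes> inv t c)" for x r c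
  have mult: "\<rho> (x \<otimes> y) r c = (\<Sum>k<m. \<rho> x r k * \<rho> y k c)"
    if xy: "x \<in> carrier G" "y \<in> carrier G" and rc: "r < m" "c < m" for x y r c
  proof -
    obtain k where k: "k < m" "t r \<otimes> x \<otimes> inv t k \<in> B" using ex t xy rc by (meson m_closed)
    have "\<rho> x r j = 0" if j: "j < m" "j \<noteq> k" for j
    proof (rule ccontr)
      assume "\<rho> x r j \<noteq> 0"
      then have "t r \<otimes> x \<otimes> inv t j \<in> B" using \<chi> unfolding \<rho>_def by (meson linear_char_outside)
      then have "inv (t r \<otimes> x \<otimes> inv t j) \<otimes> (t r \<otimes> x \<otimes> inv t k) \<in> B"
        using k B by (simp add: subgroup.m_closed subgroup.m_inv_closed)
      moreover have "inv (t r \<otimes> x \<otimes> inv t j) \<otimes> (t r \<otimes> x \<otimes> inv t k) = t j \<otimes> inv t k"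
        using t rc xy j k by (simp add: group_word_simps)
      ultimately show False using uniq j k by simp
    qed
    then have "(\<Sum>j<m. \<rho> x r j * \<rho> y j c) = (\<Sum>j<m. if j = k then \<rho> x r k * \<rho> y k c else 0)"
      by (intro sum.cong) auto
    also have "\<dots> = \<rho> x r k * \<rho> y k c" using k by simp
    also have "\<dots> = \<chi> (t r \<otimes> x \<otimes> inv t k \<otimes> (t k \<otimes> y \<otimes> inv t c))"
      unfolding \<rho>_def using \<chi> k t rc xy by (simp add: linear_char_mult_left)
    also have "t r \<otimes> x \<otimes> inv t k \<otimes> (t k \<otimes> y \<otimes> inv t c) = t r \<otimes> (x \<otimes> y) \<otimes> inv t c"
      using t[OF rc(1)] t[OF rc(2)] t[OF k(1)] xy
      by (simp add: group_word_simps)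
    finally show ?thesis by (simp add: \<rho>_def)
  qed
  have one: "\<rho> \<one> r c = (if r = c then 1 else 0)" if "r < m" "c < m" for r c
  proof (cases "r = c")
    case True
    then show ?thesis using that t \<chi> by (simp add: \<rho>_def linear_char_one)
  next
    case False
    then have "t r \<otimes> inv t c \<notin> B" using uniq that by blast
    then show ?thesis using False that t \<chi> by (simp add: \<rho>_def linear_char_outside)
  qed
  show thesis
  proof (rule that[of \<rho>])
    show "matrix_rep G m K \<rho>"
      using mult one K by (simp add: matrix_rep_def \<rho>_def)
    fix F :: "'a \<Rightarrow> complex"
    assume zero: "\<And>r c. r < m \<Longrightarrow> c < m \<Longrightarrow> (\<Sum>x\<in>carrier G. F x * \<rho> x r c) = 0"
    show "char_null G \<chi> F"
      unfolding char_null_def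
    proof (intro ballI)
      fix g h assume gh: "g \<in> carrier G" "h \<in> carrier G"
      \<comment> \<open>Representatives are chosen with t_r g and h t_c^-1 in \<open>B\<close>.
        Translating the sum for the entry (r, c) by \<open>g\<close> and \<open>h\<close> then costs
        only the invertible factors \<open>\<chi> b\<close> and
        \<open>\<chi> (inv d)\<close>.\<close>
      obtain r where r: "r < m" "inv g \<otimes> inv t r \<in> B" using ex gh by (meson inv_closed)
      obtain c where c: "c < m" "h \<otimes> inv t c \<in> B" using ex gh by blast
      note tr = t[OF r(1)] and tc = t[OF c(1)]
      define b where "b = inv (inv g \<otimes> inv t r)"
      have b: "b \<in> B" "b = t r \<otimes> g"
        using subgroup.m_inv_closed[OF B r(2)] tr gh by (simp_all add: b_def inv_mult_group)
      define d where "d = inv (h \<otimes> inv t c)"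
      have d: "d \<in> B" "inv d \<in> B" "d = t c \<otimes> inv h"
        using subgroup.m_inv_closed[OF B c(2)] c(2) tc gh by (simp_all add: d_def inv_mult_group)
      have bd: "b \<in> carrier G" "d \<in> carrier G" using b d B by (auto simp: subgroup.mem_carrier)
      have "0 = (\<Sum>x\<in>carrier G. F x * \<rho> x r c)" using zero r c by simp
      also have "\<dots> = (\<Sum>x\<in>carrier G. F (g \<otimes> x \<otimes> h) * \<chi> (t r \<otimes> (g \<otimes> x \<otimes> h) \<otimes> inv t c))"
        unfolding \<rho>_def by (rule sum_two_sided_translate[OF gh])
      also have "\<dots> = (\<Sum>x\<in>carrier G. F (g \<otimes> x \<otimes> h) * \<chi> x) * (\<chi> b * \<chi> (inv d))"
        unfolding sum_distrib_right
      proof (intro sum.cong HOL.refl)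
        fix x assume x: "x \<in> carrier G"
        have "t r \<otimes> (g \<otimes> x \<otimes> h) \<otimes> inv t c = b \<otimes> (x \<otimes> inv d)"
          using x tr tc gh by (simp add: b d group_word_simps)
        also have "\<chi> \<dots> = \<chi> b * (\<chi> x * \<chi> (inv d))"
          using \<chi> b d x bd by (simp add: linear_char_mult_left linear_char_mult_right)
        finally show "F (g \<otimes> x \<otimes> h) * \<chi> (t r \<otimes> (g \<otimes> x \<otimes> h) \<otimes> inv t c) = F (g \<otimes> x \<otimes> h) * \<chi> x * (\<chi> b * \<chi> (inv d))"
          by simp
      qed
      finally show "(\<Sum>x\<in>carrier G. F (g \<otimes> x \<otimes> h) * \<chi> x) = 0"
        using linear_char_inv[OF \<chi> b(1)] linear_char_inv[OF \<chi> d(1)] by auto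
    qed
  qed
qed

text \<open>The character of the representation induced from \<open>\<chi>\<close> vanishes outside \<open>C\<close>: it is a class function,
  and it is multiplied by \<open>\<chi> c \<noteq> 1\<close> when its argument \<open>x\<close> is conjugated to \<open>x c\<close>.\<close>

lemma char_null_central:
  assumes fin: "finite (carrier G)" and \<chi>: "linear_char G B \<chi>" and C: "C \<subseteq> B"
    and inv: "\<And>c t. c \<in> C \<Longrightarrow> t \<in> carrier G \<Longrightarrow> \<chi> (inv t \<otimes> c \<otimes> t) = \<chi> c \<and> inv t \<otimes> c \<otimes> t \<in> C"
    and move: "\<And>x. x \<in> B - C \<Longrightarrow> \<exists>u\<in>carrier G. \<exists>c\<in>C. inv u \<otimes> x \<otimes> u = x \<otimes> c \<and> \<chi> c \<noteq> 1"
    and F: "char_null G \<chi> F" and g: "g \<in> carrier G"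
  shows "(\<Sum>c\<in>C. F (g \<otimes> c) * \<chi> c) = 0"
proof -
  have B: "subgroup B G" using \<chi> by (rule linear_char_subgroup)
  have CG: "C \<subseteq> carrier G" using C B by (auto dest: subgroup.mem_carrier)
  \<comment> \<open>The induced character up to the factor \<open>card B\<close>, as the conjugating
    elements run through the whole group and not only through coset representatives.\<close>
  define \<Theta> where "\<Theta> x = (\<Sum>t\<in>carrier G. \<chi> (inv t \<otimes> x \<otimes> t))" for x
  have conj_inv: "\<Theta> (inv u \<otimes> x \<otimes> u) = \<Theta> x" if "u \<in> carrier G" "x \<in> carrier G" for u x
    unfolding \<Theta>_def using that
    by (intro sum.reindex_bij_witness[of _ "\<lambda>t. inv u \<otimes> t" "\<lambda>t. u \<otimes> t"])
      (simp_all add: group_word_simps)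
  have twist: "\<Theta> (x \<otimes> c) = \<Theta> x * \<chi> c" if "x \<in> carrier G" "c \<in> C" for x c
    unfolding \<Theta>_def sum_distrib_right
  proof (intro sum.cong HOL.refl)
    fix t assume t: "t \<in> carrier G"
    have c: "c \<in> carrier G" using that CG by blast
    have "inv t \<otimes> (x \<otimes> c) \<otimes> t = inv t \<otimes> x \<otimes> t \<otimes> (inv t \<otimes> c \<otimes> t)"
      using t c that by (simp add: group_word_simps)
    moreover have "inv t \<otimes> c \<otimes> t \<in> B" using inv[OF that(2) t] C by blast
    ultimately show "\<chi> (inv t \<otimes> (x \<otimes> c) \<otimes> t) = \<chi> (inv t \<otimes> x \<otimes> t) * \<chi> c"
      using inv[OF that(2) t] \<chi> t that by (simp add: linear_char_mult_right)
  qed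
  have vanishB: "\<Theta> x = 0" if "x \<in> B - C" for x
  proof -
    obtain u c where uc: "u \<in> carrier G" "c \<in> C" "inv u \<otimes> x \<otimes> u = x \<otimes> c" "\<chi> c \<noteq> 1"
      using move[OF \<open>x \<in> B - C\<close>] by blast
    have x: "x \<in> carrier G" using that B by (auto dest: subgroup.mem_carrier)
    have "\<Theta> x = \<Theta> x * \<chi> c" using conj_inv[OF uc(1) x] twist[OF x uc(2)] uc(3) by simp
    then show ?thesis using uc(4) by simp
  qed
  have vanish: "\<Theta> x = 0" if x: "x \<in> carrier G - C" for x
  proof (cases "\<exists>t\<in>carrier G. inv t \<otimes> x \<otimes> t \<in> B")
    case True
    then obtain t where t: "t \<in> carrier G" "inv t \<otimes> x \<otimes> t \<in> B" by blast
    have "inv t \<otimes> x \<otimes> t \<notin> C"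
    proof
      assume a: "inv t \<otimes> x \<otimes> t \<in> C"
      have "inv (inv t) \<otimes> (inv t \<otimes> x \<otimes> t) \<otimes> inv t \<in> C" using inv[OF a, of "inv t"] t by simp
      moreover have "inv (inv t) \<otimes> (inv t \<otimes> x \<otimes> t) \<otimes> inv t = x"
        using t x by (simp add: group_word_simps)
      ultimately show False using x by simp
    qed
    then show ?thesis using vanishB t conj_inv x by (metis DiffD1 DiffI)
  next
    case False
    then show ?thesis using \<chi> by (auto simp: \<Theta>_def linear_char_outside intro!: sum.neutral)
  qed
  have onC: "\<Theta> c = of_nat (card (carrier G)) * \<chi> c" if "c \<in> C" for c
    unfolding \<Theta>_def using inv[OF that] by (simp)
  \<comment> \<open>Summing the null sums over all conjugations replaces \<open>\<chi>\<close> by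
    \<open>\<Theta>\<close>, of which only the part on \<open>C\<close> survives.\<close>
  have "(\<Sum>x\<in>carrier G. F (g \<otimes> x) * \<Theta> x) = (\<Sum>t\<in>carrier G. \<Sum>x\<in>carrier G. F (g \<otimes> x) * \<chi> (inv t \<otimes> x \<otimes> t))"
    unfolding \<Theta>_def sum_distrib_left by (rule sum.swap)
  also have "\<dots> = (\<Sum>t\<in>carrier G. \<Sum>x\<in>carrier G. F (g \<otimes> t \<otimes> x \<otimes> inv t) * \<chi> x)"
  proof (rule sum.cong[OF HOL.refl])
    fix t assume t: "t \<in> carrier G"
    show "(\<Sum>x\<in>carrier G. F (g \<otimes> x) * \<chi> (inv t \<otimes> x \<otimes> t)) = (\<Sum>x\<in>carrier G. F (g \<otimes> t \<otimes> x \<otimes> inv t) * \<chi> x)"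
      using t g
      by (subst sum_two_sided_translate[of t "inv t"], simp, simp, intro sum.cong[OF HOL.refl])
        (simp add: group_word_simps)
  qed
  also have "\<dots> = 0" using F g by (simp add: char_null_def)
  finally have "0 = (\<Sum>x\<in>carrier G. F (g \<otimes> x) * \<Theta> x)" by simp
  also have "\<dots> = (\<Sum>x\<in>C. F (g \<otimes> x) * \<Theta> x)"
    using vanish CG fin by (intro sum.mono_neutral_right) auto
  also have "\<dots> = of_nat (card (carrier G)) * (\<Sum>c\<in>C. F (g \<otimes> c) * \<chi> c)"
    by (simp add: onC sum_distrib_left mult.left_commute)
  finally show ?thesis using fin card_gt_0_iff by fastforce
qed

end

subsection \<open>Extending linear characters\<close>

context group
begin

text \<open>Invariance of the set is part of the notion, so that for a constant or trivial character
  it expresses that conjugation by \<open>t\<close> maps \<open>C\<close> into itself.\<close>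

definition stable :: "'a \<Rightarrow> 'a set \<Rightarrow> ('a \<Rightarrow> complex) \<Rightarrow> bool" where
  "stable t C \<chi> \<longleftrightarrow> (\<forall>c\<in>C. inv t \<otimes> c \<otimes> t \<in> C \<and> \<chi> (inv t \<otimes> c \<otimes> t) = \<chi> c)"

text \<open>In a finite group, and if \<open>y\<close> normalises \<open>C\<close>, this is the
  subgroup generated by \<open>y\<close> and \<open>C\<close>; natural exponents then
  suffice.\<close>

definition pow_ext :: "'a \<Rightarrow> 'a set \<Rightarrow> 'a set" where
  "pow_ext y C = {y [^] i \<otimes> c |(i::nat) c. c \<in> C}"

lemma stable_mult:
  assumes "stable t C \<chi>" "stable u C \<chi>" "C \<subseteq> carrier G" "t \<in> carrier G" "u \<in> carrier G"
  shows "stable (t \<otimes> u) C \<chi>"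
  unfolding stable_def
proof
  fix c assume c: "c \<in> C"
  then have "inv (t \<otimes> u) \<otimes> c \<otimes> (t \<otimes> u) = inv u \<otimes> (inv t \<otimes> c \<otimes> t) \<otimes> u"
    using assms by (auto simp: group_word_simps subset_iff)
  then show "inv (t \<otimes> u) \<otimes> c \<otimes> (t \<otimes> u) \<in> C \<and> \<chi> (inv (t \<otimes> u) \<otimes> c \<otimes> (t \<otimes> u)) = \<chi> c"
    using assms(1,2) c by (simp add: stable_def)
qed

lemma stable_pow:
  assumes "stable t C \<chi>" "C \<subseteq> carrier G" "t \<in> carrier G"
  shows "stable (t [^] (n::nat)) C \<chi>"
  using assms
proof (induction n)
  case 0
  then show ?case by (auto simp: stable_def subset_iff)
qed (simp add: stable_mult)

lemma stable_commute:
  assumes "C \<subseteq> carrier G" "t \<in> carrier G" "\<And>c. c \<in> C \<Longrightarrow> c \<otimes> t = t \<otimes> c"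
  shows "stable t C \<chi>"
  using assms by (auto simp: stable_def m_assoc inv_cancel subset_iff)

lemma linear_char_pow:
  assumes \<chi>: "linear_char G B \<chi>" and x: "x \<in> B"
  shows "\<chi> (x [^] (n::nat)) = \<chi> x ^ n"
proof -
  have "subgroup B G" using \<chi> by (rule linear_char_subgroup)
  then have "x [^] n \<in> carrier G" for n :: nat
    using x by (simp add: subgroup.mem_carrier)
  then show ?thesis
    by (induction n) (simp_all add: linear_char_one[OF \<chi>] linear_char_mult_right[OF \<chi> _ x])
qed

lemma subgroup_pow_closed:
  assumes "subgroup B G" "x \<in> B"
  shows "x [^] (n::nat) \<in> B"
  using assms by (induction n) (auto intro: subgroup.one_closed subgroup.m_closed)

lemma pow_ext_base: "subgroup C G \<Longrightarrow> c \<in> C \<Longrightarrow> c \<in> pow_ext y C"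
  unfolding pow_ext_def
  by (rule CollectI, rule exI[of _ 0], rule exI[of _ c]) (simp add: subgroup.mem_carrier)

lemma pow_ext_gen: "subgroup C G \<Longrightarrow> y \<in> carrier G \<Longrightarrow> y \<in> pow_ext y C"
  unfolding pow_ext_def
  by (rule CollectI, rule exI[of _ 1], rule exI[of _ \<one>]) (simp add: subgroup.one_closed)

lemma pow_ext_least:
  assumes "subgroup H G" "y \<in> H" "C \<subseteq> H"
  shows "pow_ext y C \<subseteq> H"
  using assms by (auto simp: pow_ext_def intro!: subgroup.m_closed subgroup_pow_closed)

lemma subgroup_pow_ext:
  assumes fin: "finite (carrier G)" and C: "subgroup C G" and y: "y \<in> carrier G" and st: "stable y C \<chi>"
  shows "subgroup (pow_ext y C) G"
proof -
  have CG: "C \<subseteq> carrier G" using C by (rule subgroup.subset)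
  have sub: "pow_ext y C \<subseteq> carrier G" using y CG by (auto simp: pow_ext_def)
  have mult: "u \<otimes> v \<in> pow_ext y C" if uv: "u \<in> pow_ext y C" "v \<in> pow_ext y C" for u v
  proof -
    obtain i c where u: "u = y [^] (i::nat) \<otimes> c" "c \<in> C"
      using uv(1) unfolding pow_ext_def by blast
    obtain j d where v: "v = y [^] (j::nat) \<otimes> d" "d \<in> C"
      using uv(2) unfolding pow_ext_def by blast
    have "u \<otimes> v = y [^] (i + j) \<otimes> (inv (y [^] j) \<otimes> c \<otimes> y [^] j \<otimes> d)"
      using u v y CG by (simp add: group_word_simps subset_iff nat_pow_mult[symmetric])
    moreover have "inv (y [^] j) \<otimes> c \<otimes> y [^] j \<in> C"
      using stable_pow[OF st CG y, of j] u by (simp add: stable_def)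
    ultimately show ?thesis using C v unfolding pow_ext_def by (blast intro: subgroup.m_closed)
  qed
  show ?thesis
  proof (rule subgroupI)
    show "pow_ext y C \<noteq> {}" using pow_ext_gen[OF C y] by blast
    fix u assume u: "u \<in> pow_ext y C"
    then have uG: "u \<in> carrier G" using sub by blast
    have pow: "u [^] Suc n \<in> pow_ext y C" for n
      using u uG by (induction n) (auto intro: mult)
    define n where "n = card (carrier G)"
    have n: "n > 0" "u [^] n = \<one>"
      using uG fin pow_order_eq_1[OF uG] unfolding n_def Coset.order_def by (auto simp: card_gt_0_iff)
    \<comment> \<open>The exponent 2n - 1 in place of n - 1 is positive even in the trivial group,
      as \<open>pow\<close> demands.\<close>
    have "inv u = u [^] (2 * n - 1)"
    proof (rule inv_equality)
      have "u [^] (2 * n - 1) \<otimes> u = u [^] (2 * n - 1 + 1)" using uG by simp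
      also have "2 * n - 1 + 1 = n * 2" using n by simp
      finally show "u [^] (2 * n - 1) \<otimes> u = \<one>" using uG n by (simp add: nat_pow_pow[symmetric])
    qed (use uG in auto)
    moreover have "2 * n - 1 = Suc (2 * n - 2)" using n by simp
    ultimately show "inv u \<in> pow_ext y C" using pow by metis
  qed (use sub mult in auto)
qed

text \<open>Stability climbs one step of a chain when the new generator is moved only by an element
  of the kernel: powers of \<open>y \<otimes> d\<close> then have the same values as powers of
  \<open>y\<close>.\<close>

lemma stable_pow_ext:
  assumes \<chi>: "linear_char G (pow_ext y C) \<chi>" and C: "subgroup C G" and y: "y \<in> carrier G" and t: "t \<in> carrier G"
    and st: "stable t C \<chi>" and conj: "inv t \<otimes> y \<otimes> t = y \<otimes> d" and d: "d \<in> C" "\<chi> d = 1"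
  shows "stable t (pow_ext y C) \<chi>"
  unfolding stable_def
proof
  fix x assume "x \<in> pow_ext y C"
  then obtain i c where x: "x = y [^] (i::nat) \<otimes> c" "c \<in> C" by (auto simp: pow_ext_def)
  have sub: "subgroup (pow_ext y C) G" using \<chi> by (rule linear_char_subgroup)
  have yE: "y \<in> pow_ext y C" and CE: "C \<subseteq> pow_ext y C"
    using C y pow_ext_gen pow_ext_base by auto
  have G: "c \<in> carrier G" "d \<in> carrier G" using C x d by (auto dest: subgroup.mem_carrier)
  have pow: "inv t \<otimes> y [^] (i::nat) \<otimes> t = (y \<otimes> d) [^] i" for i
  proof (induction i)
    case (Suc i)
    have "inv t \<otimes> y [^] Suc i \<otimes> t = (inv t \<otimes> y [^] i \<otimes> t) \<otimes> (inv t \<otimes> y \<otimes> t)"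
      using t y by (simp add: group_word_simps)
    then show ?case using Suc conj by simp
  qed (use t in simp)
  have eq: "inv t \<otimes> x \<otimes> t = (y \<otimes> d) [^] i \<otimes> (inv t \<otimes> c \<otimes> t)"
    using x t y G pow[of i, symmetric] by (simp add: group_word_simps)
  have yd: "y \<otimes> d \<in> pow_ext y C" using sub yE CE d by (meson subgroup.m_closed subsetD)
  have cc: "inv t \<otimes> c \<otimes> t \<in> C" "\<chi> (inv t \<otimes> c \<otimes> t) = \<chi> c" using st x by (auto simp: stable_def)
  have pows: "(y \<otimes> d) [^] i \<in> pow_ext y C" "y [^] i \<in> pow_ext y C"
    using sub yd yE by (auto intro: subgroup_pow_closed)
  have "\<chi> (y \<otimes> d) = \<chi> y" using \<chi> yE G d by (simp add: linear_char_mult_left)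
  then have "\<chi> ((y \<otimes> d) [^] i \<otimes> (inv t \<otimes> c \<otimes> t)) = \<chi> x"
    using \<chi> pows cc(2) t G x yd yE d(2) by (simp add: linear_char_mult_left linear_char_pow)
  moreover have "(y \<otimes> d) [^] i \<otimes> (inv t \<otimes> c \<otimes> t) \<in> pow_ext y C"
    using sub pows cc(1) CE by (meson subgroup.m_closed subsetD)
  ultimately show "inv t \<otimes> x \<otimes> t \<in> pow_ext y C \<and> \<chi> (inv t \<otimes> x \<otimes> t) = \<chi> x" by (simp add: eq)
qed

lemma linear_char_indicator:
  assumes "subgroup B G"
  shows "linear_char G B (\<lambda>x. if x \<in> B then 1 else 0)"
  using assms by (auto simp: linear_char_def subgroup.one_closed subgroup.m_closed)

end

section \<open>Extensions of a subgroup by an element of prime order modulo it\<close>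

locale cyclic_ext = group +
  fixes C :: "'a set" and y :: 'a and p :: nat
  assumes fin: "finite (carrier G)" and sub: "subgroup C G" and y: "y \<in> carrier G"
    and prime: "Factorial_Ring.prime p" and pow: "y [^] p \<in> C" and notin: "y \<notin> C"
    and norm: "\<And>c. c \<in> C \<Longrightarrow> inv y \<otimes> c \<otimes> y \<in> C"
begin

lemma C_carrier: "C \<subseteq> carrier G"
  using sub by (rule subgroup.subset)

lemma stable_y: "stable y C (\<lambda>x. 1)"
  using norm by (simp add: stable_def)

lemma ext_subgroup: "subgroup (pow_ext y C) G"
  by (rule subgroup_pow_ext[OF fin sub y stable_y])

lemma pow_mem_iff: "y [^] (i::nat) \<in> C \<longleftrightarrow> p dvd i"
proof
  assume "p dvd i"
  then obtain k where "i = p * k" by (rule dvdE)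
  then show "y [^] i \<in> C" using sub pow y by (simp add: nat_pow_pow[symmetric] subgroup_pow_closed)
next
  assume i: "y [^] i \<in> C"
  show "p dvd i"
  proof (rule ccontr)
    assume "\<not> p dvd i"
    then have "coprime p i" by (rule prime_imp_coprime[OF prime])
    then have "coprime i p" by (subst coprime_commute)
    then obtain j k where "i * j = p * k + 1" using coprime_bezout_strong[of i p] prime
      by (metis One_nat_def not_prime_1)
    then have "y [^] (i * j) = y [^] (p * k) \<otimes> y" using y by simp
    moreover have "y [^] (i * j) \<in> C" "y [^] (p * k) \<in> C"
      using sub i pow y by (auto simp: nat_pow_pow[symmetric] intro: subgroup_pow_closed)
    ultimately have "inv (y [^] (p * k)) \<otimes> (y [^] (p * k) \<otimes> y) \<in> C"
      using sub by (auto intro: subgroup.m_closed subgroup.m_inv_closed)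
    then show False using notin y by (simp add: inv_cancel)
  qed
qed

lemma normal_form_eq:
  assumes "y [^] (i::nat) \<otimes> c = y [^] (j::nat) \<otimes> d" "c \<in> C" "d \<in> C" "i \<le> j"
  obtains k where "j = i + p * k" "c = (y [^] p) [^] k \<otimes> d"
proof -
  have G: "c \<in> carrier G" "d \<in> carrier G" using assms C_carrier by auto
  have "y [^] j = y [^] i \<otimes> y [^] (j - i)" using y assms(4) by (simp add: nat_pow_mult)
  then have "y [^] i \<otimes> c = y [^] i \<otimes> (y [^] (j - i) \<otimes> d)"
    using assms(1) y G by (simp add: m_assoc)
  then have c: "c = y [^] (j - i) \<otimes> d" using y G by simp
  then have "y [^] (j - i) = c \<otimes> inv d" using y G by (simp add: m_assoc)
  then have "y [^] (j - i) \<in> C" using sub assms by (simp add: subgroup.m_closed subgroup.m_inv_closed)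
  then obtain k where "j - i = p * k" unfolding pow_mem_iff by (rule dvdE)
  then show thesis using that[of k] c assms(4) y by (simp add: nat_pow_pow)
qed

lemma bij_normal_form: "bij_betw (\<lambda>(i, c). y [^] i \<otimes> c) ({..<p} \<times> C) (pow_ext y C)"
proof (rule bij_betw_imageI)
  show "inj_on (\<lambda>(i, c). y [^] i \<otimes> c) ({..<p} \<times> C)"
  proof (rule inj_onI, clarsimp)
    have *: "i = j \<and> c = d" if eq: "y [^] i \<otimes> c = y [^] j \<otimes> d" "c \<in> C" "d \<in> C" "i \<le> j" and j: "j < p" for i j :: nat and c d
    proof -
      obtain k where k: "j = i + p * k" "c = (y [^] p) [^] k \<otimes> d"
        by (rule normal_form_eq[OF eq])
      then have "k = 0" using j by (cases k) auto
      then show ?thesis using k eq C_carrier by auto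
    qed
    fix i c j d assume a: "i < p" "c \<in> C" "j < p" "d \<in> C" "y [^] i \<otimes> c = y [^] j \<otimes> d"
    show "i = j \<and> c = d"
    proof (cases "i \<le> j")
      case True
      then show ?thesis using * a by blast
    next
      case False
      then have "j = i \<and> d = c" using *[of j d i c] a by simp
      then show ?thesis by simp
    qed
  qed
  have "x \<in> (\<lambda>(i, c). y [^] i \<otimes> c) ` ({..<p} \<times> C)" if x: "x \<in> pow_ext y C" for x
  proof -
    obtain i c where ic: "x = y [^] (i::nat) \<otimes> c" "c \<in> C" using x by (auto simp: pow_ext_def)
    have "y [^] i = y [^] (i mod p + p * (i div p))" by simp
    also have "\<dots> = y [^] (i mod p) \<otimes> (y [^] p) [^] (i div p)"
      using y by (simp only: nat_pow_mult nat_pow_pow)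
    finally have "x = y [^] (i mod p) \<otimes> ((y [^] p) [^] (i div p) \<otimes> c)"
      using ic y C_carrier by (simp add: m_assoc subset_iff)
    moreover have "(y [^] p) [^] (i div p) \<otimes> c \<in> C"
      using sub pow ic by (auto intro: subgroup.m_closed subgroup_pow_closed)
    moreover have "i mod p < p" using prime prime_gt_0_nat by simp
    ultimately show ?thesis by force
  qed
  then show "(\<lambda>(i, c). y [^] i \<otimes> c) ` ({..<p} \<times> C) = pow_ext y C"
    by (auto simp: pow_ext_def)
qed

lemma card_ext: "card (pow_ext y C) = p * card C"
  using bij_betw_same_card[OF bij_normal_form] by (simp add: card_cartesian_product)

text \<open>Sending y^i c to w^i \<chi>(c) is well defined because of
  \<open>w ^ p = \<chi> (y [^] p)\<close>, and multiplicative because \<open>\<chi>\<close> is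
  stable under \<open>y\<close>. The root \<open>w\<close> is left open, since it decides the field
  of values.\<close>

lemma char_extend:
  assumes \<chi>: "linear_char G C \<chi>" and st: "stable y C \<chi>" and w: "w ^ p = \<chi> (y [^] p)"
    and K: "complex_subfield K" "\<And>x. \<chi> x \<in> K" "w \<in> K"
  obtains \<chi>' where "linear_char G (pow_ext y C) \<chi>'" "\<And>c. c \<in> C \<Longrightarrow> \<chi>' c = \<chi> c" "\<chi>' y = w"
    "\<And>x. \<chi>' x \<in> K"
proof -
  have wd: "w ^ i * \<chi> c = w ^ j * \<chi> d"
    if "y [^] i \<otimes> c = y [^] j \<otimes> d" "c \<in> C" "d \<in> C" for i j :: nat and c d
  proof -
    have *: "w ^ i * \<chi> c = w ^ j * \<chi> d"
      if eq: "y [^] i \<otimes> c = y [^] j \<otimes> d" "c \<in> C" "d \<in> C" "i \<le> j" for i j :: nat and c d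
    proof -
      obtain k where k: "j = i + p * k" "c = (y [^] p) [^] k \<otimes> d" by (rule normal_form_eq[OF eq])
      have "(y [^] p) [^] k \<in> C" using sub pow by (rule subgroup_pow_closed)
      then have "\<chi> c = (w ^ p) ^ k * \<chi> d"
        using k \<chi> eq pow C_carrier by (auto simp: linear_char_mult_left linear_char_pow w)
      then show ?thesis using k by (simp add: power_add power_mult)
    qed
    show ?thesis using *[of i c j d] *[of j d i c] that by (metis nat_le_linear)
  qed
  \<comment> \<open>Defined through an arbitrary normal form; \<open>val\<close> shows that the
    choice does not matter.\<close>
  define \<chi>' where "\<chi>' x = (if x \<in> pow_ext y C
      then let (i, c) = (SOME (i, c). c \<in> C \<and> x = y [^] (i::nat) \<otimes> c) in w ^ i * \<chi> c else 0)" for x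
  have val: "\<chi>' (y [^] i \<otimes> c) = w ^ i * \<chi> c" if c: "c \<in> C" for i :: nat and c
  proof -
    define ic where "ic = (SOME (j, d). d \<in> C \<and> y [^] i \<otimes> c = y [^] (j::nat) \<otimes> d)"
    have "case ic of (j, d) \<Rightarrow> d \<in> C \<and> y [^] i \<otimes> c = y [^] j \<otimes> d"
      unfolding ic_def by (rule someI[of _ "(i, c)"]) (simp add: c)
    then have "snd ic \<in> C" "y [^] i \<otimes> c = y [^] fst ic \<otimes> snd ic" by (auto split: prod.splits)
    then have "w ^ fst ic * \<chi> (snd ic) = w ^ i * \<chi> c" using wd c by metis
    moreover have "y [^] i \<otimes> c \<in> pow_ext y C" using c by (auto simp: pow_ext_def)
    ultimately show ?thesis by (simp add: \<chi>'_def ic_def[symmetric] split_beta)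
  qed
  have onC: "\<chi>' c = \<chi> c" if "c \<in> C" for c
    using val[of c 0] that C_carrier by auto
  have wK: "w ^ i \<in> K" for i
  proof (induction i)
    case 0
    then show ?case using K(1) of_rat_1 unfolding complex_subfield_def by (metis power_0)
  qed (use K in \<open>simp add: complex_subfield_def\<close>)
  show thesis
  proof (rule that[of \<chi>'])
    have mult: "\<chi>' (u \<otimes> v) = \<chi>' u * \<chi>' v" if uv: "u \<in> pow_ext y C" "v \<in> pow_ext y C" for u v
    proof -
      obtain i c where u: "u = y [^] (i::nat) \<otimes> c" "c \<in> C"
        using uv(1) unfolding pow_ext_def by blast
      obtain j d where v: "v = y [^] (j::nat) \<otimes> d" "d \<in> C"
        using uv(2) unfolding pow_ext_def by blast
      \<comment> \<open>Carrying \<open>c\<close> past a power of \<open>y\<close> conjugates it,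
        which \<open>\<chi>\<close> does not notice.\<close>
      have eq: "u \<otimes> v = y [^] (i + j) \<otimes> (inv (y [^] j) \<otimes> c \<otimes> y [^] j \<otimes> d)"
        using u v y C_carrier by (simp add: group_word_simps subset_iff nat_pow_mult[symmetric])
      have c': "inv (y [^] j) \<otimes> c \<otimes> y [^] j \<in> C" "\<chi> (inv (y [^] j) \<otimes> c \<otimes> y [^] j) = \<chi> c"
        using stable_pow[OF st C_carrier y, of j] u by (simp_all add: stable_def)
      then have "inv (y [^] j) \<otimes> c \<otimes> y [^] j \<otimes> d \<in> C" using sub v by (auto intro: subgroup.m_closed)
      then have "\<chi>' (u \<otimes> v) = w ^ (i + j) * \<chi> (inv (y [^] j) \<otimes> c \<otimes> y [^] j \<otimes> d)"
        unfolding eq by (rule val)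
      also have "\<dots> = w ^ (i + j) * (\<chi> c * \<chi> d)"
        using \<chi> c' v unfolding linear_char_def by metis
      also have "\<dots> = \<chi>' u * \<chi>' v" using u v by (simp add: val power_add)
      finally show ?thesis .
    qed
    have "\<chi>' \<one> = 1" using onC[of \<one>] sub \<chi> by (simp add: subgroup.one_closed linear_char_one)
    then show "linear_char G (pow_ext y C) \<chi>'"
      using ext_subgroup mult by (auto simp: linear_char_def \<chi>'_def)
    show "\<chi>' y = w"
      using val[of \<one> 1] sub y \<chi> by (simp add: subgroup.one_closed linear_char_one)
    show "\<chi>' x \<in> K" for x
    proof (cases "x \<in> pow_ext y C")
      case True
      then obtain i c where "x = y [^] (i::nat) \<otimes> c" "c \<in> C" by (auto simp: pow_ext_def)
      then show ?thesis using K wK by (simp add: val complex_subfield_def)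
    next
      case False
      then show ?thesis using K(1) of_rat_0 unfolding complex_subfield_def \<chi>'_def by metis
    qed
  qed (use onC in auto)
qed

text \<open>Grouping the sum by cosets of \<open>C\<close> leaves a relation between the
  \<open>p\<close>-th roots of unity \<open>\<chi> y ^ i\<close> with rational coefficients f(x
  y^i), which must then all be equal. Thus one nontrivial character does the work of all its Galois
  conjugates.\<close>

lemma right_invariant_ext:
  fixes f :: "'a \<Rightarrow> rat"
  assumes inv: "\<And>x c. x \<in> carrier G \<Longrightarrow> c \<in> C \<Longrightarrow> f (x \<otimes> c) = f x"
    and \<chi>: "linear_char G B \<chi>" "y \<in> B" "C \<subseteq> B" "\<And>c. c \<in> C \<Longrightarrow> \<chi> c = 1" "\<chi> y \<noteq> 1"
    and sum0: "\<And>g. g \<in> carrier G \<Longrightarrow> (\<Sum>d\<in>pow_ext y C. of_rat (f (g \<otimes> d)) * \<chi> d) = 0"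
    and x: "x \<in> carrier G" and d: "d \<in> pow_ext y C"
  shows "f (x \<otimes> d) = f x"
proof -
  have finC: "finite C" using C_carrier fin by (rule finite_subset)
  have yp: "\<chi> y ^ p = 1" using \<chi> pow by (metis linear_char_pow)
  have "(\<Sum>d\<in>pow_ext y C. of_rat (f (x \<otimes> d)) * \<chi> d)
    = (\<Sum>(i, c)\<in>{..<p} \<times> C. of_rat (f (x \<otimes> (y [^] i \<otimes> c))) * \<chi> (y [^] i \<otimes> c))"
    by (subst sum.reindex_bij_betw[OF bij_normal_form, symmetric]) (simp add: split_beta)
  also have "\<dots> = (\<Sum>(i, c)\<in>{..<p} \<times> C. of_rat (f (x \<otimes> y [^] i)) * \<chi> y ^ i)"
  proof (intro sum.cong HOL.refl, clarify)
    fix i :: nat and c assume c: "c \<in> C"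
    then have cG: "c \<in> carrier G" using C_carrier by blast
    have "x \<otimes> (y [^] i \<otimes> c) = x \<otimes> y [^] i \<otimes> c" using x y cG by (simp add: m_assoc)
    moreover have "\<chi> (y [^] i \<otimes> c) = \<chi> y ^ i"
      using \<chi> c y cG by (simp add: linear_char_mult_right subsetD linear_char_pow)
    ultimately show "of_rat (f (x \<otimes> (y [^] i \<otimes> c))) * \<chi> (y [^] i \<otimes> c) = of_rat (f (x \<otimes> y [^] i)) * \<chi> y ^ i"
      using inv[of "x \<otimes> y [^] i" c] c x y by simp
  qed
  also have "\<dots> = of_nat (card C) * (\<Sum>i<p. of_rat (f (x \<otimes> y [^] i)) * \<chi> y ^ i)"
    by (simp add: sum.cartesian_product[symmetric] sum_distrib_left)
  finally have "(\<Sum>i<p. of_rat (f (x \<otimes> y [^] i)) * \<chi> y ^ i) = 0"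
    using sum0[OF x] finC sub by (auto simp: card_gt_0_iff dest: subgroup.one_closed)
  then have const: "f (x \<otimes> y [^] i) = f (x \<otimes> y [^] (0::nat))" if "i < p" for i
    using prime_root_of_unity_rat_relation[OF prime yp \<chi>(5), of "\<lambda>i. f (x \<otimes> y [^] i)"] that by simp
  obtain i c where ic: "i < p" "c \<in> C" "d = y [^] i \<otimes> c"
    using d bij_normal_form by (force simp: bij_betw_def)
  then have "x \<otimes> d = x \<otimes> y [^] i \<otimes> c" using x y C_carrier by (simp add: m_assoc subset_iff)
  then show ?thesis using inv[of "x \<otimes> y [^] i" c] ic const[OF ic(1)] x y by simp
qed

text \<open>The conjugation hypothesis of \<open>char_null_central\<close>, checked on the generator \<open>y\<close> and on \<open>C\<close> only.\<close>

lemma conjugate_moves: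
  assumes \<chi>: "linear_char G (pow_ext y C) \<chi>" and D: "subgroup D G" "D \<subseteq> C"
    and st: "\<And>t. t \<in> carrier G \<Longrightarrow> stable t D \<chi>"
    and u: "u \<in> carrier G" and d: "d \<in> D" "inv u \<otimes> y \<otimes> u = y \<otimes> d" "\<chi> d ^ p = 1" "\<chi> d \<noteq> 1"
    and uC: "\<And>c. c \<in> C \<Longrightarrow> \<exists>e\<in>D. inv u \<otimes> c \<otimes> u = c \<otimes> e \<and> \<chi> e = 1"
    and x: "x \<in> pow_ext y C - C"
  shows "\<exists>c\<in>D. inv u \<otimes> x \<otimes> u = x \<otimes> c \<and> \<chi> c \<noteq> 1"
proof -
  obtain i c where x_eq: "x = y [^] (i::nat) \<otimes> c" and c: "c \<in> C" using x by (auto simp: pow_ext_def)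
  have "\<not> p dvd i"
  proof
    assume "p dvd i"
    then have "y [^] i \<in> C" by (simp add: pow_mem_iff)
    then show False using x x_eq c sub by (auto dest: subgroup.m_closed)
  qed
  have DG: "D \<subseteq> carrier G" using D(1) by (rule subgroup.subset)
  have DB: "D \<subseteq> pow_ext y C" using D sub pow_ext_base by blast
  have G: "c \<in> carrier G" "d \<in> carrier G" using c d DG C_carrier by auto
  \<comment> \<open>Conjugation by \<open>u\<close> multiplies y^i by an element of \<open>D\<close>
    whose value is the \<open>i\<close>-th power of \<open>\<chi> d\<close>. Outside
    \<open>C\<close> the exponent is prime to \<open>p\<close>, so this value is not 1.\<close>
  have "\<exists>e\<in>D. inv u \<otimes> y [^] i \<otimes> u = y [^] i \<otimes> e \<and> \<chi> e = \<chi> d ^ i" for i :: nat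
  proof (induction i)
    case 0
    then show ?case using D u \<chi> by (auto simp: linear_char_one subgroup.one_closed intro!: bexI[of _ \<one>])
  next
    case (Suc i)
    then obtain e where e: "e \<in> D" "inv u \<otimes> y [^] i \<otimes> u = y [^] i \<otimes> e" "\<chi> e = \<chi> d ^ i" by blast
    have eG: "e \<in> carrier G" using e DG by blast
    define e' where "e' = inv y \<otimes> e \<otimes> y"
    have e': "e' \<in> D" "\<chi> e' = \<chi> e" using st[OF y] e by (auto simp: stable_def e'_def)
    have "inv u \<otimes> y [^] Suc i \<otimes> u = (inv u \<otimes> y [^] i \<otimes> u) \<otimes> (inv u \<otimes> y \<otimes> u)"
      using u y by (simp add: group_word_simps)
    also have "\<dots> = y [^] Suc i \<otimes> (e' \<otimes> d)"
      using e eG y G by (simp only: d(2) e(2) e'_def) (simp add: group_word_simps)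
    finally have "inv u \<otimes> y [^] Suc i \<otimes> u = y [^] Suc i \<otimes> (e' \<otimes> d)" .
    moreover have "e' \<otimes> d \<in> D" using D e' d by (auto intro: subgroup.m_closed)
    moreover have "\<chi> (e' \<otimes> d) = \<chi> d ^ Suc i"
      using \<chi> e' e d DB G by (simp add: linear_char_mult_left subsetD)
    ultimately show ?case by blast
  qed
  then obtain e where e: "e \<in> D" "inv u \<otimes> y [^] i \<otimes> u = y [^] i \<otimes> e" "\<chi> e = \<chi> d ^ i" by blast
  obtain e2 where e2: "e2 \<in> D" "inv u \<otimes> c \<otimes> u = c \<otimes> e2" "\<chi> e2 = 1" using uC[OF c] by blast
  have eG: "e \<in> carrier G" "e2 \<in> carrier G" using e e2 DG by auto
  define e' where "e' = inv c \<otimes> e \<otimes> c"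
  have e': "e' \<in> D" "\<chi> e' = \<chi> e" using st[OF G(1)] e by (auto simp: stable_def e'_def)
  have "inv u \<otimes> x \<otimes> u = (inv u \<otimes> y [^] i \<otimes> u) \<otimes> (inv u \<otimes> c \<otimes> u)"
    using u y G by (simp add: x_eq group_word_simps)
  also have "\<dots> = x \<otimes> (e' \<otimes> e2)"
    using eG y G by (simp only: e(2) e2(2) e'_def x_eq) (simp add: group_word_simps)
  finally have "inv u \<otimes> x \<otimes> u = x \<otimes> (e' \<otimes> e2)" .
  moreover have "e' \<otimes> e2 \<in> D" using D e' e2 by (auto intro: subgroup.m_closed)
  moreover have "\<chi> (e' \<otimes> e2) = \<chi> d ^ i"
    using \<chi> e' e e2 DB eG by (simp add: linear_char_mult_left subsetD)
  moreover have "\<chi> d ^ i \<noteq> 1" by (rule prime_root_power_ne_1[OF prime d(3,4) \<open>\<not> p dvd i\<close>])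
  ultimately show ?thesis by metis
qed

end

section \<open>Cyclotomic fields as subrings and as rational spans\<close>

lemma cyclotomic_closed:
  "1 \<in> cyclotomic_field d" "cis (2 * pi / real d) \<in> cyclotomic_field d"
  "x \<in> cyclotomic_field d \<Longrightarrow> y \<in> cyclotomic_field d \<Longrightarrow> x + y \<in> cyclotomic_field d"
  "x \<in> cyclotomic_field d \<Longrightarrow> y \<in> cyclotomic_field d \<Longrightarrow> x * y \<in> cyclotomic_field d"
  "x \<in> cyclotomic_field d \<Longrightarrow> - x \<in> cyclotomic_field d"
  "x \<in> cyclotomic_field d \<Longrightarrow> inverse x \<in> cyclotomic_field d"
proof -
  interpret K: field "ring_of_type_algebra :: complex ring" by (rule field_from_type_algebra)
  let ?H = "{cis (2 * pi / real d)}"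
  show one: "1 \<in> cyclotomic_field d"
    using generate_field.one[of "ring_of_type_algebra :: complex ring" ?H]
    by (simp add: cyclotomic_field_def ring_of_type_algebra_def)
  show "cis (2 * pi / real d) \<in> cyclotomic_field d"
    by (simp add: cyclotomic_field_def generate_field.incl)
  show "x + y \<in> cyclotomic_field d" if "x \<in> cyclotomic_field d" "y \<in> cyclotomic_field d"
    using generate_field.eng_add[of x "ring_of_type_algebra :: complex ring" ?H y] that
    by (simp add: cyclotomic_field_def ring_of_type_algebra_def)
  show "x * y \<in> cyclotomic_field d" if "x \<in> cyclotomic_field d" "y \<in> cyclotomic_field d"
    using generate_field.eng_mult[of x "ring_of_type_algebra :: complex ring" ?H y] that
    by (simp add: cyclotomic_field_def ring_of_type_algebra_def)
  show neg: "- x \<in> cyclotomic_field d" if x: "x \<in> cyclotomic_field d" for x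
  proof -
    have "\<ominus>\<^bsub>ring_of_type_algebra\<^esub> x = - x"
      by (rule K.minus_equality) (auto simp: ring_of_type_algebra_def)
    then show ?thesis
      using generate_field.a_inv[of x "ring_of_type_algebra :: complex ring" ?H] x
      by (simp add: cyclotomic_field_def)
  qed
  show "inverse x \<in> cyclotomic_field d" if x: "x \<in> cyclotomic_field d"
  proof (cases "x = 0")
    case False
    have "inv\<^bsub>ring_of_type_algebra\<^esub> x = inverse x"
      using False by (intro K.comm_inv_char) (auto simp: ring_of_type_algebra_def)
    then show ?thesis
      using generate_field.m_inv[of x "ring_of_type_algebra :: complex ring" ?H] x False
      by (simp add: cyclotomic_field_def ring_of_type_algebra_def)
  qed (use x in simp)
qed

lemma complex_subfield_cyclotomic: "complex_subfield (cyclotomic_field d)"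
proof -
  let ?K = "cyclotomic_field d"
  have zero: "0 \<in> ?K" using cyclotomic_closed(3)[of 1 d "- 1"] cyclotomic_closed(1,5) by simp
  have nat: "of_nat n \<in> ?K" for n
    by (induction n) (simp_all add: zero cyclotomic_closed)
  have int: "of_int z \<in> ?K" for z
    by (cases z rule: int_cases2) (simp_all add: nat cyclotomic_closed(5))
  have "of_rat q \<in> ?K" for q
  proof (cases q)
    case (Fract a b)
    then have "(of_rat q :: complex) = of_int a * inverse (of_int b)"
      by (simp add: of_rat_rat divide_inverse)
    then show ?thesis using int cyclotomic_closed(4,6) by metis
  qed
  then show ?thesis by (simp add: complex_subfield_def cyclotomic_closed)
qed

lemma cis_primitive:
  assumes "n > 1"
  shows "cis (2 * pi / real n) \<noteq> 1"
proof
  assume "cis (2 * pi / real n) = 1"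
  then have "cos (2 * pi / real n) = 1" by (metis cis.sel(1) one_complex.sel(1))
  then obtain k where "2 * pi / real n = of_int k * (2 * pi)" by (auto simp: cos_one_2pi_int)
  then have "real_of_int (k * int n) = 1" using assms by (simp add: field_simps)
  then have "k * int n = 1" by linarith
  then show False using assms by (simp add: zmult_eq_1_iff)
qed

lemma cyclotomic_field_prime_span:
  assumes p: "Factorial_Ring.prime p" and y: "y \<in> cyclotomic_field p"
  shows "\<exists>q. y = (\<Sum>k<p - 1. of_rat (q k) * cis (2 * pi / real p) ^ k)"
proof (rule generate_field_rat_span)
  let ?z = "cis (2 * pi / real p)"
  have p1: "p > 1" using p prime_gt_1_nat by blast
  have z: "?z ^ p = 1" "?z \<noteq> 1" using p1 by (auto simp: DeMoivre cis_primitive)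
  obtain n where n: "p = Suc n" using p1 by (cases p) auto
  \<comment> \<open>The vanishing geometric sum expresses the power \<open>p - 1\<close> by the
    lower ones.\<close>
  have "(\<Sum>k<p. ?z ^ k) = 0" using z by (simp add: sum_gp_strict)
  then have "?z ^ n = - (\<Sum>k<n. ?z ^ k)" by (simp add: n add_eq_0_iff)
  then show "?z ^ (p - 1) = (\<Sum>k<p - 1. of_rat (- 1) * ?z ^ k)"
    by (simp add: n sum_negf)
  show "p - 1 > 0" using p1 by simp
qed (use y in \<open>simp add: cyclotomic_field_def\<close>)

lemma cis_ninth: "cis (2 * pi / 9) ^ 6 + cis (2 * pi / 9) ^ 3 + 1 = (0 :: complex)"
proof -
  \<comment> \<open>The cube of the ninth root is this cube root of unity, so the claim is w^2 + w +
    1 = 0.\<close>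
  let ?w = "cis (2 * pi / 3)"
  have w: "?w ^ 3 = 1" "?w \<noteq> 1" using cis_primitive[of 3] by (simp_all add: DeMoivre)
  have "(?w - 1) * (?w ^ 2 + ?w + 1) = 0"
    using w(1) by (simp add: algebra_simps power2_eq_square power3_eq_cube)
  then have "?w ^ 2 + ?w + 1 = 0" using w(2) by simp
  then show ?thesis by (simp add: DeMoivre)
qed

lemma cyclotomic_field_9_span:
  assumes y: "y \<in> cyclotomic_field 9"
  shows "\<exists>q. y = (\<Sum>k<6. of_rat (q k) * cis (2 * pi / 9) ^ k)"
proof (rule generate_field_rat_span)
  show "cis (2 * pi / 9) ^ 6 = (\<Sum>k<6. of_rat (if k = 0 \<or> k = 3 then - 1 else 0) * cis (2 * pi / 9) ^ k)"
  proof -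
    let ?z = "cis (2 * pi / 9)"
    have "?z ^ 6 = (?z ^ 6 + ?z ^ 3 + 1) - ?z ^ 3 - 1" by simp
    also have "\<dots> = - (?z ^ 3) - 1" by (simp only: cis_ninth) simp
    finally have "?z ^ 6 = - (?z ^ 3) - 1" .
    then show ?thesis by (simp add: lessThan_nat_numeral lessThan_Suc)
  qed
qed (use y in \<open>simp_all add: cyclotomic_field_def\<close>)

context group
begin

text \<open>Here \<open>\<chi>\<close> lives on a possibly larger subgroup \<open>B\<close>; its
  restriction, again cut off by zero, is what \<open>stable_pow_ext\<close> is applied to.\<close>

lemma stable_pow_ext_subset:
  assumes \<chi>: "linear_char G B \<chi>" and sub: "subgroup (pow_ext y C) G" "pow_ext y C \<subseteq> B"
    and C: "subgroup C G" and y: "y \<in> carrier G" and t: "t \<in> carrier G"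
    and st: "stable t C \<chi>" and conj: "inv t \<otimes> y \<otimes> t = y \<otimes> d" and d: "d \<in> C" "\<chi> d = 1"
  shows "stable t (pow_ext y C) \<chi>"
proof -
  let ?\<chi> = "\<lambda>x. if x \<in> pow_ext y C then \<chi> x else 0"
  have CE: "C \<subseteq> pow_ext y C" using C pow_ext_base by blast
  have "linear_char G (pow_ext y C) ?\<chi>"
    using \<chi> sub by (auto simp: linear_char_def subgroup.one_closed subgroup.m_closed subset_iff)
  moreover have "stable t C ?\<chi>" using st CE by (auto simp: stable_def)
  ultimately have "stable t (pow_ext y C) ?\<chi>"
    using C y t conj d CE by (intro stable_pow_ext[where d = d]) auto
  then show ?thesis by (auto simp: stable_def)
qed

lemma conj_trivial:
  "x \<in> carrier G \<Longrightarrow> t \<in> carrier G \<Longrightarrow> x \<otimes> t = t \<otimes> x \<Longrightarrow> inv t \<otimes> x \<otimes> t = x"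
  by (simp add: m_assoc inv_cancel)

lemma pow_ext_induct [consumes 3, case_names base gen one mult]:
  assumes x: "x \<in> pow_ext y C" and C: "C \<subseteq> carrier G" "y \<in> carrier G"
    and base: "\<And>c. c \<in> C \<Longrightarrow> P c" and gen: "P y" and one: "P \<one>"
    and mult: "\<And>u v. u \<in> carrier G \<Longrightarrow> v \<in> carrier G \<Longrightarrow> P u \<Longrightarrow> P v \<Longrightarrow> P (u \<otimes> v)"
  shows "P x"
proof -
  obtain i c where ic: "x = y [^] (i::nat) \<otimes> c" "c \<in> C" using x unfolding pow_ext_def by blast
  have "P (y [^] i)" for i :: nat
    by (induction i) (use gen one mult C in auto)
  then show ?thesis using ic C base mult by auto
qed

lemma commute_pow_ext:
  assumes "C \<subseteq> carrier G" "y \<in> carrier G" "t \<in> carrier G" "y \<otimes> t = t \<otimes> y"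
    "\<And>c. c \<in> C \<Longrightarrow> c \<otimes> t = t \<otimes> c" "x \<in> pow_ext y C"
  shows "x \<otimes> t = t \<otimes> x"
  using assms(6,1,2)
proof (induction rule: pow_ext_induct)
  case (mult u v)
  then show ?case using assms(3) by (metis m_assoc)
qed (use assms in auto)

lemma center_subgroup: "subgroup (center G) G"
proof (rule subgroupI)
  fix u v assume uv: "u \<in> center G" "v \<in> center G"
  then have uvG: "u \<in> carrier G" "v \<in> carrier G" by (auto simp: center_def)
  show "inv u \<in> center G"
    unfolding center_def
  proof (intro CollectI conjI ballI)
    fix g assume g: "g \<in> carrier G"
    have "inv u \<otimes> g = inv u \<otimes> (g \<otimes> u) \<otimes> inv u" using g uvG by (simp add: group_word_simps)
    also have "g \<otimes> u = u \<otimes> g" using uv g by (simp add: center_def)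
    finally show "inv u \<otimes> g = g \<otimes> inv u" using g uvG by (simp add: group_word_simps)
  qed (use uvG in simp)
  show "u \<otimes> v \<in> center G"
    unfolding center_def
  proof (intro CollectI conjI ballI)
    fix g assume g: "g \<in> carrier G"
    have "u \<otimes> v \<otimes> g = u \<otimes> (v \<otimes> g)" using g uvG by (simp add: m_assoc)
    also have "v \<otimes> g = g \<otimes> v" using uv(2) g by (simp add: center_def)
    also have "u \<otimes> (g \<otimes> v) = (u \<otimes> g) \<otimes> v" using g uvG by (simp add: m_assoc)
    also have "u \<otimes> g = g \<otimes> u" using uv(1) g by (simp add: center_def)
    finally show "u \<otimes> v \<otimes> g = g \<otimes> (u \<otimes> v)" using g uvG by (simp add: m_assoc)
  qed (use uvG in simp)
qed (auto simp: center_def)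

end

subsection \<open>Groups satisfying the relations of \<open>\<Phi>\<^sub>1\<^sub>0\<close>\<close>

text \<open>What isoclinism preserves of the presentation. Commutators and the \<open>p\<close>-th
  powers of \<open>a3\<close> and \<open>a4\<close> are known exactly, the other \<open>p\<close>-th
  powers only up to central factors; \<open>pow_a1\<close> admits a power of \<open>a3\<close> so
  that it also covers \<open>p = 3\<close>. The order of the centre is counted, not assumed.\<close>

locale phi10_relations = group +
  fixes p :: nat and a a1 a2 a3 a4 :: 'a
  assumes fin: "finite (carrier G)" and prime: "Factorial_Ring.prime p" and card_G: "card (carrier G) = p ^ 5"
    and carr: "a \<in> carrier G" "a1 \<in> carrier G" "a2 \<in> carrier G" "a3 \<in> carrier G"
    and rel1: "a1 \<otimes> a = a \<otimes> a1 \<otimes> a2" and rel2: "a2 \<otimes> a = a \<otimes> a2 \<otimes> a3"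
    and rel3: "a3 \<otimes> a = a \<otimes> a3 \<otimes> a4" and rel12: "a1 \<otimes> a2 = a2 \<otimes> a1 \<otimes> a4"
    and rel13: "a1 \<otimes> a3 = a3 \<otimes> a1" and rel23: "a2 \<otimes> a3 = a3 \<otimes> a2"
    and a4: "a4 \<in> center G" "a4 \<noteq> \<one>" "a4 [^] p = \<one>"
    and pow_a: "a [^] p \<in> center G" and pow_a1: "a1 [^] p \<in> pow_ext a3 (center G)"
    and pow_a2: "a2 [^] p \<in> center G" and pow_a3: "a3 [^] p = \<one>"
    and gen: "\<And>H. subgroup H G \<Longrightarrow> a \<in> H \<Longrightarrow> a1 \<in> H \<Longrightarrow> center G \<subseteq> H \<Longrightarrow> carrier G \<subseteq> H"
begin

abbreviation "Z \<equiv> center G"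
definition "C3 = pow_ext a3 Z"
definition "E = pow_ext a2 C3"
definition "N = pow_ext a1 E"

lemma Z_carrier: "Z \<subseteq> carrier G" by (auto simp: center_def)

lemma Z_commute: "z \<in> Z \<Longrightarrow> g \<in> carrier G \<Longrightarrow> z \<otimes> g = g \<otimes> z"
  by (simp add: center_def)

lemma a4_carrier: "a4 \<in> carrier G" using a4 Z_carrier by blast

lemma conj_rels:
  "inv a \<otimes> a1 \<otimes> a = a1 \<otimes> a2" "inv a \<otimes> a2 \<otimes> a = a2 \<otimes> a3" "inv a \<otimes> a3 \<otimes> a = a3 \<otimes> a4"
  "inv a1 \<otimes> a2 \<otimes> a1 = a2 \<otimes> inv a4" "inv a2 \<otimes> a1 \<otimes> a2 = a1 \<otimes> a4"
proof -
  have *: "inv t \<otimes> x \<otimes> t = x \<otimes> d"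
    if "x \<otimes> t = t \<otimes> x \<otimes> d" "t \<in> carrier G" "x \<in> carrier G" "d \<in> carrier G" for t x d
    using that by (simp add: m_assoc inv_cancel)
  note c = carr a4_carrier
  show "inv a \<otimes> a1 \<otimes> a = a1 \<otimes> a2" by (rule *[OF rel1]) (use c in auto)
  show "inv a \<otimes> a2 \<otimes> a = a2 \<otimes> a3" by (rule *[OF rel2]) (use c in auto)
  show "inv a \<otimes> a3 \<otimes> a = a3 \<otimes> a4" by (rule *[OF rel3]) (use c in auto)
  show "inv a2 \<otimes> a1 \<otimes> a2 = a1 \<otimes> a4" by (rule *[OF rel12]) (use c in auto)
  have "a1 \<otimes> a2 \<otimes> inv a4 = a2 \<otimes> a1" unfolding rel12 using c by (simp add: m_assoc)
  then have "a2 \<otimes> a1 = a1 \<otimes> a2 \<otimes> inv a4" by simp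
  then show "inv a1 \<otimes> a2 \<otimes> a1 = a2 \<otimes> inv a4" by (rule *) (use c in auto)
qed

lemma inv_a4: "inv a4 \<in> Z"
  using a4(1) center_subgroup by (rule subgroup.m_inv_closed[rotated])

lemma commute_C3:
  assumes "t = a1 \<or> t = a2 \<or> t = a3" "x \<in> C3"
  shows "x \<otimes> t = t \<otimes> x"
proof (rule commute_pow_ext[of Z a3 t x])
  show t: "t \<in> carrier G" using assms(1) carr by auto
  show "a3 \<otimes> t = t \<otimes> a3" using assms(1) rel13 rel23 by auto
  show "c \<otimes> t = t \<otimes> c" if "c \<in> Z" for c using that t by (rule Z_commute)
qed (use assms(2) carr Z_carrier in \<open>auto simp: C3_def\<close>)

text \<open>Every step of the chain is strict for the same reason: the new generator fails to
  commute with an element that the previous subgroup centralises, namely \<open>a3\<close> with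
  \<open>a\<close>, \<open>a2\<close> with \<open>a1\<close>, \<open>a1\<close> with
  \<open>a2\<close>, and \<open>a\<close> with \<open>a3\<close>.\<close>

lemma ext_C3: "cyclic_ext G Z a3 p"
proof (intro cyclic_ext.intro cyclic_ext_axioms.intro group_axioms)
  show "a3 \<notin> Z"
  proof
    assume "a3 \<in> Z"
    then have "a3 \<otimes> a = a \<otimes> a3" using Z_commute carr by blast
    then have "a \<otimes> a3 \<otimes> a4 = a \<otimes> a3" using rel3 by simp
    then show False using a4 a4_carrier carr by simp
  qed
  show "inv a3 \<otimes> c \<otimes> a3 \<in> Z" if "c \<in> Z" for c
    using that Z_commute[OF that carr(4)] Z_carrier carr by (simp add: conj_trivial subset_iff)
  show "a3 [^] p \<in> Z" using center_subgroup pow_a3 by (simp add: subgroup.one_closed)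
qed (use fin carr prime center_subgroup in auto)

lemma C3: "subgroup C3 G" "Z \<subseteq> C3" "a3 \<in> C3" "C3 \<subseteq> carrier G" "card C3 = p * card Z"
proof -
  interpret cyclic_ext G Z a3 p by (rule ext_C3)
  show "subgroup C3 G" unfolding C3_def by (rule ext_subgroup)
  then show "C3 \<subseteq> carrier G" by (rule subgroup.subset)
  show "Z \<subseteq> C3" "a3 \<in> C3" unfolding C3_def
    using pow_ext_base[OF center_subgroup] pow_ext_gen[OF center_subgroup] carr by auto
  show "card C3 = p * card Z" unfolding C3_def by (rule card_ext)
qed

lemma a4_contra: "a1 \<otimes> a2 \<noteq> a2 \<otimes> a1"
proof
  assume "a1 \<otimes> a2 = a2 \<otimes> a1"
  then have "a2 \<otimes> a1 \<otimes> a4 = a2 \<otimes> a1" using rel12 by simp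
  then show False using a4 a4_carrier carr by simp
qed

lemma ext_E: "cyclic_ext G C3 a2 p"
proof (intro cyclic_ext.intro cyclic_ext_axioms.intro group_axioms)
  show "a2 \<notin> C3" using commute_C3[of a1 a2] a4_contra by metis
  show "inv a2 \<otimes> c \<otimes> a2 \<in> C3" if "c \<in> C3" for c
    using that commute_C3[of a2 c] C3(4) carr by (simp add: conj_trivial subset_iff)
qed (use fin carr prime C3 pow_a2 in auto)

lemma E: "subgroup E G" "C3 \<subseteq> E" "a2 \<in> E" "E \<subseteq> carrier G" "card E = p * card C3"
proof -
  interpret cyclic_ext G C3 a2 p by (rule ext_E)
  show "subgroup E G" unfolding E_def by (rule ext_subgroup)
  then show "E \<subseteq> carrier G" by (rule subgroup.subset)
  show "C3 \<subseteq> E" "a2 \<in> E" unfolding E_def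
    using pow_ext_base[OF C3(1)] pow_ext_gen[OF C3(1)] carr by auto
  show "card E = p * card C3" unfolding E_def by (rule card_ext)
qed

lemma commute_E:
  assumes "t = a2 \<or> t = a3" "x \<in> E"
  shows "x \<otimes> t = t \<otimes> x"
proof (rule commute_pow_ext[of C3 a2 t x])
  show "a2 \<otimes> t = t \<otimes> a2" using assms(1) rel23 by auto
  show "c \<otimes> t = t \<otimes> c" if "c \<in> C3" for c using that assms(1) by (intro commute_C3) auto
qed (use assms carr C3(4) in \<open>auto simp: E_def\<close>)

lemma stable_Z: "t \<in> carrier G \<Longrightarrow> stable t Z \<chi>"
  by (rule stable_commute[OF Z_carrier _ Z_commute])

lemma stable_C3_a:
  assumes "linear_char G B \<chi>" "C3 \<subseteq> B" "\<chi> a4 = 1"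
  shows "stable a C3 \<chi>"
  using assms C3(1) center_subgroup carr a4 unfolding C3_def
  by (intro stable_pow_ext_subset[of B \<chi> a3 Z a a4] stable_Z conj_rels)

lemma stable_E_a1:
  assumes "linear_char G B \<chi>" "E \<subseteq> B" "\<chi> (inv a4) = 1"
  shows "stable a1 E \<chi>"
proof -
  have "stable a1 C3 \<chi>" by (rule stable_commute[OF C3(4) carr(2) commute_C3]) simp_all
  moreover have "inv a4 \<in> C3" using inv_a4 C3(2) by blast
  ultimately show ?thesis
    using assms E(1) C3(1) carr unfolding E_def
    by (intro stable_pow_ext_subset[of B \<chi> a2 C3 a1 "inv a4"] conj_rels)
qed

lemma stable_E_a:
  assumes "linear_char G B \<chi>" "E \<subseteq> B" "\<chi> a4 = 1" "\<chi> a3 = 1"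
  shows "stable a E \<chi>"
proof -
  have "stable a C3 \<chi>" using assms E(2) by (intro stable_C3_a[of B]) auto
  then show ?thesis
    using assms E(1) C3(1,3) carr unfolding E_def
    by (intro stable_pow_ext_subset[of B \<chi> a2 C3 a a3] conj_rels)
qed

lemma ext_N: "cyclic_ext G E a1 p"
proof (intro cyclic_ext.intro cyclic_ext_axioms.intro group_axioms)
  show "a1 \<notin> E" using commute_E[of a2 a1] a4_contra by metis
  show "inv a1 \<otimes> c \<otimes> a1 \<in> E" if "c \<in> E" for c
  proof -
    \<comment> \<open>Normality is read off from the stability of the trivial character, which takes
      the value 1 at this element.\<close>
    have "inv a4 \<in> E" using inv_a4 C3(2) E(2) by blast
    then show ?thesis
      using stable_E_a1[OF linear_char_indicator[OF E(1)] subset_refl] that by (simp add: stable_def)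
  qed
  show "a1 [^] p \<in> E" using pow_a1 E(2) unfolding C3_def[symmetric] by blast
qed (use fin carr prime E in auto)

lemma N: "subgroup N G" "E \<subseteq> N" "a1 \<in> N" "N \<subseteq> carrier G" "card N = p * card E"
proof -
  interpret cyclic_ext G E a1 p by (rule ext_N)
  show "subgroup N G" unfolding N_def by (rule ext_subgroup)
  then show "N \<subseteq> carrier G" by (rule subgroup.subset)
  show "E \<subseteq> N" "a1 \<in> N" unfolding N_def
    using pow_ext_base[OF E(1)] pow_ext_gen[OF E(1)] carr by auto
  show "card N = p * card E" unfolding N_def by (rule card_ext)
qed

lemma ext_G: "cyclic_ext G N a p"
proof (intro cyclic_ext.intro cyclic_ext_axioms.intro group_axioms)
  have "x \<otimes> a3 = a3 \<otimes> x" if "x \<in> N" for x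
  proof (rule commute_pow_ext[of E a1 a3 x])
    show "c \<otimes> a3 = a3 \<otimes> c" if "c \<in> E" for c using that by (intro commute_E) auto
  qed (use that carr E(4) rel13 in \<open>auto simp: N_def\<close>)
  moreover have "a \<otimes> a3 \<noteq> a3 \<otimes> a"
  proof
    assume "a \<otimes> a3 = a3 \<otimes> a"
    then have "a \<otimes> a3 \<otimes> a4 = a \<otimes> a3" using rel3 by simp
    then show False using a4 a4_carrier carr by simp
  qed
  ultimately show "a \<notin> N" by metis
  show "inv a \<otimes> c \<otimes> a \<in> N" if "c \<in> N" for c
  proof -
    let ?i = "\<lambda>x. if x \<in> N then 1 else 0 :: complex"
    have i: "linear_char G N ?i" by (rule linear_char_indicator[OF N(1)])
    have in_N: "a4 \<in> N" "a3 \<in> N" "a2 \<in> N" using a4(1) C3(2,3) E(2,3) N(2) by auto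
    have "stable a E ?i" using i N(2) in_N by (intro stable_E_a) auto
    then have "stable a N ?i"
      using i N(1) E(1,3) carr in_N unfolding N_def
      by (intro stable_pow_ext_subset[of "pow_ext a1 E" _ a1 E a a2] conj_rels) auto
    then show ?thesis using that by (simp add: stable_def)
  qed
  show "a [^] p \<in> N" using pow_a C3(2) E(2) N(2) by blast
qed (use fin carr prime N in auto)

lemma G_eq: "carrier G = pow_ext a N"
proof -
  interpret cyclic_ext G N a p by (rule ext_G)
  have "carrier G \<subseteq> pow_ext a N"
  proof (rule gen[OF ext_subgroup])
    show "a \<in> pow_ext a N" by (rule pow_ext_gen[OF N(1) carr(1)])
    have "Z \<subseteq> N" using C3(2) E(2) N(2) by blast
    then show "a1 \<in> pow_ext a N" "Z \<subseteq> pow_ext a N" using pow_ext_base[OF N(1)] N(3) by auto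
  qed
  then show ?thesis using ext_subgroup by (auto dest: subgroup.mem_carrier)
qed

text \<open>Four steps of index \<open>p\<close> lead from the centre to a group of order p^5, which
  leaves \<open>p\<close> for the centre.\<close>

lemma cards: "card Z = p" "card C3 = p ^ 2" "card E = p ^ 3" "card N = p ^ 4"
proof -
  interpret cyclic_ext G N a p by (rule ext_G)
  have "p ^ 5 = p * (p * (p * (p * card Z)))"
    using card_ext card_G C3(5) E(5) N(5) by (simp add: G_eq[symmetric])
  moreover have "p > 0" using prime by (simp add: prime_gt_0_nat)
  ultimately show "card Z = p" by (auto simp: eval_nat_numeral)
  then show "card C3 = p ^ 2" "card E = p ^ 3" "card N = p ^ 4"
    using C3(5) E(5) N(5) by (simp_all add: eval_nat_numeral)
qed

lemma G_induct [consumes 1, case_names a a1 a2 a3 Z mult]: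
  assumes x: "x \<in> carrier G" and "P a" "P a1" "P a2" "P a3" and PZ: "\<And>z. z \<in> Z \<Longrightarrow> P z"
    and mult: "\<And>u v. u \<in> carrier G \<Longrightarrow> v \<in> carrier G \<Longrightarrow> P u \<Longrightarrow> P v \<Longrightarrow> P (u \<otimes> v)"
  shows "P x"
proof -
  have one: "P \<one>" using PZ center_subgroup by (simp add: subgroup.one_closed)
  have PC3: "P c" if "c \<in> C3" for c
    using that Z_carrier carr(4) PZ \<open>P a3\<close> one mult unfolding C3_def by (rule pow_ext_induct)
  have PE: "P c" if "c \<in> E" for c
    using that C3(4) carr(3) PC3 \<open>P a2\<close> one mult unfolding E_def by (rule pow_ext_induct)
  have PN: "P c" if "c \<in> N" for c
    using that E(4) carr(2) PE \<open>P a1\<close> one mult unfolding N_def by (rule pow_ext_induct)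
  have "x \<in> pow_ext a N" using x G_eq by simp
  then show ?thesis
    using N(4) carr(1) PN \<open>P a\<close> one mult by (rule pow_ext_induct)
qed

lemma all_stable:
  assumes "D \<subseteq> carrier G" "stable a D \<chi>" "stable a1 D \<chi>" "stable a2 D \<chi>" "stable a3 D \<chi>" "t \<in> carrier G"
  shows "stable t D \<chi>"
  using assms(6)
proof (induction rule: G_induct)
  case (Z z)
  have "c \<otimes> z = z \<otimes> c" if "c \<in> D" for c
    using Z_commute[OF Z, of c] that assms(1) by auto
  then show ?case using assms(1) Z Z_carrier by (intro stable_commute) auto
next
  case (mult u v)
  then show ?case using assms(1) by (simp add: stable_mult)
qed (use assms in auto)

text \<open>Only \<open>a\<close> needs the hypothesis on \<open>a4\<close>, by which it moves
  \<open>a3\<close>; the other generators centralise \<open>C3\<close>.\<close>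

lemma all_stable_C3:
  assumes "linear_char G B \<chi>" "C3 \<subseteq> B" "\<chi> a4 = 1" "t \<in> carrier G"
  shows "stable t C3 \<chi>"
  using assms(4)
proof (rule all_stable[OF C3(4) stable_C3_a[OF assms(1-3)], rotated 3])
  show "stable a1 C3 \<chi>" "stable a2 C3 \<chi>" "stable a3 C3 \<chi>"
    by (rule stable_commute[OF C3(4) _ commute_C3], use carr in simp_all)+
qed

lemma all_stable_E:
  assumes \<chi>: "linear_char G B \<chi>" "E \<subseteq> B" "\<And>c. c \<in> C3 \<Longrightarrow> \<chi> c = 1" "t \<in> carrier G"
  shows "stable t E \<chi>"
proof (rule all_stable)
  have "a4 \<in> C3" "inv a4 \<in> C3" "a3 \<in> C3" using a4(1) inv_a4 C3 by auto
  then show "stable a E \<chi>" "stable a1 E \<chi>" using \<chi> by (auto intro: stable_E_a stable_E_a1)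
  show "stable a2 E \<chi>" "stable a3 E \<chi>"
    by (rule stable_commute[OF E(4) _ commute_E], use carr in simp_all)+
qed (use E(4) assms in auto)

text \<open>The centre is itself a step of the same kind, over the trivial subgroup: it has order
  \<open>p\<close> and contains the nontrivial element \<open>a4\<close>.\<close>

lemma Z_eq: "cyclic_ext G {\<one>} a4 p" "Z = pow_ext a4 {\<one>}"
proof -
  show ext: "cyclic_ext G {\<one>} a4 p"
    by (intro cyclic_ext.intro cyclic_ext_axioms.intro group_axioms)
      (use fin a4_carrier prime a4 in \<open>auto simp: triv_subgroup\<close>)
  interpret cyclic_ext G "{\<one>}" a4 p by (rule ext)
  have "pow_ext a4 {\<one>} \<subseteq> Z"
    using center_subgroup a4(1) by (intro pow_ext_least) (auto simp: subgroup.one_closed)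
  then have "pow_ext a4 {\<one>} = Z"
    using cards(1) card_ext fin Z_carrier by (intro card_seteq) (auto intro: finite_subset)
  then show "Z = pow_ext a4 {\<one>}" by simp
qed

end

context group
begin

definition right_invariant :: "('a \<Rightarrow> rat) \<Rightarrow> 'a set \<Rightarrow> bool" where
  "right_invariant f C \<longleftrightarrow> (\<forall>x\<in>carrier G. \<forall>c\<in>C. f (x \<otimes> c) = f x)"

end

section \<open>Commutators and the derived subgroup\<close>

context phi10_relations
begin

text \<open>Central factors move freely, so the displacement of a product under conjugation by
  \<open>a\<close> is the product of the displacements.\<close>

lemma C3_conj:
  assumes "c \<in> C3"
  shows "\<exists>e\<in>Z. inv a \<otimes> c \<otimes> a = c \<otimes> e"
  using assms Z_carrier carr(4) unfolding C3_def
proof (induction rule: pow_ext_induct)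
  case (base c)
  then have "inv a \<otimes> c \<otimes> a = c" using Z_carrier carr Z_commute[OF base carr(1)] by (intro conj_trivial) auto
  then show ?case
    using base Z_carrier center_subgroup by (intro bexI[of _ \<one>]) (auto simp: subgroup.one_closed subset_iff)
next
  case (mult u v)
  then obtain e e' where e: "e \<in> Z" "e' \<in> Z" "inv a \<otimes> u \<otimes> a = u \<otimes> e" "inv a \<otimes> v \<otimes> a = v \<otimes> e'" by blast
  have G: "e \<in> carrier G" "e' \<in> carrier G" using e Z_carrier by auto
  have "inv a \<otimes> (u \<otimes> v) \<otimes> a = (inv a \<otimes> u \<otimes> a) \<otimes> (inv a \<otimes> v \<otimes> a)"
    using mult carr by (simp add: group_word_simps)
  also have "\<dots> = u \<otimes> (e \<otimes> v) \<otimes> e'" using e G mult by (simp add: m_assoc)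
  also have "e \<otimes> v = v \<otimes> e" using e(1) mult(2) by (rule Z_commute)
  also have "u \<otimes> (v \<otimes> e) \<otimes> e' = u \<otimes> v \<otimes> (e \<otimes> e')" using G mult by (simp add: m_assoc)
  finally show ?case using e center_subgroup by (blast intro: subgroup.m_closed)
next
  case gen
  show ?case using conj_rels(3) a4(1) by blast
next
  case one
  show ?case
    by (rule bexI[of _ \<one>]) (use carr center_subgroup in \<open>auto simp: subgroup.one_closed\<close>)
qed

lemma C3_normal: "t \<in> carrier G \<Longrightarrow> c \<in> C3 \<Longrightarrow> inv t \<otimes> c \<otimes> t \<in> C3"
proof -
  assume "t \<in> carrier G" "c \<in> C3"
  moreover have "a4 \<in> C3" using a4(1) C3(2) by blast
  ultimately show ?thesis
    using all_stable_C3[OF linear_char_indicator[OF C3(1)] subset_refl] by (simp add: stable_def)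
qed

lemma E_normal: "t \<in> carrier G \<Longrightarrow> c \<in> E \<Longrightarrow> inv t \<otimes> c \<otimes> t \<in> E"
proof -
  assume *: "t \<in> carrier G" "c \<in> E"
  let ?i = "\<lambda>x. if x \<in> E then 1 else 0 :: complex"
  have "?i c = 1" if "c \<in> C3" for c using that E(2) by auto
  then show ?thesis
    using * all_stable_E[OF linear_char_indicator[OF E(1)] subset_refl, of t] by (simp add: stable_def)
qed

text \<open>The same induction one step higher; the displacement of \<open>u\<close> now gets
  conjugated by \<open>v\<close>, which is where normality of \<open>C3\<close> enters.\<close>

lemma E_conj:
  assumes "c \<in> E"
  shows "\<exists>e\<in>C3. inv a \<otimes> c \<otimes> a = c \<otimes> e"
  using assms C3(4) carr(3) unfolding E_def
proof (induction rule: pow_ext_induct)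
  case (base c)
  then show ?case using C3_conj[OF base] C3(2) by blast
next
  case (mult u v)
  then obtain e e' where e: "e \<in> C3" "e' \<in> C3" "inv a \<otimes> u \<otimes> a = u \<otimes> e" "inv a \<otimes> v \<otimes> a = v \<otimes> e'" by blast
  have G: "e \<in> carrier G" "e' \<in> carrier G" using e C3(4) by auto
  have "inv a \<otimes> (u \<otimes> v) \<otimes> a = (inv a \<otimes> u \<otimes> a) \<otimes> (inv a \<otimes> v \<otimes> a)"
    using mult carr by (simp add: group_word_simps)
  also have "\<dots> = u \<otimes> v \<otimes> ((inv v \<otimes> e \<otimes> v) \<otimes> e')" using e G mult by (simp add: group_word_simps)
  finally have "inv a \<otimes> (u \<otimes> v) \<otimes> a = u \<otimes> v \<otimes> ((inv v \<otimes> e \<otimes> v) \<otimes> e')" .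
  moreover have "(inv v \<otimes> e \<otimes> v) \<otimes> e' \<in> C3"
    using C3_normal[OF mult(2) e(1)] e(2) C3(1) by (simp add: subgroup.m_closed)
  ultimately show ?case by blast
next
  case gen
  show ?case using conj_rels(2) C3(3) by blast
next
  case one
  show ?case
    by (rule bexI[of _ \<one>]) (use carr C3(1) in \<open>auto simp: subgroup.one_closed\<close>)
qed

lemma E_commutators:
  assumes "u \<in> carrier G" "x \<in> carrier G"
  shows "\<exists>e\<in>E. inv u \<otimes> x \<otimes> u = x \<otimes> e"
proof -
  \<comment> \<open>\<open>Q u x\<close> says that \<open>u\<close> and \<open>x\<close> commute
    modulo \<open>E\<close>. It is symmetric and, since \<open>E\<close> is normal, multiplicative
    in \<open>x\<close>.\<close>
  define Q where "Q u x \<longleftrightarrow> (\<exists>e\<in>E. x \<otimes> u = u \<otimes> x \<otimes> e)" for u x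
  have symQ: "Q x u" if Qux: "Q u x" and G: "u \<in> carrier G" "x \<in> carrier G" for u x
  proof -
    obtain e where e: "e \<in> E" "x \<otimes> u = u \<otimes> x \<otimes> e" using Qux by (auto simp: Q_def)
    have eG: "e \<in> carrier G" using e E(4) by blast
    have "u \<otimes> x = x \<otimes> u \<otimes> inv e" unfolding e(2) using eG G by (simp add: m_assoc)
    then show ?thesis using e(1) E(1) unfolding Q_def by (blast intro: subgroup.m_inv_closed)
  qed
  have multQ: "Q u (x \<otimes> y)" if Q: "Q u x" "Q u y" and G: "u \<in> carrier G" "x \<in> carrier G" "y \<in> carrier G" for u x y
  proof -
    obtain e f where e: "e \<in> E" "x \<otimes> u = u \<otimes> x \<otimes> e" and f: "f \<in> E" "y \<otimes> u = u \<otimes> y \<otimes> f"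
      using Q by (auto simp: Q_def)
    have efG: "e \<in> carrier G" "f \<in> carrier G" using e f E(4) by auto
    have "x \<otimes> y \<otimes> u = x \<otimes> (y \<otimes> u)" using G by (simp add: m_assoc)
    also have "\<dots> = (x \<otimes> u) \<otimes> y \<otimes> f" unfolding f(2) using G efG by (simp add: m_assoc)
    also have "\<dots> = u \<otimes> (x \<otimes> y) \<otimes> ((inv y \<otimes> e \<otimes> y) \<otimes> f)"
      unfolding e(2) using G efG by (simp add: group_word_simps)
    finally have "x \<otimes> y \<otimes> u = u \<otimes> (x \<otimes> y) \<otimes> ((inv y \<otimes> e \<otimes> y) \<otimes> f)" .
    moreover have "(inv y \<otimes> e \<otimes> y) \<otimes> f \<in> E"
      using E_normal[OF G(3) e(1)] f(1) E(1) by (simp add: subgroup.m_closed)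
    ultimately show ?thesis by (auto simp: Q_def)
  qed
  have E_Q: "Q u e" if "e \<in> E" "u \<in> carrier G" for u e
  proof -
    have eG: "e \<in> carrier G" using that E(4) by blast
    have "e \<otimes> u = u \<otimes> e \<otimes> (inv e \<otimes> (inv u \<otimes> e \<otimes> u))" using that eG by (simp add: group_word_simps)
    moreover have "inv e \<otimes> (inv u \<otimes> e \<otimes> u) \<in> E"
      using E_normal[OF that(2,1)] that(1) E(1) by (simp add: subgroup.m_closed subgroup.m_inv_closed)
    ultimately show ?thesis by (auto simp: Q_def)
  qed
  have in_E: "\<one> \<in> E" "a3 \<in> E" "z \<in> E" if "z \<in> Z" for z
    using that C3 E subgroup.one_closed[OF E(1)] by auto
  have self: "Q u u" if "u \<in> carrier G" for u
    unfolding Q_def by (rule bexI[of _ \<one>]) (use that subgroup.one_closed[OF E(1)] in simp_all)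
  have a_a1: "Q a a1" unfolding Q_def using rel1 E(3) by blast
  have Qgen: "Q u x" if u: "Q u a" "Q u a1" "u \<in> carrier G" and x: "x \<in> carrier G" for u x
    using x
  proof (induction rule: G_induct)
    case (mult v w)
    then show ?case using multQ u(3) by blast
  next
    case a2
    show ?case by (rule E_Q[OF E(3) u(3)])
  next
    case a3
    show ?case by (rule E_Q[OF in_E(2)[OF a4(1)] u(3)])
  next
    case (Z z)
    show ?case by (rule E_Q[OF in_E(3)[OF Z] u(3)])
  qed (rule u)+
  \<comment> \<open>Three rounds: every element commutes modulo \<open>E\<close> with
    \<open>a\<close>, then with \<open>a1\<close>, and so an arbitrary \<open>u\<close> satisfies
    the premises of \<open>Qgen\<close>.\<close>
  have "Q a x" if "x \<in> carrier G" for x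
    by (rule Qgen[OF self[OF carr(1)] a_a1 carr(1) that])
  then have Qa: "Q x a" if "x \<in> carrier G" for x by (rule symQ) (use that carr in auto)
  have "Q a1 x" if "x \<in> carrier G" for x
    by (rule Qgen[OF Qa[OF carr(2)] self[OF carr(2)] carr(2) that])
  then have Qa1: "Q x a1" if "x \<in> carrier G" for x by (rule symQ) (use that carr in auto)
  have "Q u x" by (rule Qgen[OF Qa[OF assms(1)] Qa1[OF assms(1)] assms])
  then obtain e where e: "e \<in> E" "x \<otimes> u = u \<otimes> x \<otimes> e" by (auto simp: Q_def)
  then have "inv u \<otimes> (x \<otimes> u) = x \<otimes> e" using assms E(4) by (simp add: m_assoc inv_cancel subset_iff)
  then show ?thesis using e assms by (auto simp: m_assoc)
qed

lemma derived_eq: "commutator_subgroup G = E"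
proof
  have "h \<otimes> k \<otimes> inv h \<otimes> inv k \<in> E" if hk: "h \<in> carrier G" "k \<in> carrier G" for h k
  proof -
    obtain e where e: "e \<in> E" "inv (inv h) \<otimes> k \<otimes> inv h = k \<otimes> e"
      using E_commutators[of "inv h" k] hk by auto
    have "inv (inv k) \<otimes> e \<otimes> inv k \<in> E" by (rule E_normal) (use hk e in auto)
    then show ?thesis using e hk by simp
  qed
  then have "derived_set G (carrier G) \<subseteq> E" by auto
  then show "commutator_subgroup G \<subseteq> E"
    unfolding derived_def using E(1) by (rule generate_subgroup_incl)
next
  let ?D = "commutator_subgroup G"
  have D: "subgroup ?D G" by (rule derived_is_subgroup) simp
  have comm: "inv x \<otimes> inv y \<otimes> x \<otimes> y \<in> ?D" if "x \<in> carrier G" "y \<in> carrier G" for x y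
  proof -
    have "inv x \<otimes> inv y \<otimes> inv (inv x) \<otimes> inv (inv y) \<in> derived_set G (carrier G)"
      using that by (intro UN_I[of "inv x"] UN_I[of "inv y"]) auto
    then have "inv x \<otimes> inv y \<otimes> inv (inv x) \<otimes> inv (inv y) \<in> ?D"
      unfolding derived_def by (rule generate.incl)
    then show ?thesis using that by simp
  qed
  have *: "d \<in> ?D" if "inv t \<otimes> x \<otimes> t = x \<otimes> d" "t \<in> carrier G" "x \<in> carrier G" "d \<in> carrier G" for t x d
  proof -
    have "inv x \<otimes> inv t \<otimes> x \<otimes> t = inv x \<otimes> (inv t \<otimes> x \<otimes> t)" using that by (simp add: m_assoc)
    also have "\<dots> = d" unfolding that(1) using that by (simp add: inv_cancel)
    finally show ?thesis using comm[OF that(3,2)] by simp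
  qed
  \<comment> \<open>Conjugation by \<open>a\<close> exhibits all three as commutators, and
    \<open>a4\<close> generates the centre.\<close>
  have gens: "a2 \<in> ?D" "a3 \<in> ?D" "a4 \<in> ?D"
    by (rule *[OF conj_rels(1)] *[OF conj_rels(2)] *[OF conj_rels(3)], use carr a4_carrier in simp_all)+
  have "Z \<subseteq> ?D"
    unfolding Z_eq(2) using D gens by (intro pow_ext_least) (auto simp: subgroup.one_closed)
  then show "E \<subseteq> ?D"
    unfolding E_def C3_def using D gens by (intro pow_ext_least) auto
qed

section \<open>Characters that force invariance under one more subgroup\<close>

lemma right_invariant_Z:
  assumes \<chi>: "linear_char G B \<chi>" and B: "Z \<subseteq> B" and z: "\<chi> a4 \<noteq> 1"
    and move: "\<And>x. x \<in> B - Z \<Longrightarrow> \<exists>u\<in>carrier G. \<exists>c\<in>Z. inv u \<otimes> x \<otimes> u = x \<otimes> c \<and> \<chi> c \<noteq> 1"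
    and f: "char_null G \<chi> (\<lambda>x. of_rat (f x))"
  shows "right_invariant f Z"
proof -
  interpret cyclic_ext G "{\<one>}" a4 p by (rule Z_eq)
  have "(\<Sum>c\<in>Z. of_rat (f (g \<otimes> c)) * \<chi> c) = 0" if "g \<in> carrier G" for g
  proof (rule char_null_central[OF fin \<chi> B _ move f that])
    fix c t assume "c \<in> Z" "t \<in> carrier G"
    then show "\<chi> (inv t \<otimes> c \<otimes> t) = \<chi> c \<and> inv t \<otimes> c \<otimes> t \<in> Z"
      using stable_Z[of t \<chi>] by (simp add: stable_def)
  qed
  then have sum0: "(\<Sum>c\<in>pow_ext a4 {\<one>}. of_rat (f (g \<otimes> c)) * \<chi> c) = 0" if "g \<in> carrier G" for g
    using that by (simp only: Z_eq(2)[symmetric])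
  have "f (x \<otimes> d) = f x" if x: "x \<in> carrier G" and d: "d \<in> Z" for x d
  proof (rule right_invariant_ext[OF _ \<chi> _ _ _ z sum0 x])
    show "d \<in> pow_ext a4 {\<one>}" using d Z_eq(2) by simp
    show "a4 \<in> B" "{\<one>} \<subseteq> B"
      using a4(1) B linear_char_subgroup[OF \<chi>] by (auto simp: subgroup.one_closed)
  qed (auto simp: linear_char_one[OF \<chi>])
  then show ?thesis by (simp add: right_invariant_def)
qed

lemma central_char:
  assumes K: "complex_subfield K" and w: "w ^ p = 1" "w \<in> K"
  obtains \<chi> where "linear_char G Z \<chi>" "\<And>x. \<chi> x \<in> K" "\<chi> a4 = w"
proof -
  interpret cyclic_ext G "{\<one>}" a4 p by (rule Z_eq)
  let ?i = "\<lambda>x. if x \<in> {\<one>} then 1 else 0 :: complex"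
  have "0 \<in> K" "1 \<in> K" using K of_rat_0 of_rat_1 unfolding complex_subfield_def by metis+
  then have i: "?i x \<in> K" for x by simp
  have st: "stable a4 {\<one>} ?i" using a4_carrier by (simp add: stable_def)
  have pw: "w ^ p = ?i (a4 [^] p)" using w a4 by simp
  show thesis
  proof (rule char_extend[OF linear_char_indicator[OF sub] st pw K i w(2)])
    fix \<chi> assume "linear_char G (pow_ext a4 {\<one>}) \<chi>" "\<chi> a4 = w" "\<And>x. \<chi> x \<in> K"
    then show thesis by (intro that[of \<chi>]) (simp_all add: Z_eq(2)[symmetric])
  qed
qed

lemma extend_char_C3:
  assumes \<chi>: "linear_char G Z \<chi>" and K: "complex_subfield K" "\<And>x. \<chi> x \<in> K" and w: "w ^ p = 1" "w \<in> K"
  obtains \<chi>' where "linear_char G C3 \<chi>'" "\<And>c. c \<in> Z \<Longrightarrow> \<chi>' c = \<chi> c" "\<chi>' a3 = w" "\<And>x. \<chi>' x \<in> K"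
proof -
  interpret cyclic_ext G Z a3 p by (rule ext_C3)
  have pw: "w ^ p = \<chi> (a3 [^] p)" using w pow_a3 \<chi> by (simp add: linear_char_one)
  show thesis
  proof (rule char_extend[OF \<chi> stable_Z[OF carr(4)] pw K w(2)])
    fix \<chi>' assume *: "linear_char G (pow_ext a3 Z) \<chi>'" "\<And>c. c \<in> Z \<Longrightarrow> \<chi>' c = \<chi> c"
      "\<chi>' a3 = w" "\<And>x. \<chi>' x \<in> K"
    show thesis by (rule that[of \<chi>']) (use * in \<open>simp_all add: C3_def\<close>)
  qed
qed

lemma extend_char_E:
  assumes \<chi>: "linear_char G C3 \<chi>" and K: "complex_subfield K" "\<And>x. \<chi> x \<in> K" and w: "w ^ p = \<chi> (a2 [^] p)" "w \<in> K"
  obtains \<chi>' where "linear_char G E \<chi>'" "\<And>c. c \<in> C3 \<Longrightarrow> \<chi>' c = \<chi> c" "\<chi>' a2 = w" "\<And>x. \<chi>' x \<in> K"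
proof -
  interpret cyclic_ext G C3 a2 p by (rule ext_E)
  have st: "stable a2 C3 \<chi>" by (rule stable_commute[OF C3(4) carr(3) commute_C3]) simp_all
  show thesis
  proof (rule char_extend[OF \<chi> st w(1) K w(2)])
    fix \<chi>' assume *: "linear_char G (pow_ext a2 C3) \<chi>'" "\<And>c. c \<in> C3 \<Longrightarrow> \<chi>' c = \<chi> c"
      "\<chi>' a2 = w" "\<And>x. \<chi>' x \<in> K"
    show thesis by (rule that[of \<chi>']) (use * in \<open>simp_all add: E_def\<close>)
  qed
qed

lemma extend_char_N:
  assumes \<chi>: "linear_char G E \<chi>" "\<chi> (inv a4) = 1" and K: "complex_subfield K" "\<And>x. \<chi> x \<in> K"
    and w: "w ^ p = \<chi> (a1 [^] p)" "w \<in> K"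
  obtains \<chi>' where "linear_char G N \<chi>'" "\<And>c. c \<in> E \<Longrightarrow> \<chi>' c = \<chi> c" "\<chi>' a1 = w" "\<And>x. \<chi>' x \<in> K"
proof -
  interpret cyclic_ext G E a1 p by (rule ext_N)
  show thesis
  proof (rule char_extend[OF \<chi>(1) stable_E_a1[OF \<chi>(1) subset_refl \<chi>(2)] w(1) K w(2)])
    fix \<chi>' assume *: "linear_char G (pow_ext a1 E) \<chi>'" "\<And>c. c \<in> E \<Longrightarrow> \<chi>' c = \<chi> c"
      "\<chi>' a1 = w" "\<And>x. \<chi>' x \<in> K"
    show thesis by (rule that[of \<chi>']) (use * in \<open>simp_all add: N_def\<close>)
  qed
qed

text \<open>The character sits on \<open>E\<close> rather than \<open>N\<close>: conjugates of
  \<open>a1\<close> that lie in the coset a_1 C_3 already lie in a_1 Z, where \<open>\<chi>\<close>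
  would not separate them, so \<open>a1\<close> could not be moved as
  \<open>char_null_central\<close> requires. Elements of \<open>E\<close> outside \<open>C3\<close>
  are moved by \<open>a\<close>.\<close>

lemma right_invariant_C3:
  assumes \<chi>: "linear_char G E \<chi>" "\<And>z. z \<in> Z \<Longrightarrow> \<chi> z = 1" "\<chi> a3 \<noteq> 1"
    and inv: "right_invariant f Z" and f: "char_null G \<chi> (\<lambda>x. of_rat (f x))"
  shows "right_invariant f C3"
proof -
  interpret C3: cyclic_ext G Z a3 p by (rule ext_C3)
  interpret E: cyclic_ext G C3 a2 p by (rule ext_E)
  have st: "stable t C3 \<chi>" if "t \<in> carrier G" for t
    using \<chi>(2)[OF a4(1)] that by (rule all_stable_C3[OF \<chi>(1) E(2)])
  have pow1: "\<chi> a3 ^ p = 1"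
    using linear_char_pow[OF \<chi>(1), of a3 p] C3(3) E(2) pow_a3 linear_char_one[OF \<chi>(1)] by auto
  have move: "\<exists>u\<in>carrier G. \<exists>c\<in>C3. inv u \<otimes> x \<otimes> u = x \<otimes> c \<and> \<chi> c \<noteq> 1" if x: "x \<in> E - C3" for x
  proof -
    have "\<exists>c\<in>C3. inv a \<otimes> x \<otimes> a = x \<otimes> c \<and> \<chi> c \<noteq> 1"
    proof (rule E.conjugate_moves[OF _ C3(1) subset_refl st carr(1) C3(3) conj_rels(2) pow1 \<chi>(3)])
      show "linear_char G (pow_ext a2 C3) \<chi>" using \<chi>(1) by (simp add: E_def)
      show "x \<in> pow_ext a2 C3 - C3" using x by (simp add: E_def)
      show "\<exists>e\<in>C3. inv a \<otimes> c \<otimes> a = c \<otimes> e \<and> \<chi> e = 1" if "c \<in> C3" for c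
        using C3_conj[OF that] \<chi>(2) C3(2) by blast
    qed
    then show ?thesis using carr(1) by blast
  qed
  have sum0: "(\<Sum>c\<in>pow_ext a3 Z. of_rat (f (g \<otimes> c)) * \<chi> c) = 0" if "g \<in> carrier G" for g
    unfolding C3_def[symmetric]
  proof (rule char_null_central[OF fin \<chi>(1) E(2) _ move f that])
    fix c t assume "c \<in> C3" "t \<in> carrier G"
    then show "\<chi> (inv t \<otimes> c \<otimes> t) = \<chi> c \<and> inv t \<otimes> c \<otimes> t \<in> C3"
      using st[of t] by (simp add: stable_def)
  qed
  have "f (x \<otimes> d) = f x" if x: "x \<in> carrier G" and d: "d \<in> C3" for x d
  proof (rule C3.right_invariant_ext[OF _ \<chi>(1) _ _ \<chi>(2) \<chi>(3) sum0 x])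
    show "d \<in> pow_ext a3 Z" using d by (simp add: C3_def)
  qed (use inv C3 E(2) in \<open>auto simp: right_invariant_def\<close>)
  then show ?thesis by (simp add: right_invariant_def)
qed

text \<open>One step up that obstruction is gone: \<open>a\<close> moves \<open>a1\<close> by
  \<open>a2\<close>, which lies in \<open>E\<close> and has nontrivial value, so the character may
  sit on all of \<open>N\<close>.\<close>

lemma right_invariant_E:
  assumes \<chi>: "linear_char G N \<chi>" "\<And>c. c \<in> C3 \<Longrightarrow> \<chi> c = 1" "\<chi> a2 \<noteq> 1"
    and inv: "right_invariant f C3" and f: "char_null G \<chi> (\<lambda>x. of_rat (f x))"
  shows "right_invariant f E"
proof -
  interpret E: cyclic_ext G C3 a2 p by (rule ext_E)
  interpret N: cyclic_ext G E a1 p by (rule ext_N)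
  have st: "stable t E \<chi>" if "t \<in> carrier G" for t
    by (rule all_stable_E[OF \<chi>(1) N(2) \<chi>(2) that])
  have "a2 [^] p \<in> C3" using pow_a2 C3(2) by blast
  then have pow1: "\<chi> a2 ^ p = 1"
    using linear_char_pow[OF \<chi>(1), of a2 p] E(3) N(2) \<chi>(2) by auto
  have move: "\<exists>u\<in>carrier G. \<exists>c\<in>E. inv u \<otimes> x \<otimes> u = x \<otimes> c \<and> \<chi> c \<noteq> 1" if x: "x \<in> N - E" for x
  proof -
    have "\<exists>c\<in>E. inv a \<otimes> x \<otimes> a = x \<otimes> c \<and> \<chi> c \<noteq> 1"
    proof (rule N.conjugate_moves[OF _ E(1) subset_refl st carr(1) E(3) conj_rels(1) pow1 \<chi>(3)])
      show "linear_char G (pow_ext a1 E) \<chi>" using \<chi>(1) by (simp add: N_def)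
      show "x \<in> pow_ext a1 E - E" using x by (simp add: N_def)
      show "\<exists>e\<in>E. inv a \<otimes> c \<otimes> a = c \<otimes> e \<and> \<chi> e = 1" if "c \<in> E" for c
        using E_conj[OF that] \<chi>(2) E(2) by blast
    qed
    then show ?thesis using carr(1) by blast
  qed
  have sum0: "(\<Sum>c\<in>pow_ext a2 C3. of_rat (f (g \<otimes> c)) * \<chi> c) = 0" if "g \<in> carrier G" for g
    unfolding E_def[symmetric]
  proof (rule char_null_central[OF fin \<chi>(1) N(2) _ move f that])
    fix c t assume "c \<in> E" "t \<in> carrier G"
    then show "\<chi> (inv t \<otimes> c \<otimes> t) = \<chi> c \<and> inv t \<otimes> c \<otimes> t \<in> E"
      using st[of t] by (simp add: stable_def)
  qed
  have "f (x \<otimes> d) = f x" if x: "x \<in> carrier G" and d: "d \<in> E" for x d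
  proof (rule E.right_invariant_ext[OF _ \<chi>(1) _ _ \<chi>(2) \<chi>(3) sum0 x])
    show "d \<in> pow_ext a2 C3" using d by (simp add: E_def)
  qed (use inv E N(2) in \<open>auto simp: right_invariant_def\<close>)
  then show ?thesis by (simp add: right_invariant_def)
qed

lemma char_inv_a4:
  assumes "linear_char G B \<chi>" "a4 \<in> B"
  shows "\<chi> (inv a4) = inverse (\<chi> a4)"
  using linear_char_inv[OF assms] by (metis inverse_unique)

lemma moves_C3:
  assumes \<chi>: "linear_char G C3 \<chi>" "\<chi> a4 \<noteq> 1" and x: "x \<in> C3 - Z"
  shows "\<exists>u\<in>carrier G. \<exists>c\<in>Z. inv u \<otimes> x \<otimes> u = x \<otimes> c \<and> \<chi> c \<noteq> 1"
proof -
  interpret cyclic_ext G Z a3 p by (rule ext_C3)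
  have "a4 \<in> C3" using a4(1) C3(2) by blast
  then have pow1: "\<chi> a4 ^ p = 1"
    using linear_char_pow[OF \<chi>(1), of a4 p] a4(3) linear_char_one[OF \<chi>(1)] by auto
  have "\<exists>c\<in>Z. inv a \<otimes> x \<otimes> a = x \<otimes> c \<and> \<chi> c \<noteq> 1"
  proof (rule conjugate_moves[OF _ center_subgroup subset_refl stable_Z[of _ \<chi>] carr(1) a4(1) conj_rels(3) pow1 \<chi>(2)])
    show "linear_char G (pow_ext a3 Z) \<chi>" using \<chi>(1) by (simp add: C3_def)
    show "x \<in> pow_ext a3 Z - Z" using x by (simp add: C3_def)
    show "\<exists>e\<in>Z. inv a \<otimes> c \<otimes> a = c \<otimes> e \<and> \<chi> e = 1" if c: "c \<in> Z" for c
    proof (rule bexI[of _ \<one>])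
      have "c \<in> carrier G" using c Z_carrier by blast
      then show "inv a \<otimes> c \<otimes> a = c \<otimes> \<one> \<and> \<chi> \<one> = 1"
        using Z_commute[OF c carr(1)] carr \<chi>(1) by (simp add: conj_trivial linear_char_one)
    qed (rule subgroup.one_closed[OF center_subgroup])
  qed
  then show ?thesis using carr(1) by blast
qed

text \<open>\<open>a1\<close> and \<open>a2\<close> displace each other by a nontrivial central
  element while both centralise \<open>C3\<close>; whichever of them is \<open>y\<close>, the other
  provides \<open>u\<close>.\<close>

lemma moves_over_C3:
  assumes ext: "cyclic_ext G C3 y p" and \<chi>: "linear_char G (pow_ext y C3) \<chi>" "\<chi> d \<noteq> 1"
    and u: "u = a1 \<or> u = a2" and d: "d \<in> Z" "inv u \<otimes> y \<otimes> u = y \<otimes> d" "d [^] p = \<one>"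
    and x: "x \<in> pow_ext y C3 - C3"
  shows "\<exists>u\<in>carrier G. \<exists>c\<in>Z. inv u \<otimes> x \<otimes> u = x \<otimes> c \<and> \<chi> c \<noteq> 1"
proof -
  interpret cyclic_ext G C3 y p by (rule ext)
  have uG: "u \<in> carrier G" using u carr by auto
  have "d \<in> pow_ext y C3" using d(1) C3(2) pow_ext_base[OF C3(1)] by blast
  then have pow1: "\<chi> d ^ p = 1"
    using linear_char_pow[OF \<chi>(1), of d p] d(3) linear_char_one[OF \<chi>(1)] by auto
  have "\<exists>c\<in>Z. inv u \<otimes> x \<otimes> u = x \<otimes> c \<and> \<chi> c \<noteq> 1"
  proof (rule conjugate_moves[OF \<chi>(1) center_subgroup C3(2) stable_Z[of _ \<chi>] uG d(1,2) pow1 \<chi>(2) _ x])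
    show "\<exists>e\<in>Z. inv u \<otimes> c \<otimes> u = c \<otimes> e \<and> \<chi> e = 1" if c: "c \<in> C3" for c
    proof (rule bexI[of _ \<one>])
      have "c \<in> carrier G" "c \<otimes> u = u \<otimes> c" using c C3(4) u commute_C3 by auto
      then show "inv u \<otimes> c \<otimes> u = c \<otimes> \<one> \<and> \<chi> \<one> = 1"
        using uG \<chi>(1) by (simp add: conj_trivial linear_char_one)
    qed (rule subgroup.one_closed[OF center_subgroup])
  qed
  then show ?thesis using uG by blast
qed

text \<open>The faithful character of the centre is extended to a subgroup of index \<open>p\<^sup>2\<close> with values still in
  \<open>\<rat>(\<zeta>\<^sub>p)\<close>: the generator \<open>y\<close> is mapped to 1.\<close>

lemma faithful_char_extension:
  assumes ext: "cyclic_ext G C3 y p" and K: "complex_subfield K"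
    and \<chi>: "linear_char G C3 \<chi>" "\<And>x. \<chi> x \<in> K" "\<chi> a4 \<noteq> 1"
    and gy: "\<chi> (y [^] p) = 1" "y = a1 \<or> y = a2"
    and u: "u = a1 \<or> u = a2" and d: "d = a4 \<or> d = inv a4" "inv u \<otimes> y \<otimes> u = y \<otimes> d"
  obtains \<chi>' where "linear_char G (pow_ext y C3) \<chi>'" "\<And>x. \<chi>' x \<in> K" "card (pow_ext y C3) = p ^ 3"
    "\<And>f. char_null G \<chi>' (\<lambda>x. of_rat (f x)) \<Longrightarrow> right_invariant f Z"
proof -
  interpret cyclic_ext G C3 y p by (rule ext)
  have st: "stable y C3 \<chi>" using gy(2) carr by (intro stable_commute[OF C3(4) _ commute_C3]) auto
  have "1 \<in> K" using K of_rat_1 unfolding complex_subfield_def by metis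
  moreover have pw: "1 ^ p = \<chi> (y [^] p)" using gy(1) by simp
  ultimately obtain \<chi>' where \<chi>': "linear_char G (pow_ext y C3) \<chi>'" "\<And>c. c \<in> C3 \<Longrightarrow> \<chi>' c = \<chi> c" "\<And>x. \<chi>' x \<in> K"
    using char_extend[OF \<chi>(1) st pw K \<chi>(2)] by metis
  have a4C3: "a4 \<in> C3" using a4(1) C3(2) by blast
  have BC3: "C3 \<subseteq> pow_ext y C3" using pow_ext_base[OF C3(1)] by blast
  have dZ: "d \<in> Z" using d(1) a4(1) inv_a4 by auto
  have dp: "d [^] p = \<one>" using d(1) a4_carrier a4(3) by (auto simp: nat_pow_inv)
  have "\<chi>' a4 \<noteq> 1" using \<chi>(3) \<chi>'(2)[OF a4C3] by simp
  moreover have "\<chi>' (inv a4) = inverse (\<chi>' a4)" using \<chi>'(1) a4C3 BC3 by (intro char_inv_a4[of "pow_ext y C3"]) auto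
  \<comment> \<open>\<open>d\<close> is \<open>a4\<close> or its inverse, depending on which of
    \<open>a1\<close> and \<open>a2\<close> plays \<open>y\<close>.\<close>
  ultimately have d1: "\<chi>' d \<noteq> 1" using d(1) by (metis inverse_1 inverse_inverse_eq)
  \<comment> \<open>Inside \<open>C3\<close> conjugation by \<open>a\<close> does the moving,
    outside it conjugation by \<open>u\<close>.\<close>
  have move: "\<exists>u\<in>carrier G. \<exists>c\<in>Z. inv u \<otimes> x \<otimes> u = x \<otimes> c \<and> \<chi>' c \<noteq> 1" if x: "x \<in> pow_ext y C3 - Z" for x
  proof (cases "x \<in> C3")
    case True
    then obtain u c where "u \<in> carrier G" "c \<in> Z" "inv u \<otimes> x \<otimes> u = x \<otimes> c" "\<chi> c \<noteq> 1"
      using moves_C3[OF \<chi>(1,3)] x by blast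
    moreover have "\<chi>' c = \<chi> c" using \<open>c \<in> Z\<close> C3(2) by (intro \<chi>'(2)) auto
    ultimately show ?thesis by metis
  next
    case False
    then show ?thesis using x by (intro moves_over_C3[OF ext \<chi>'(1) d1 u dZ d(2) dp]) auto
  qed
  show thesis
  proof (rule that[OF \<chi>'(1,3)])
    show "card (pow_ext y C3) = p ^ 3" using card_ext cards(2) by (simp add: eval_nat_numeral)
    show "right_invariant f Z" if "char_null G \<chi>' (\<lambda>x. of_rat (f x))" for f
      using BC3 C3(2) by (intro right_invariant_Z[OF \<chi>'(1) _ \<open>\<chi>' a4 \<noteq> 1\<close> move that]) auto
  qed
qed

text \<open>\<open>E\<close> is the derived subgroup, so the coset sum of an invariant function is
  the size of the coset times the common value.\<close>

lemma invariant_coset_sums_zero: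
  assumes inv: "right_invariant f E"
    and sum0: "\<And>x. x \<in> carrier G \<Longrightarrow>
      (\<Sum>y | y \<in> carrier G \<and> commutator_subgroup G #> y = commutator_subgroup G #> x. f y) = 0"
    and x: "x \<in> carrier G"
  shows "f x = 0"
proof -
  let ?F = "{y \<in> carrier G. E #> y = E #> x}"
  have "f y = f x" if y: "y \<in> ?F" for y
  proof -
    have yG: "y \<in> carrier G" using y by simp
    have "y \<in> E #> x" using y rcos_self[OF yG E(1)] by simp
    then obtain e where e: "e \<in> E" "y = e \<otimes> x" by (auto simp: r_coset_def)
    have eG: "e \<in> carrier G" using e(1) E(4) by blast
    have "y = x \<otimes> (inv x \<otimes> e \<otimes> x)" using e(2) eG x by (simp add: m_assoc inv_cancel)
    then show ?thesis using inv E_normal[OF x e(1)] x by (simp add: right_invariant_def)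
  qed
  then have "(\<Sum>y\<in>?F. f y) = of_nat (card ?F) * f x" by simp
  moreover have "(\<Sum>y\<in>?F. f y) = 0" using sum0[OF x] by (simp add: derived_eq)
  moreover have "card ?F > 0" using fin x by (auto simp: card_gt_0_iff)
  ultimately show ?thesis by simp
qed

end

section \<open>The homomorphisms to the simple components and the two decompositions\<close>

lemma cis_power_self: "n > 0 \<Longrightarrow> cis (2 * pi / real n) ^ n = 1"
  by (simp add: DeMoivre)

text \<open>The second conclusion concerns the difference of two elements with equal image, the form
  in which injectivity is checked.\<close>

lemma (in group) monomial_hom:
  assumes fin: "finite (carrier G)" and \<chi>: "linear_char G B \<chi>" and m: "card B * m = card (carrier G)"
    and K: "complex_subfield K" "\<And>x. \<chi> x \<in> K"
  obtains h where "h \<in> rat_algebra_hom (rat_group_algebra G) (matrix_algebra m K)"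
    "\<And>f g. h f = h g \<Longrightarrow> char_null G \<chi> (\<lambda>x. of_rat (f x - g x))"
proof -
  obtain \<rho> where \<rho>: "matrix_rep G m K \<rho>"
    "\<And>F. (\<And>r c. r < m \<Longrightarrow> c < m \<Longrightarrow> (\<Sum>x\<in>carrier G. F x * \<rho> x r c) = 0) \<Longrightarrow> char_null G \<chi> F"
    using monomial_rep[OF fin \<chi> m K(2)] by metis
  show thesis
  proof (rule that[of "rep_map G m \<rho>"])
    show "rep_map G m \<rho> \<in> rat_algebra_hom (rat_group_algebra G) (matrix_algebra m K)"
      by (rule rep_map_hom[OF group_axioms fin K(1) \<rho>(1)])
    fix f g assume eq: "rep_map G m \<rho> f = rep_map G m \<rho> g"
    show "char_null G \<chi> (\<lambda>x. of_rat (f x - g x))"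
    proof (rule \<rho>(2))
      fix r c assume rc: "r < m" "c < m"
      have "rep_map G m \<rho> f $$ (r, c) = rep_map G m \<rho> g $$ (r, c)" by (simp add: eq)
      then show "(\<Sum>x\<in>carrier G. of_rat (f x - g x) * \<rho> x r c) = 0"
        using rc by (simp add: rep_map_def of_rat_diff left_diff_distrib sum_subtractf)
    qed
  qed
qed

text \<open>Representations are induced from the extensions of a character, while the peeling
  argument needs the character itself. The bridge is that suitable extensions add up to a multiple
  of it, extended by zero.\<close>

lemma char_null_sum:
  assumes "\<And>u. u \<in> U \<Longrightarrow> char_null G (\<chi> u) F" and eq: "\<And>x. x \<in> carrier G \<Longrightarrow> (\<Sum>u\<in>U. \<chi> u x) = a * \<mu> x"
    and a: "a \<noteq> 0"
  shows "char_null G \<mu> F"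
  unfolding char_null_def
proof (intro ballI)
  fix g h assume gh: "g \<in> carrier G" "h \<in> carrier G"
  have "a * (\<Sum>x\<in>carrier G. F (g \<otimes>\<^bsub>G\<^esub> x \<otimes>\<^bsub>G\<^esub> h) * \<mu> x) = (\<Sum>x\<in>carrier G. \<Sum>u\<in>U. F (g \<otimes>\<^bsub>G\<^esub> x \<otimes>\<^bsub>G\<^esub> h) * \<chi> u x)"
    unfolding sum_distrib_left by (intro sum.cong HOL.refl) (simp add: sum_distrib_left[symmetric] eq mult.left_commute)
  also have "\<dots> = 0"
    using assms(1) gh by (subst sum.swap) (simp add: char_null_def)
  finally show "(\<Sum>x\<in>carrier G. F (g \<otimes>\<^bsub>G\<^esub> x \<otimes>\<^bsub>G\<^esub> h) * \<mu> x) = 0" using a by simp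
qed

lemma rat_group_algebra_eqI:
  assumes "f \<in> carrier (rat_group_algebra G)" "g \<in> carrier (rat_group_algebra G)"
    "\<And>x. x \<in> carrier G \<Longrightarrow> f x = g x"
  shows "f = g"
proof
  fix x
  show "f x = g x"
  proof (cases "x \<in> carrier G")
    case False
    then have "f x = 0" "g x = 0" using assms(1,2) by (auto simp: rat_group_algebra_def)
    then show ?thesis by simp
  qed (rule assms(3))
qed

context phi10_relations
begin

lemma p_gt_1: "p > 1" using prime prime_gt_1_nat by blast

lemma derived_normal: "commutator_subgroup G \<lhd> G"
  unfolding derived_eq normal_inv_iff
proof (intro conjI ballI E(1))
  fix x h assume "x \<in> carrier G" "h \<in> E"
  then show "x \<otimes> h \<otimes> inv x \<in> E" using E_normal[of "inv x" h] by simp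
qed

lemma quotient_card: "card (carrier (G Mod commutator_subgroup G)) = p ^ 2" "finite (carrier (G Mod commutator_subgroup G))"
proof -
  have "card (rcosets E) * p ^ 3 = p ^ 2 * p ^ 3"
    using lagrange[OF E(1), unfolded Coset.order_def] cards(3) card_G by (simp add: power_add[symmetric])
  then have "card (rcosets E) = p ^ 2" using p_gt_1 by (subst (asm) mult_cancel2) auto
  then show "card (carrier (G Mod commutator_subgroup G)) = p ^ 2"
    by (simp add: FactGroup_def derived_eq)
  show "finite (carrier (G Mod commutator_subgroup G))"
    using fin by (simp add: FactGroup_def RCOSETS_def)
qed

text \<open>The last peeling step: two elements with equal projection and \<open>E\<close>-invariant
  difference coincide on the group.\<close>

lemma quotient_hom:
  "\<exists>h\<in>rat_algebra_hom (rat_group_algebra G) (rat_group_algebra (G Mod commutator_subgroup G)).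
    \<forall>f g. h f = h g \<longrightarrow> right_invariant (\<lambda>x. f x - g x) E \<longrightarrow> (\<forall>x\<in>carrier G. f x = g x)"
proof -
  let ?D = "commutator_subgroup G" and ?h = "rat_group_algebra_map G (G Mod commutator_subgroup G) (\<lambda>x. commutator_subgroup G #> x)"
  interpret D: normal ?D G by (rule derived_normal)
  show ?thesis
  proof (intro bexI[of _ ?h] allI impI ballI)
    show "?h \<in> rat_algebra_hom (rat_group_algebra G) (rat_group_algebra (G Mod ?D))"
      by (rule rat_group_algebra_map_hom[OF group_axioms fin D.factorgroup_is_group quotient_card(2) D.r_coset_hom_Mod])
    fix f g x assume eq: "?h f = ?h g" and inv: "right_invariant (\<lambda>x. f x - g x) E" and x: "x \<in> carrier G"
    have "(\<Sum>y | y \<in> carrier G \<and> ?D #> y = ?D #> z. f y - g y) = 0" for z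
      using fun_cong[OF eq, of "?D #> z"] by (simp add: rat_group_algebra_map_def sum_subtractf)
    then have "f x - g x = 0" by (intro invariant_coset_sums_zero[OF inv _ x])
    then show "f x = g x" by simp
  qed
qed

text \<open>The restriction to \<open>E\<close> of characters of the abelian group N/Z. The value 1
  at \<open>a2\<close> is no restriction up to conjugacy, as conjugation by \<open>a\<close>
  multiplies it by \<open>w\<close>.\<close>

lemma abelian_type_char:
  assumes K: "complex_subfield K" and w: "w ^ p = 1" "w \<noteq> 1" "w \<in> K"
  obtains \<mu> where "linear_char G E \<mu>" "\<And>x. \<mu> x \<in> K" "\<And>z. z \<in> Z \<Longrightarrow> \<mu> z = 1" "\<mu> a3 = w" "\<mu> a2 = 1"
proof -
  let ?i = "\<lambda>x. if x \<in> Z then 1 else 0 :: complex"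
  have 01: "0 \<in> K" "1 \<in> K" using K of_rat_0 of_rat_1 unfolding complex_subfield_def by metis+
  then have i: "?i x \<in> K" for x by simp
  obtain \<mu>1 where \<mu>1: "linear_char G C3 \<mu>1" "\<And>c. c \<in> Z \<Longrightarrow> \<mu>1 c = ?i c" "\<mu>1 a3 = w" "\<And>x. \<mu>1 x \<in> K"
    using extend_char_C3[OF linear_char_indicator[OF center_subgroup] K i w(1,3)] by metis
  have pw: "1 ^ p = \<mu>1 (a2 [^] p)" using \<mu>1(2)[OF pow_a2] pow_a2 by simp
  obtain \<mu> where \<mu>: "linear_char G E \<mu>" "\<And>c. c \<in> C3 \<Longrightarrow> \<mu> c = \<mu>1 c" "\<mu> a2 = 1" "\<And>x. \<mu> x \<in> K"
    using extend_char_E[OF \<mu>1(1) K \<mu>1(4) pw 01(2)] by metis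
  show thesis
  proof (rule that[OF \<mu>(1,4)])
    show "\<mu> z = 1" if "z \<in> Z" for z using \<mu>(2)[of z] \<mu>1(2)[OF that] that C3(2) by auto
    show "\<mu> a3 = w" using \<mu>(2)[OF C3(3)] \<mu>1(3) by simp
  qed (rule \<mu>(3))
qed

text \<open>Being trivial on \<open>C3\<close>, this character belongs to the nonabelian quotient
  G/C_3 of order p^3, whose centre is generated by the image of \<open>a2\<close>.\<close>

lemma heisenberg_type_char:
  assumes K: "complex_subfield K" and w: "w ^ p = 1" "w \<noteq> 1" "w \<in> K"
  obtains \<nu> where "linear_char G N \<nu>" "\<And>x. \<nu> x \<in> K" "\<And>c. c \<in> C3 \<Longrightarrow> \<nu> c = 1" "\<nu> a2 \<noteq> 1"
proof -
  let ?i = "\<lambda>x. if x \<in> C3 then 1 else 0 :: complex"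
  have 01: "0 \<in> K" "1 \<in> K" using K of_rat_0 of_rat_1 unfolding complex_subfield_def by metis+
  then have i: "?i x \<in> K" for x by simp
  have "a2 [^] p \<in> C3" using pow_a2 C3(2) by blast
  then have pw: "w ^ p = ?i (a2 [^] p)" using w by simp
  obtain \<nu>1 where \<nu>1: "linear_char G E \<nu>1" "\<And>c. c \<in> C3 \<Longrightarrow> \<nu>1 c = ?i c" "\<nu>1 a2 = w" "\<And>x. \<nu>1 x \<in> K"
    using extend_char_E[OF linear_char_indicator[OF C3(1)] K i pw w(3)] by metis
  have i4: "inv a4 \<in> C3" and p1: "a1 [^] p \<in> C3" using inv_a4 C3(2) pow_a1 by (auto simp: C3_def)
  have one: "\<nu>1 (inv a4) = 1" and pw2: "1 ^ p = \<nu>1 (a1 [^] p)" using \<nu>1(2)[OF i4] \<nu>1(2)[OF p1] i4 p1 by auto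
  obtain \<nu> where \<nu>: "linear_char G N \<nu>" "\<And>c. c \<in> E \<Longrightarrow> \<nu> c = \<nu>1 c" "\<nu> a1 = 1" "\<And>x. \<nu> x \<in> K"
    using extend_char_N[OF \<nu>1(1) one K \<nu>1(4) pw2 01(2)] by metis
  show thesis
  proof (rule that[OF \<nu>(1,4)])
    show "\<nu> c = 1" if "c \<in> C3" for c using \<nu>(2)[of c] \<nu>1(2)[OF that] that E(2) by auto
    show "\<nu> a2 \<noteq> 1" using \<nu>(2)[OF E(3)] \<nu>1(3) w(2) by simp
  qed
qed

lemma mem_N_cases:
  assumes "x \<in> N"
  obtains i e where "x = a1 [^] (i::nat) \<otimes> e" "e \<in> E" "p dvd i \<longleftrightarrow> x \<in> E"
proof -
  interpret cyclic_ext G E a1 p by (rule ext_N)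
  obtain i e where ie: "x = a1 [^] (i::nat) \<otimes> e" "e \<in> E" using assms unfolding N_def pow_ext_def by blast
  have G: "e \<in> carrier G" using ie E(4) by blast
  have "a1 [^] i \<in> E \<longleftrightarrow> x \<in> E"
  proof
    assume "x \<in> E"
    then have "x \<otimes> inv e \<in> E" using ie(2) E(1) by (simp add: subgroup.m_closed subgroup.m_inv_closed)
    then show "a1 [^] i \<in> E" using ie carr G by (simp add: m_assoc)
  qed (use ie E(1) in \<open>simp add: subgroup.m_closed\<close>)
  then show thesis using that ie pow_mem_iff by blast
qed

lemma decomposition_exponent_p:
  assumes pa1: "a1 [^] p \<in> Z" and pa2: "a2 [^] p = \<one>"
  shows "rat_group_algebra G \<cong>\<^sub>\<rat>
    rat_group_algebra (G Mod commutator_subgroup G)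
    \<oplus>\<^sub>\<rat> algebra_copies (p + 1) (matrix_algebra p (cyclotomic_field p))
    \<oplus>\<^sub>\<rat> matrix_algebra (p ^ 2) (cyclotomic_field p)"
proof -
  let ?K = "cyclotomic_field p" and ?z = "cis (2 * pi / real p)" and ?QG = "rat_group_algebra G"
  note K = complex_subfield_cyclotomic[of p]
  have z: "?z ^ p = 1" "?z \<noteq> 1" "?z \<in> ?K"
    using p_gt_1 cis_power_self[of p] cis_primitive[of p] cyclotomic_closed(2) by auto
  have oneK: "1 \<in> ?K" by (rule cyclotomic_closed(1))

  obtain \<theta>0 where \<theta>0: "linear_char G Z \<theta>0" "\<And>x. \<theta>0 x \<in> ?K" "\<theta>0 a4 = ?z"
    using central_char[OF K z(1,3)] by metis
  obtain \<theta>1 where \<theta>1: "linear_char G C3 \<theta>1" "\<And>c. c \<in> Z \<Longrightarrow> \<theta>1 c = \<theta>0 c" "\<And>x. \<theta>1 x \<in> ?K"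
    using extend_char_C3[OF \<theta>0(1) K \<theta>0(2) power_one oneK] by metis
  have l4: "\<theta>1 a4 \<noteq> 1" using \<theta>1(2)[OF a4(1)] \<theta>0(3) z by simp
  \<comment> \<open>Here a_2^p = 1 enters: \<open>a2\<close> may be sent to 1 without leaving the
    field.\<close>
  have l2: "\<theta>1 (a2 [^] p) = 1" using pa2 linear_char_one[OF \<theta>1(1)] by simp
  obtain \<theta> where \<theta>: "linear_char G (pow_ext a2 C3) \<theta>" "\<And>x. \<theta> x \<in> ?K" "card (pow_ext a2 C3) = p ^ 3"
    "\<And>f. char_null G \<theta> (\<lambda>x. of_rat (f x)) \<Longrightarrow> right_invariant f Z"
    using faithful_char_extension[OF ext_E K \<theta>1(1,3) l4 l2 disjI2[OF HOL.refl] disjI1[OF HOL.refl] disjI2[OF HOL.refl] conj_rels(4)] by metis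
  have "card (pow_ext a2 C3) * p ^ 2 = card (carrier G)" using \<theta>(3) card_G by (simp add: power_add[symmetric])
  then obtain hl where hl: "hl \<in> rat_algebra_hom ?QG (matrix_algebra (p ^ 2) ?K)"
    "\<And>f g. hl f = hl g \<Longrightarrow> char_null G \<theta> (\<lambda>x. of_rat (f x - g x))"
    using monomial_hom[OF fin \<theta>(1) _ K \<theta>(2)] by metis

  obtain \<mu> where \<mu>: "linear_char G E \<mu>" "\<And>x. \<mu> x \<in> ?K" "\<And>z. z \<in> Z \<Longrightarrow> \<mu> z = 1" "\<mu> a3 = ?z" "\<mu> a2 = 1"
    using abelian_type_char[OF K z] by metis
  \<comment> \<open>Since a_1^p is central, \<open>\<mu>\<close> is trivial on it and every
    \<open>p\<close>-th root of unity is admissible at \<open>a1\<close>. This gives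
    \<open>p\<close> of the \<open>p + 1\<close> copies.\<close>
  have "\<exists>\<chi>. linear_char G N \<chi> \<and> (\<forall>c\<in>E. \<chi> c = \<mu> c) \<and> \<chi> a1 = ?z ^ u \<and> (\<forall>x. \<chi> x \<in> ?K)" for u :: nat
  proof -
    have pw: "(?z ^ u) ^ p = \<mu> (a1 [^] p)" using z \<mu>(3)[OF pa1] by (simp add: power_commutes power_mult[symmetric] mult.commute) (simp add: power_mult z)
    have "?z ^ u \<in> ?K" by (induction u) (simp_all add: cyclotomic_closed)
    then show ?thesis
      using extend_char_N[OF \<mu>(1) \<mu>(3)[OF inv_a4] K \<mu>(2) pw] by metis
  qed
  then obtain \<chi> where \<chi>: "\<And>u. linear_char G N (\<chi> u)" "\<And>u c. c \<in> E \<Longrightarrow> \<chi> u c = \<mu> c"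
      "\<And>u. \<chi> u a1 = ?z ^ u" "\<And>u x. \<chi> u x \<in> ?K" by metis
  have cN: "card N * p = card (carrier G)" using cards(4) card_G by (simp add: eval_nat_numeral)
  have "\<exists>h. h \<in> rat_algebra_hom ?QG (matrix_algebra p ?K) \<and>
    (\<forall>f g. h f = h g \<longrightarrow> char_null G (\<chi> u) (\<lambda>x. of_rat (f x - g x)))" for u
    using monomial_hom[OF fin \<chi>(1) cN K \<chi>(4)] by metis
  then obtain hc where hc: "\<And>u. hc u \<in> rat_algebra_hom ?QG (matrix_algebra p ?K)"
    "\<And>u f g. hc u f = hc u g \<Longrightarrow> char_null G (\<chi> u) (\<lambda>x. of_rat (f x - g x))" by metis
  obtain \<nu> where \<nu>: "linear_char G N \<nu>" "\<And>x. \<nu> x \<in> ?K" "\<And>c. c \<in> C3 \<Longrightarrow> \<nu> c = 1" "\<nu> a2 \<noteq> 1"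
    using heisenberg_type_char[OF K z] by metis
  obtain hv where hv: "hv \<in> rat_algebra_hom ?QG (matrix_algebra p ?K)"
    "\<And>f g. hv f = hv g \<Longrightarrow> char_null G \<nu> (\<lambda>x. of_rat (f x - g x))"
    using monomial_hom[OF fin \<nu>(1) cN K \<nu>(2)] by metis
  obtain h0 where h0: "h0 \<in> rat_algebra_hom ?QG (rat_group_algebra (G Mod commutator_subgroup G))"
    "\<forall>f g. h0 f = h0 g \<longrightarrow> right_invariant (\<lambda>x. f x - g x) E \<longrightarrow> (\<forall>x\<in>carrier G. f x = g x)"
    using quotient_hom by (elim bexE)

  \<comment> \<open>On \<open>E\<close> the extensions agree; on the rest of \<open>N\<close> their
    values form a full geometric sum of roots of unity and cancel.\<close>
  have sum_\<chi>: "(\<Sum>u\<in>{..<p}. \<chi> u x) = of_nat p * \<mu> x" for x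
  proof (cases "x \<in> N")
    case True
    then obtain i e where ie: "x = a1 [^] (i::nat) \<otimes> e" "e \<in> E" "p dvd i \<longleftrightarrow> x \<in> E" by (rule mem_N_cases)
    show ?thesis
    proof (cases "x \<in> E")
      case False
      have eG: "e \<in> carrier G" using ie E(4) by blast
      have "\<chi> u x = (?z ^ i) ^ u * \<mu> e" for u
      proof -
        have "\<chi> u x = \<chi> u (a1 [^] i) * \<chi> u e"
          unfolding ie(1) using subgroup_pow_closed[OF N(1,3)] eG by (rule linear_char_mult_left[OF \<chi>(1)])
        then show ?thesis
          using linear_char_pow[OF \<chi>(1) N(3), of u i] \<chi>(2)[OF ie(2)] \<chi>(3)
          by (simp add: power_mult[symmetric] mult.commute)
      qed
      then have "(\<Sum>u\<in>{..<p}. \<chi> u x) = (\<Sum>u<p. (?z ^ i) ^ u) * \<mu> e" by (simp add: sum_distrib_right)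
      moreover have "?z ^ i \<noteq> 1" using prime_root_power_ne_1[OF prime z(1,2)] ie(3) False by blast
      moreover have "(?z ^ i) ^ p = 1" using z(1) by (metis mult.commute power_mult power_one)
      ultimately have "(\<Sum>u\<in>{..<p}. \<chi> u x) = 0" by (simp add: sum_gp_strict)
      then show ?thesis using linear_char_outside[OF \<mu>(1) False] by simp
    qed (simp add: \<chi>(2))
  next
    case False
    then have "x \<notin> E" using N(2) by blast
    then show ?thesis using False linear_char_outside[OF \<chi>(1)] linear_char_outside[OF \<mu>(1)] by simp
  qed

  \<comment> \<open>The copy with index \<open>p\<close> is the one coming from
    \<open>\<nu>\<close>.\<close>
  let ?hs = "\<lambda>u. if u < p then hc u else hv"
  let ?h = "\<lambda>f. (h0 f, (\<lambda>i\<in>{..<p + 1}. ?hs i f), hl f)"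
  have hom: "?h \<in> rat_algebra_hom ?QG (rat_group_algebra (G Mod commutator_subgroup G)
    \<oplus>\<^sub>\<rat> algebra_copies (p + 1) (matrix_algebra p ?K) \<oplus>\<^sub>\<rat> matrix_algebra (p ^ 2) ?K)"
    using hc(1) hv(1) by (intro rat_algebra_hom_sum rat_algebra_hom_copies h0(1) hl(1)) simp
  have inj: "inj_on ?h (carrier ?QG)"
  proof (rule inj_onI)
    fix f g assume fg: "f \<in> carrier ?QG" "g \<in> carrier ?QG" and eq: "?h f = ?h g"
    have e0: "h0 f = h0 g" and el: "hl f = hl g" using eq by auto
    have "(\<lambda>i\<in>{..<p + 1}. ?hs i f) = (\<lambda>i\<in>{..<p + 1}. ?hs i g)" using eq by auto
    then have es: "?hs i f = ?hs i g" if "i < p + 1" for i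
      using that by (metis (no_types, lifting) lessThan_iff restrict_apply')
    let ?d = "\<lambda>x. f x - g x"
    have "right_invariant ?d Z" by (rule \<theta>(4)[OF hl(2)[OF el]])
    moreover have "char_null G \<mu> (\<lambda>x. of_rat (?d x))"
    proof (rule char_null_sum[where U = "{..<p}" and \<chi> = \<chi>])
      show "char_null G (\<chi> u) (\<lambda>x. of_rat (?d x))" if "u \<in> {..<p}" for u
        using es[of u] that by (intro hc(2)) simp
    qed (use sum_\<chi> p_gt_1 in auto)
    ultimately have "right_invariant ?d C3"
      using \<mu>(3,4) z(2) by (intro right_invariant_C3[OF \<mu>(1)]) auto
    moreover have "char_null G \<nu> (\<lambda>x. of_rat (?d x))" using es[of p] by (intro hv(2)) simp
    ultimately have "right_invariant ?d E" by (intro right_invariant_E[OF \<nu>(1,3,4)])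
    then show "f = g" using fg h0(2) e0 by (intro rat_group_algebra_eqI) auto
  qed
  note spans = rat_spans_sum[OF rat_spans_group_algebra rat_spans_sum[OF
      rat_spans_copies[OF rat_spans_matrix[OF cyclotomic_field_prime_span[OF prime]]]
      rat_spans_matrix[OF cyclotomic_field_prime_span[OF prime]]]]
  show ?thesis
  proof (rule rat_group_algebra_isoI[OF group_axioms fin _ _ inj spans])
    obtain n where n: "p = Suc n" using p_gt_1 by (cases p) auto
    \<comment> \<open>The three blocks contribute p^2, p^4 - p^2 and p^5 - p^4.\<close>
    show "card (carrier (G Mod commutator_subgroup G) <+> ({..<p + 1} \<times> ({..<p} \<times> {..<p}) \<times> {..<p - 1}) <+>
        ({..<p ^ 2} \<times> {..<p ^ 2}) \<times> {..<p - 1}) \<le> card (carrier G)"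
      using quotient_card
      by (simp add: card_Plus card_cartesian_product card_G) (simp add: n algebra_simps eval_nat_numeral)
  qed (use hom quotient_card(2) in \<open>auto simp: rat_algebra_hom_def\<close>)
qed

text \<open>A branch off the chain for the faithful character when \<open>p = 3\<close>, with
  \<open>a1\<close> in place of \<open>a2\<close>.\<close>

lemma ext_C3_a1: "cyclic_ext G C3 a1 p"
proof (intro cyclic_ext.intro cyclic_ext_axioms.intro group_axioms)
  show "a1 \<notin> C3" using commute_C3[of a2 a1] a4_contra by metis
  show "inv a1 \<otimes> c \<otimes> a1 \<in> C3" if "c \<in> C3" for c
    using that commute_C3[of a1 c] C3(4) carr by (simp add: conj_trivial subset_iff)
qed (use fin carr prime C3 pow_a1 in \<open>auto simp: C3_def\<close>)

lemma Z_pow: "t \<in> Z \<Longrightarrow> t [^] p = \<one>"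
proof -
  assume "t \<in> Z"
  then obtain i where "t = a4 [^] (i::nat)"
    unfolding Z_eq(2) pow_ext_def using a4_carrier by auto
  then have "t [^] p = (a4 [^] p) [^] i" using a4_carrier by (simp add: nat_pow_pow mult.commute)
  then show ?thesis using a4(3) by simp
qed

text \<open>One character with values in the ninth roots of unity replaces the \<open>p\<close>
  extensions: a rational relation among these roots splits by exponents modulo 3, and the exponents
  divisible by 3 are exactly those on \<open>E\<close>.\<close>

lemma char_null_ninth_root:
  fixes y :: complex
  assumes p3: "p = 3" and y: "y ^ 6 + y ^ 3 + 1 = 0" "y ^ 9 = 1"
    and \<chi>: "linear_char G N \<chi>" "\<And>c. c \<in> E \<Longrightarrow> \<chi> c = \<mu> c" "\<chi> a1 = y"
    and \<mu>: "linear_char G E \<mu>" "\<And>c. c \<in> E \<Longrightarrow> \<exists>j::nat. \<mu> c = y ^ (3 * j)"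
    and f: "char_null G \<chi> (\<lambda>x. of_rat (f x))"
  shows "char_null G \<mu> (\<lambda>x. of_rat (f x))"
  unfolding char_null_def
proof (intro ballI)
  fix g h assume gh: "g \<in> carrier G" "h \<in> carrier G"
  have "\<exists>k<9. \<chi> x = y ^ k \<and> (x \<in> E \<longleftrightarrow> 3 dvd k)" if x: "x \<in> N" for x
  proof -
    obtain i e where ie: "x = a1 [^] (i::nat) \<otimes> e" "e \<in> E" "p dvd i \<longleftrightarrow> x \<in> E" by (rule mem_N_cases[OF x])
    obtain j where j: "\<mu> e = y ^ (3 * j)" using \<mu>(2)[OF ie(2)] by blast
    have eG: "e \<in> carrier G" using ie E(4) by blast
    have "\<chi> x = \<chi> (a1 [^] i) * \<chi> e"
      unfolding ie(1) using subgroup_pow_closed[OF N(1,3)] eG by (rule linear_char_mult_left[OF \<chi>(1)])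
    then have "\<chi> x = y ^ (i + 3 * j)"
      using linear_char_pow[OF \<chi>(1) N(3), of i] \<chi>(2)[OF ie(2)] \<chi>(3) j by (simp add: power_add)
    also have "i + 3 * j = (i + 3 * j) mod 9 + 9 * ((i + 3 * j) div 9)" by simp
    also have "y ^ \<dots> = y ^ ((i + 3 * j) mod 9)" by (simp only: power_add power_mult y) simp
    finally have "\<chi> x = y ^ ((i + 3 * j) mod 9)" .
    moreover have "3 dvd (i + 3 * j) mod 9 \<longleftrightarrow> 3 dvd i" by presburger
    ultimately show ?thesis using ie(3) p3 by (intro exI[of _ "(i + 3 * j) mod 9"]) simp
  qed
  then obtain \<kappa> where \<kappa>: "\<And>x. x \<in> N \<Longrightarrow> \<kappa> x < 9 \<and> \<chi> x = y ^ \<kappa> x \<and> (x \<in> E \<longleftrightarrow> 3 dvd \<kappa> x)" by metis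
  \<comment> \<open>The coefficients of a relation in powers of \<open>y\<close>, collected by
    exponent; they are rational because \<open>f\<close> is.\<close>
  define q where "q k = (\<Sum>x | x \<in> N \<and> \<kappa> x = k. f (g \<otimes> x \<otimes> h))" for k
  have finN: "finite N" using N(4) fin by (rule finite_subset)
  have img: "\<kappa> ` N \<subseteq> {..<9}" using \<kappa> by auto
  have collect: "(\<Sum>x\<in>N. of_rat (f (g \<otimes> x \<otimes> h)) * c (\<kappa> x)) = (\<Sum>k<9. of_rat (q k) * c k)" for c :: "nat \<Rightarrow> complex"
  proof -
    have "(\<Sum>x\<in>N. of_rat (f (g \<otimes> x \<otimes> h)) * c (\<kappa> x))
      = (\<Sum>k<9. \<Sum>x | x \<in> N \<and> \<kappa> x = k. of_rat (f (g \<otimes> x \<otimes> h)) * c (\<kappa> x))"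
      by (rule sum.group[OF finN _ img, symmetric]) simp
    also have "\<dots> = (\<Sum>k<9. of_rat (q k) * c k)"
      by (intro sum.cong HOL.refl) (simp add: q_def of_rat_sum sum_distrib_right)
    finally show ?thesis .
  qed
  have restrict: "(\<Sum>x\<in>carrier G. of_rat (f (g \<otimes> x \<otimes> h)) * \<psi> x) = (\<Sum>x\<in>N. of_rat (f (g \<otimes> x \<otimes> h)) * \<psi> x)"
    if "\<And>x. x \<notin> N \<Longrightarrow> \<psi> x = 0" for \<psi> :: "'a \<Rightarrow> complex"
    using that N(4) fin by (intro sum.mono_neutral_right) auto
  have "(\<Sum>k<9. of_rat (q k) * y ^ k) = (\<Sum>x\<in>N. of_rat (f (g \<otimes> x \<otimes> h)) * \<chi> x)"
    unfolding collect[symmetric] using \<kappa> by (intro sum.cong HOL.refl) simp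
  also have "\<dots> = 0"
    using restrict[of \<chi>] linear_char_outside[OF \<chi>(1)] f gh by (simp add: char_null_def)
  finally have q: "q 0 = q 6" "q 3 = q 6" by (rule ninth_root_of_unity_rat_relation[OF y(1)])+
  have "(\<Sum>x\<in>carrier G. of_rat (f (g \<otimes> x \<otimes> h)) * \<mu> x) = (\<Sum>x\<in>N. of_rat (f (g \<otimes> x \<otimes> h)) * \<mu> x)"
    using linear_char_outside[OF \<mu>(1)] N(2) by (intro restrict) blast
  also have "\<dots> = (\<Sum>x\<in>N. of_rat (f (g \<otimes> x \<otimes> h)) * (if 3 dvd \<kappa> x then y ^ \<kappa> x else 0))"
    using \<kappa> \<chi>(2) linear_char_outside[OF \<mu>(1)] by (intro sum.cong HOL.refl arg_cong2[where f = "(*)"]) metis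
  also have "\<dots> = (\<Sum>k<9. of_rat (q k) * (if 3 dvd k then y ^ k else 0))" by (rule collect)
  \<comment> \<open>The three coefficients at exponents 0, 3 and 6 coincide.\<close>
  also have "\<dots> = of_rat (q 6) * (y ^ 6 + y ^ 3 + 1)"
    by (simp add: lessThan_nat_numeral lessThan_Suc q algebra_simps)
  finally show "(\<Sum>x\<in>carrier G. of_rat (f (g \<otimes> x \<otimes> h)) * \<mu> x) = 0" using y(1) by simp
qed

lemma decomposition_three:
  assumes p3: "p = 3" and t: "a1 [^] p \<otimes> a3 \<in> Z"
  shows "rat_group_algebra G \<cong>\<^sub>\<rat>
    rat_group_algebra (G Mod commutator_subgroup G)
    \<oplus>\<^sub>\<rat> matrix_algebra 3 (cyclotomic_field 3)
    \<oplus>\<^sub>\<rat> matrix_algebra 3 (cyclotomic_field 9)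
    \<oplus>\<^sub>\<rat> matrix_algebra 9 (cyclotomic_field 3)"
proof -
  let ?K = "cyclotomic_field 3" and ?L = "cyclotomic_field 9" and ?QG = "rat_group_algebra G"
  let ?z = "cis (2 * pi / 3)" and ?y = "cis (2 * pi / 9)"
  note K = complex_subfield_cyclotomic[of 3] and L = complex_subfield_cyclotomic[of 9]
  have z: "?z ^ p = 1" "?z \<noteq> 1" "?z \<in> ?K"
    using cis_power_self[of 3] cis_primitive[of 3] cyclotomic_closed(2)[of 3] p3 by auto
  have y: "?y ^ 6 + ?y ^ 3 + 1 = 0" "?y ^ 9 = 1" "?y \<in> ?L"
    using cis_ninth cis_power_self[of 9] cyclotomic_closed(2)[of 9] by auto
  have powL: "?y ^ n \<in> ?L" for n
    by (induction n) (simp_all add: cyclotomic_closed(1,4) y(3))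
  have C3G: "a1 [^] p \<in> carrier G" using carr by simp

  obtain \<theta>0 where \<theta>0: "linear_char G Z \<theta>0" "\<And>x. \<theta>0 x \<in> ?K" "\<theta>0 a4 = ?z"
    using central_char[OF K z(1,3)] by metis
  \<comment> \<open>The value at \<open>a3\<close> will be that of the central element a_1^3 a_3, so
    that a_1^3 is sent to 1. It is an admissible cube root of unity because the centre has exponent
    3.\<close>
  have v: "\<theta>0 (a1 [^] p \<otimes> a3) ^ p = 1"
    using linear_char_pow[OF \<theta>0(1) t, of p] Z_pow[OF t] linear_char_one[OF \<theta>0(1)] by simp
  obtain \<theta>1 where \<theta>1: "linear_char G C3 \<theta>1" "\<And>c. c \<in> Z \<Longrightarrow> \<theta>1 c = \<theta>0 c"
      "\<theta>1 a3 = \<theta>0 (a1 [^] p \<otimes> a3)" "\<And>x. \<theta>1 x \<in> ?K"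
    using extend_char_C3[OF \<theta>0(1) K \<theta>0(2) v \<theta>0(2)] by metis
  have l4: "\<theta>1 a4 \<noteq> 1" using \<theta>1(2)[OF a4(1)] \<theta>0(3) z by simp
  have "\<theta>1 (a1 [^] p) * \<theta>1 a3 = \<theta>1 a3"
    using \<theta>1(2)[OF t] \<theta>1(3) linear_char_mult_right[OF \<theta>1(1) C3G C3(3)] by simp
  moreover have "\<theta>1 a3 \<noteq> 0" using linear_char_inv[OF \<theta>1(1) C3(3)] by auto
  ultimately have l1: "\<theta>1 (a1 [^] p) = 1" by simp
  obtain \<theta> where \<theta>: "linear_char G (pow_ext a1 C3) \<theta>" "\<And>x. \<theta> x \<in> ?K" "card (pow_ext a1 C3) = p ^ 3"
    "\<And>f. char_null G \<theta> (\<lambda>x. of_rat (f x)) \<Longrightarrow> right_invariant f Z"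
    using faithful_char_extension[OF ext_C3_a1 K \<theta>1(1,4) l4 l1 disjI1[OF HOL.refl] disjI2[OF HOL.refl] disjI1[OF HOL.refl] conj_rels(5)] by metis
  have "card (pow_ext a1 C3) * 9 = card (carrier G)" using \<theta>(3) card_G p3 by simp
  then obtain hl where hl: "hl \<in> rat_algebra_hom ?QG (matrix_algebra 9 ?K)"
    "\<And>f g. hl f = hl g \<Longrightarrow> char_null G \<theta> (\<lambda>x. of_rat (f x - g x))"
    using monomial_hom[OF fin \<theta>(1) _ K \<theta>(2)] by metis

  \<comment> \<open>The sixth power is dictated by \<open>\<chi> a1 = ?y\<close> below:
    \<open>\<mu>\<close> is trivial on the central a_1^3 a_3, so it must send \<open>a3\<close> to
    the inverse of y^3.\<close>
  have y6: "(?y ^ 6) ^ p = 1" using y(2) p3 power_mult[of ?y 9 2] by (simp add: power_mult[symmetric])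
  have y61: "?y ^ 6 \<noteq> 1"
  proof
    assume a: "?y ^ 6 = 1"
    have "?y ^ 9 = ?y ^ 6 * ?y ^ 3" by (simp add: power_add[symmetric])
    then have "?y ^ 3 = 1" using a y(2) by simp
    then show False using a y(1) by simp
  qed
  obtain \<mu> where \<mu>: "linear_char G E \<mu>" "\<And>x. \<mu> x \<in> ?L" "\<And>z. z \<in> Z \<Longrightarrow> \<mu> z = 1" "\<mu> a3 = ?y ^ 6" "\<mu> a2 = 1"
    using abelian_type_char[OF L y6 y61 powL] by metis
  have "\<mu> (a1 [^] p) * ?y ^ 6 = 1"
    using \<mu>(3)[OF t] \<mu>(4) C3(3) E(2) linear_char_mult_right[OF \<mu>(1) C3G, of a3] by auto
  moreover have "?y ^ 3 * ?y ^ 6 = 1" using y(2) by (simp add: power_add[symmetric])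
  ultimately have pw: "?y ^ p = \<mu> (a1 [^] p)" using y61 p3 by (metis mult_cancel_right mult_zero_right zero_neq_one)
  obtain \<chi> where \<chi>: "linear_char G N \<chi>" "\<And>c. c \<in> E \<Longrightarrow> \<chi> c = \<mu> c" "\<chi> a1 = ?y" "\<And>x. \<chi> x \<in> ?L"
    using extend_char_N[OF \<mu>(1) \<mu>(3)[OF inv_a4] L \<mu>(2) pw y(3)] by metis
  have \<mu>_val: "\<exists>j::nat. \<mu> c = ?y ^ (3 * j)" if c: "c \<in> E" for c
  proof -
    obtain k d where kd: "c = a2 [^] (k::nat) \<otimes> d" "d \<in> C3" using c unfolding E_def pow_ext_def by blast
    obtain l z where lz: "d = a3 [^] (l::nat) \<otimes> z" "z \<in> Z" using kd(2) unfolding C3_def pow_ext_def by blast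
    have inE: "a2 [^] k \<in> E" "a3 [^] l \<in> E" and G: "d \<in> carrier G" "z \<in> carrier G"
      using E C3 subgroup_pow_closed kd lz Z_carrier by blast+
    have "\<mu> c = \<mu> a2 ^ k * (\<mu> a3 ^ l * \<mu> z)"
      unfolding kd(1) linear_char_mult_left[OF \<mu>(1) inE(1) G(1)] unfolding lz(1) linear_char_mult_left[OF \<mu>(1) inE(2) G(2)]
      using linear_char_pow[OF \<mu>(1) E(3), of k] linear_char_pow[OF \<mu>(1), of a3 l] C3(3) E(2) by auto
    then have "\<mu> c = ?y ^ (3 * (2 * l))" using \<mu>(3)[OF lz(2)] \<mu>(4,5) by (simp add: power_mult[symmetric])
    then show ?thesis by blast
  qed
  have cN: "card N * 3 = card (carrier G)" using cards(4) card_G p3 by simp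
  obtain hc where hc: "hc \<in> rat_algebra_hom ?QG (matrix_algebra 3 ?L)"
    "\<And>f g. hc f = hc g \<Longrightarrow> char_null G \<chi> (\<lambda>x. of_rat (f x - g x))"
    using monomial_hom[OF fin \<chi>(1) cN L \<chi>(4)] by metis
  obtain \<nu> where \<nu>: "linear_char G N \<nu>" "\<And>x. \<nu> x \<in> ?K" "\<And>c. c \<in> C3 \<Longrightarrow> \<nu> c = 1" "\<nu> a2 \<noteq> 1"
    using heisenberg_type_char[OF K z] by metis
  obtain hv where hv: "hv \<in> rat_algebra_hom ?QG (matrix_algebra 3 ?K)"
    "\<And>f g. hv f = hv g \<Longrightarrow> char_null G \<nu> (\<lambda>x. of_rat (f x - g x))"
    using monomial_hom[OF fin \<nu>(1) cN K \<nu>(2)] by metis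
  obtain h0 where h0: "h0 \<in> rat_algebra_hom ?QG (rat_group_algebra (G Mod commutator_subgroup G))"
    "\<forall>f g. h0 f = h0 g \<longrightarrow> right_invariant (\<lambda>x. f x - g x) E \<longrightarrow> (\<forall>x\<in>carrier G. f x = g x)"
    using quotient_hom by (elim bexE)

  let ?h = "\<lambda>f. (h0 f, hv f, hc f, hl f)"
  have hom: "?h \<in> rat_algebra_hom ?QG (rat_group_algebra (G Mod commutator_subgroup G)
    \<oplus>\<^sub>\<rat> matrix_algebra 3 ?K \<oplus>\<^sub>\<rat> matrix_algebra 3 ?L \<oplus>\<^sub>\<rat> matrix_algebra 9 ?K)"
    by (intro rat_algebra_hom_sum h0(1) hv(1) hc(1) hl(1))
  have inj: "inj_on ?h (carrier ?QG)"
  proof (rule inj_onI)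
    fix f g assume fg: "f \<in> carrier ?QG" "g \<in> carrier ?QG" and eq: "?h f = ?h g"
    have eqs: "h0 f = h0 g" "hv f = hv g" "hc f = hc g" "hl f = hl g" using eq by auto
    let ?d = "\<lambda>x. f x - g x"
    have "right_invariant ?d Z" by (rule \<theta>(4)[OF hl(2)[OF eqs(4)]])
    moreover have "char_null G \<mu> (\<lambda>x. of_rat (?d x))"
      by (rule char_null_ninth_root[OF p3 y(1,2) \<chi>(1,2,3) \<mu>(1) \<mu>_val hc(2)[OF eqs(3)]])
    ultimately have "right_invariant ?d C3"
      using \<mu>(3,4) y61 by (intro right_invariant_C3[OF \<mu>(1)]) auto
    then have "right_invariant ?d E"
      using hv(2)[OF eqs(2)] by (intro right_invariant_E[OF \<nu>(1,3,4)])
    then show "f = g" using fg h0(2) eqs(1) by (intro rat_group_algebra_eqI) auto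
  qed
  have prime3: "Factorial_Ring.prime (3::nat)" using prime p3 by simp
  note K_span = cyclotomic_field_prime_span[OF prime3]
  note spans = rat_spans_sum[OF rat_spans_group_algebra rat_spans_sum[OF rat_spans_matrix[OF K_span]
      rat_spans_sum[OF rat_spans_matrix[OF cyclotomic_field_9_span] rat_spans_matrix[OF K_span]]]]
  show ?thesis
  proof (rule rat_group_algebra_isoI[OF group_axioms fin _ _ inj spans])
    show "card (carrier (G Mod commutator_subgroup G) <+> (({..<3::nat} \<times> {..<3::nat}) \<times> {..<3 - 1::nat}) <+>
        (({..<3::nat} \<times> {..<3::nat}) \<times> {..<6::nat}) <+> ({..<9::nat} \<times> {..<9::nat}) \<times> {..<3 - 1::nat}) \<le> card (carrier G)"
      using quotient_card by (simp add: card_Plus card_cartesian_product card_G p3)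
  qed (use hom quotient_card(2) in \<open>auto simp: rat_algebra_hom_def\<close>)
qed

end

subsection \<open>The presentation of \<open>\<Phi>\<^sub>1\<^sub>0(1\<^sup>5)\<close>\<close>

lemma word_pow_words: "w \<in> words_over S \<Longrightarrow> word_pow w n \<in> words_over S"
  by (auto simp: words_over_def word_pow_def in_lists_conv_set)

context group
begin

fun word_eval :: "('x \<Rightarrow> 'a) \<Rightarrow> 'x word \<Rightarrow> 'a" where
  "word_eval s [] = \<one>"
| "word_eval s ((x, b) # w) = (if b then s x else inv s x) \<otimes> word_eval s w"

context
  fixes s :: "'x \<Rightarrow> 'a" and S :: "'x set"
  assumes s: "s ` S \<subseteq> carrier G"
begin

lemma word_eval_closed: "w \<in> words_over S \<Longrightarrow> word_eval s w \<in> carrier G"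
proof (induction w)
  case (Cons a w)
  obtain x b where a: "a = (x, b)" by (cases a)
  have "s x \<in> carrier G" "w \<in> words_over S" using Cons.prems s by (auto simp: words_over_def a)
  then show ?case using Cons by (simp add: a)
qed simp

lemma word_eval_append:
  "u \<in> words_over S \<Longrightarrow> v \<in> words_over S \<Longrightarrow> word_eval s (u @ v) = word_eval s u \<otimes> word_eval s v"
proof (induction u)
  case (Cons a u)
  obtain x b where a: "a = (x, b)" by (cases a)
  have "s x \<in> carrier G" "u \<in> words_over S" using Cons.prems s by (auto simp: words_over_def a)
  then show ?case using Cons word_eval_closed by (simp add: a m_assoc)
qed (simp add: word_eval_closed)

lemma word_eval_inv: "w \<in> words_over S \<Longrightarrow> word_eval s (word_inv w) = inv word_eval s w"
proof (induction w)
  case (Cons a w)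
  obtain x b where a: "a = (x, b)" by (cases a)
  have x: "s x \<in> carrier G" "x \<in> S" "w \<in> words_over S" using Cons.prems s by (auto simp: words_over_def a)
  have "word_inv (a # w) = word_inv w @ [(x, \<not> b)]" by (simp add: word_inv_def a)
  moreover have "[(x, \<not> b)] \<in> words_over S" using x by (simp add: words_over_def)
  ultimately show ?case
    using Cons x word_inv_words[OF x(3)] word_eval_closed[OF x(3)]
    by (simp add: word_eval_append a inv_mult_group)
qed (simp add: word_inv_def)

lemma word_eval_pow: "w \<in> words_over S \<Longrightarrow> word_eval s (word_pow w n) = word_eval s w [^] n"
proof (induction n)
  case (Suc n)
  have "word_pow w (Suc n) = w @ word_pow w n" by (simp add: word_pow_def)
  moreover have "word_eval s w [^] Suc n = word_eval s w \<otimes> word_eval s w [^] n"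
    by (rule nat_pow_Suc2[OF word_eval_closed[OF Suc.prems]])
  ultimately show ?case
    using Suc word_eval_append[OF Suc.prems word_pow_words[OF Suc.prems, of n]] by simp
qed (simp add: word_pow_def)

lemma word_eval_comm:
  assumes "u \<in> words_over S" "v \<in> words_over S"
  shows "word_eval s (word_comm u v) = commutator G (word_eval s u) (word_eval s v)"
proof -
  have "u @ v \<in> words_over S" "word_inv v @ u @ v \<in> words_over S"
    using assms word_inv_words[OF assms(2)] by (auto simp: words_over_def)
  then have "word_eval s (word_comm u v) = inv word_eval s u \<otimes> (inv word_eval s v \<otimes> (word_eval s u \<otimes> word_eval s v))"
    using word_inv_words[OF assms(1)] word_inv_words[OF assms(2)] assms
    by (simp add: word_comm_def word_eval_append word_eval_inv)
  then show ?thesis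
    using word_eval_closed[OF assms(1)] word_eval_closed[OF assms(2)] by (simp add: commutator_def m_assoc)
qed

text \<open>Von Dyck's argument on words: a group in which the relators hold cannot separate words
  that are equal in the presented group.\<close>

lemma word_eq_eval:
  assumes R: "\<And>r. r \<in> R \<Longrightarrow> r \<in> words_over S \<Longrightarrow> word_eval s r = \<one>" and "word_eq S R u v"
  shows "word_eval s u = word_eval s v"
  using assms(2)
proof (induction rule: word_eq.induct)
  case (append u u' v v')
  then show ?case using word_eq_words[OF append(1)] word_eq_words[OF append(2)] by (simp add: word_eval_append)
next
  case (cancel x b)
  then have "s x \<in> carrier G" using s by auto
  then show ?case by (cases b) simp_all
qed (use R in auto)

end

end

text \<open>Lets \<open>word_eval\<close> be used inside the presented group itself, at the classes
  of its generators.\<close>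

lemma presented_group_eval:
  fixes R :: "'x word set" and S :: "'x set"
  defines "P \<equiv> presented_group S R"
  assumes w: "w \<in> words_over S"
  shows "word_rel S R `` {w} = group.word_eval P (\<lambda>x. word_rel S R `` {[(x, True)]}) w"
proof -
  interpret P: group P unfolding P_def by (rule group_presented_group)
  let ?c = "\<lambda>w. word_rel S R `` {w}"
  have mult: "?c u \<otimes>\<^bsub>P\<^esub> ?c v = ?c (u @ v)" if "u \<in> words_over S" "v \<in> words_over S" for u v
    unfolding P_def using that by (rule presented_group_mult)
  have car: "?c u \<in> carrier P" if "u \<in> words_over S" for u
    using that by (auto simp: P_def presented_group_def quotient_def)
  have one: "\<one>\<^bsub>P\<^esub> = ?c []" by (simp add: P_def presented_group_def)
  have inv: "inv\<^bsub>P\<^esub> ?c [(x, True)] = ?c [(x, False)]" if x: "x \<in> S" for x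
  proof (rule P.inv_equality)
    have l: "[(x, True)] \<in> words_over S" "[(x, False)] \<in> words_over S" using x by (auto simp: words_over_def)
    then show "?c [(x, True)] \<in> carrier P" "?c [(x, False)] \<in> carrier P" by (auto intro: car)
    have "word_eq S R [(x, False), (x, True)] []" using word_eq.cancel[OF x, of R False] by simp
    then have "?c [(x, False), (x, True)] = ?c []"
      by (intro equiv_class_eq[OF equiv_word_rel]) (simp add: word_rel_def)
    then show "?c [(x, False)] \<otimes>\<^bsub>P\<^esub> ?c [(x, True)] = \<one>\<^bsub>P\<^esub>" using mult l by (simp add: one)
  qed
  show ?thesis
    using w
  proof (induction w)
    case (Cons a w)
    obtain x b where a: "a = (x, b)" by (cases a)
    have x: "x \<in> S" "w \<in> words_over S" using Cons.prems by (auto simp: words_over_def a)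
    have "[(x, b)] \<in> words_over S" using x by (simp add: words_over_def)
    then have "?c (a # w) = ?c [(x, b)] \<otimes>\<^bsub>P\<^esub> ?c w" using mult x by (simp add: a)
    then show ?case using Cons.IH x inv by (simp add: a)
  qed (simp add: one)
qed

context group
begin

definition satisfies_phi10 :: "nat \<Rightarrow> (nat \<Rightarrow> 'a) \<Rightarrow> bool" where
  "satisfies_phi10 p s \<longleftrightarrow> s ` {0..4} \<subseteq> carrier G \<and> (\<forall>r\<in>phi10_relators p. word_eval s r = \<one>)"

text \<open>Carries the convention \<open>\<alpha>\<^sub>l = 1\<close> for l > 4 over to
  values.\<close>

definition ext_gen :: "(nat \<Rightarrow> 'a) \<Rightarrow> nat \<Rightarrow> 'a" where
  "ext_gen s l = (if l \<le> 4 then s l else \<one>)"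

lemma phi10_gen_words: "phi10_gen l \<in> words_over {0..4}"
  by (simp add: phi10_gen_def words_over_def)

lemma eval_phi10_gen: "s ` {0..4} \<subseteq> carrier G \<Longrightarrow> word_eval s (phi10_gen l) = ext_gen s l"
  by (simp add: phi10_gen_def ext_gen_def image_subset_iff)

lemma ext_gen_closed: "s ` {0..4} \<subseteq> carrier G \<Longrightarrow> ext_gen s l \<in> carrier G"
  by (auto simp: ext_gen_def)

lemma word_pow_Nil: "word_pow [] n = []"
  by (simp add: word_pow_def)

text \<open>From the fifth factor on the index exceeds 4 and the factor is empty, so at most four
  remain; for \<open>p = 3\<close> the product ends after three.\<close>

lemma eval_phi10_ppow:
  assumes s: "s ` {0..4} \<subseteq> carrier G" and j: "j \<ge> 1"
  shows "p \<ge> 5 \<Longrightarrow> word_eval s (phi10_ppow p j) = ext_gen s j [^] p \<otimes> (ext_gen s (j + 1) [^] (p choose 2) \<otimes>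
      (ext_gen s (j + 2) [^] (p choose 3) \<otimes> ext_gen s (j + 3) [^] (p choose 4)))"
    and "word_eval s (phi10_ppow 3 j) = ext_gen s j [^] (3::nat) \<otimes> (ext_gen s (j + 1) [^] (3::nat) \<otimes> ext_gen s (j + 2))"
proof -
  let ?w = "\<lambda>p k. word_pow (phi10_gen (j + k - 1)) (p choose k)"
  have w: "?w p k \<in> words_over {0..4}" for p k by (rule word_pow_words[OF phi10_gen_words])
  have app: "u @ v \<in> words_over {0..4}" if "u \<in> words_over {0..4}" "v \<in> words_over {0..4}" for u v :: "nat word"
    using that by (simp add: words_over_def)
  let ?v = "\<lambda>l n. word_pow (phi10_gen l) n"
  have v: "?v l n \<in> words_over {0..4}" for l n by (rule word_pow_words[OF phi10_gen_words])
  have ev: "word_eval s (?v l n) = ext_gen s l [^] n" for l n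
    using s by (simp add: word_eval_pow[OF s phi10_gen_words] eval_phi10_gen)
  have ev3: "word_eval s (?v l n @ ?v l' n' @ ?v k m) = ext_gen s l [^] n \<otimes> (ext_gen s l' [^] n' \<otimes> ext_gen s k [^] m)"
    for l n l' n' k m
    by (simp add: word_eval_append[OF s v app[OF v v]] word_eval_append[OF s v v] ev)
  have ev4: "word_eval s (?v l n @ ?v l' n' @ ?v k m @ ?v k' m')
    = ext_gen s l [^] n \<otimes> (ext_gen s l' [^] n' \<otimes> (ext_gen s k [^] m \<otimes> ext_gen s k' [^] m'))"
    for l n l' n' k m k' m'
    by (simp add: word_eval_append[OF s v app[OF v app[OF v v]]] ev3 ev)
  show "word_eval s (phi10_ppow p j) = ext_gen s j [^] p \<otimes> (ext_gen s (j + 1) [^] (p choose 2) \<otimes>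
      (ext_gen s (j + 2) [^] (p choose 3) \<otimes> ext_gen s (j + 3) [^] (p choose 4)))" if p: "p \<ge> 5"
  proof -
    have split: "[1..<p + 1] = [1, 2, 3, 4] @ [5..<p + 1]"
    proof -
      have "[1..<p + 1] = [1..<5] @ [5..<p + 1]" using p upt_add_eq_append[of 1 5 "p + 1 - 5"] by simp
      then show ?thesis by (simp add: upt_rec)
    qed
    have "concat (map (?w p) [5..<p + 1]) = []"
      using j by (auto simp: phi10_gen_def word_pow_Nil)
    then have "phi10_ppow p j = ?v j p @ ?v (j + 1) (p choose 2) @ ?v (j + 2) (p choose 3) @ ?v (j + 3) (p choose 4)"
      unfolding phi10_ppow_def split by (simp add: numeral_eq_Suc)
    then show ?thesis by (simp only: ev4)
  qed
  have "[1..<3 + 1] = [1, 2, 3::nat]" by (simp add: upt_rec)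
  then have "phi10_ppow 3 j = ?v j 3 @ ?v (j + 1) 3 @ ?v (j + 2) 1"
    by (simp add: phi10_ppow_def numeral_eq_Suc)
  then show "word_eval s (phi10_ppow 3 j) = ext_gen s j [^] (3::nat) \<otimes> (ext_gen s (j + 1) [^] (3::nat) \<otimes> ext_gen s (j + 2))"
    using ext_gen_closed[OF s] by (simp add: ev3)
qed

lemma satisfies_phi10_iff:
  assumes s: "s ` {0..4} \<subseteq> carrier G"
  shows "satisfies_phi10 p s \<longleftrightarrow>
    (\<forall>i\<in>{1, 2, 3}. commutator G (s i) (s 0) = s (i + 1)) \<and> commutator G (s 4) (s 0) = \<one> \<and>
    commutator G (s 1) (s 2) = s 4 \<and>
    (\<forall>i j. 1 \<le> i \<and> i < j \<and> j \<le> 4 \<and> (i, j) \<noteq> (1, 2) \<longrightarrow> commutator G (s i) (s j) = \<one>) \<and>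
    s 0 [^] p = \<one> \<and> (\<forall>j\<in>{1, 2, 3, 4}. word_eval s (phi10_ppow p j) = \<one>)"
proof -
  have comm: "word_eval s (word_comm (phi10_gen i) (phi10_gen j)) = commutator G (s i) (s j)" if "i \<le> 4" "j \<le> 4" for i j
    using that by (simp add: word_eval_comm[OF s phi10_gen_words phi10_gen_words] eval_phi10_gen[OF s] ext_gen_def)
  have cc: "commutator G (s i) (s j) \<in> carrier G" if "i \<le> 4" "j \<le> 4" for i j
    using s that by (auto simp: commutator_def image_subset_iff)
  have ww: "word_comm (phi10_gen i) (phi10_gen j) \<in> words_over {0..4}" for i j
    using phi10_gen_words[of i] phi10_gen_words[of j] word_inv_words[OF phi10_gen_words[of i]] word_inv_words[OF phi10_gen_words[of j]]
    by (simp add: word_comm_def words_over_def)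
  have rel: "word_eval s (word_comm (phi10_gen i) (phi10_gen j) @ word_inv (phi10_gen k)) = \<one> \<longleftrightarrow> commutator G (s i) (s j) = s k"
    if "i \<le> 4" "j \<le> 4" "k \<le> 4" for i j k
  proof -
    have k: "s k \<in> carrier G" using s that by auto
    have "word_eval s (word_comm (phi10_gen i) (phi10_gen j) @ word_inv (phi10_gen k)) = commutator G (s i) (s j) \<otimes> inv s k"
      using that by (simp add: word_eval_append[OF s ww word_inv_words[OF phi10_gen_words]] comm
          word_eval_inv[OF s phi10_gen_words] eval_phi10_gen[OF s] ext_gen_def)
    then show ?thesis using cc[OF that(1,2)] k by (metis inv_equality inv_inv inv_closed r_inv)
  qed
  have pow: "word_eval s (word_pow (phi10_gen 0) p) = s 0 [^] p"
    by (simp add: word_eval_pow[OF s phi10_gen_words] eval_phi10_gen[OF s] ext_gen_def)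
  have A: "(\<forall>r\<in>{word_comm (phi10_gen i) (phi10_gen 0) @ word_inv (phi10_gen (i + 1)) |i. i \<in> {1, 2, 3}}. word_eval s r = \<one>)
      \<longleftrightarrow> (\<forall>i\<in>{1, 2, 3}. commutator G (s i) (s 0) = s (i + 1))"
  proof -
    have "{word_comm (phi10_gen i) (phi10_gen 0) @ word_inv (phi10_gen (i + 1)) |i. i \<in> {1, 2, 3}}
      = (\<lambda>i. word_comm (phi10_gen i) (phi10_gen 0) @ word_inv (phi10_gen (i + 1))) ` {1, 2, 3}" by blast
    then show ?thesis using rel[of 1 0 "1 + 1"] rel[of 2 0 "2 + 1"] rel[of 3 0 "3 + 1"] by simp
  qed
  have B: "(\<forall>r\<in>{word_comm (phi10_gen i) (phi10_gen j) |i j. 1 \<le> i \<and> i < j \<and> j \<le> 4 \<and> (i, j) \<noteq> (1, 2)}. word_eval s r = \<one>)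
      \<longleftrightarrow> (\<forall>i j. 1 \<le> i \<and> i < j \<and> j \<le> 4 \<and> (i, j) \<noteq> (1, 2) \<longrightarrow> commutator G (s i) (s j) = \<one>)"
    (is "?L \<longleftrightarrow> ?R")
  proof
    assume L: ?L
    show ?R
    proof (intro allI impI)
      fix i j :: nat assume ij: "1 \<le> i \<and> i < j \<and> j \<le> 4 \<and> (i, j) \<noteq> (1, 2)"
      then have "word_eval s (word_comm (phi10_gen i) (phi10_gen j)) = \<one>" using L by blast
      then show "commutator G (s i) (s j) = \<one>" using comm[of i j] ij by simp
    qed
  next
    assume R: ?R
    show ?L
    proof
      fix r assume "r \<in> {word_comm (phi10_gen i) (phi10_gen j) |i j. 1 \<le> i \<and> i < j \<and> j \<le> 4 \<and> (i, j) \<noteq> (1, 2)}"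
      then obtain i j where r: "r = word_comm (phi10_gen i) (phi10_gen j)"
        and ij: "1 \<le> i \<and> i < j \<and> j \<le> 4 \<and> (i, j) \<noteq> (1, 2)" by blast
      have "commutator G (s i) (s j) = \<one>" using R ij by blast
      then show "word_eval s r = \<one>" using comm[of i j] ij by (simp add: r)
    qed
  qed
  have C: "(\<forall>r\<in>{phi10_ppow p j |j. j \<in> {1, 2, 3, 4}}. word_eval s r = \<one>) \<longleftrightarrow> (\<forall>j\<in>{1, 2, 3, 4}. word_eval s (phi10_ppow p j) = \<one>)"
    by blast
  show ?thesis
    unfolding satisfies_phi10_def phi10_relators_def ball_Un A B C
    using s rel[of 1 2 4] comm[of 4 0] pow by simp
qed

lemma eval_phi10_ppow_3:
  assumes s: "s ` {0..4} \<subseteq> carrier G"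
  shows "word_eval s (phi10_ppow 3 1) = s 1 [^] (3::nat) \<otimes> (s 2 [^] (3::nat) \<otimes> s 3)"
    and "word_eval s (phi10_ppow 3 2) = s 2 [^] (3::nat) \<otimes> (s 3 [^] (3::nat) \<otimes> s 4)"
    and "word_eval s (phi10_ppow 3 3) = s 3 [^] (3::nat) \<otimes> s 4 [^] (3::nat)"
    and "word_eval s (phi10_ppow 3 4) = s 4 [^] (3::nat)"
proof -
  have c: "s i \<in> carrier G" if "i \<le> 4" for i using s that by auto
  have idx: "(1::nat) + 1 = 2" "(1::nat) + 2 = 3" by simp_all
  have ext: "ext_gen s 1 = s 1" "ext_gen s 2 = s 2" "ext_gen s 3 = s 3" "ext_gen s 4 = s 4"
    by (simp_all add: ext_gen_def)
  note e = eval_phi10_ppow(2)[OF s]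
  show "word_eval s (phi10_ppow 3 1) = s 1 [^] (3::nat) \<otimes> (s 2 [^] (3::nat) \<otimes> s 3)"
    by (simp only: e[OF le_refl] idx ext)
  show "word_eval s (phi10_ppow 3 2) = s 2 [^] (3::nat) \<otimes> (s 3 [^] (3::nat) \<otimes> s 4)"
    "word_eval s (phi10_ppow 3 3) = s 3 [^] (3::nat) \<otimes> s 4 [^] (3::nat)"
    "word_eval s (phi10_ppow 3 4) = s 4 [^] (3::nat)"
    using c by (simp_all add: e ext_gen_def)
qed

lemma eval_phi10_ppow_ge_5:
  assumes s: "s ` {0..4} \<subseteq> carrier G" and p: "p \<ge> 5"
  shows "word_eval s (phi10_ppow p 1) =
      s 1 [^] p \<otimes> (s 2 [^] (p choose 2) \<otimes> (s 3 [^] (p choose 3) \<otimes> s 4 [^] (p choose 4)))"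
    and "word_eval s (phi10_ppow p 2) = s 2 [^] p \<otimes> (s 3 [^] (p choose 2) \<otimes> s 4 [^] (p choose 3))"
    and "word_eval s (phi10_ppow p 3) = s 3 [^] p \<otimes> s 4 [^] (p choose 2)"
    and "word_eval s (phi10_ppow p 4) = s 4 [^] p"
proof -
  have c: "s i \<in> carrier G" if "i \<le> 4" for i using s that by auto
  have idx: "(1::nat) + 1 = 2" "(1::nat) + 2 = 3" "(1::nat) + 3 = 4" by simp_all
  have ext: "ext_gen s 1 = s 1" "ext_gen s 2 = s 2" "ext_gen s 3 = s 3" "ext_gen s 4 = s 4"
    by (simp_all add: ext_gen_def)
  note e = eval_phi10_ppow(1)[OF s _ p]
  show "word_eval s (phi10_ppow p 1) =
      s 1 [^] p \<otimes> (s 2 [^] (p choose 2) \<otimes> (s 3 [^] (p choose 3) \<otimes> s 4 [^] (p choose 4)))"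
    by (simp only: e[OF le_refl] idx ext)
  show "word_eval s (phi10_ppow p 2) = s 2 [^] p \<otimes> (s 3 [^] (p choose 2) \<otimes> s 4 [^] (p choose 3))"
    "word_eval s (phi10_ppow p 3) = s 3 [^] p \<otimes> s 4 [^] (p choose 2)"
    "word_eval s (phi10_ppow p 4) = s 4 [^] p"
    using c by (simp_all add: e ext_gen_def)
qed

end

subsection \<open>A permutation model of \<open>\<Phi>\<^sub>1\<^sub>0(1\<^sup>5)\<close>\<close>

lemma (in group) commutator_eqI:
  assumes "x \<otimes> y = y \<otimes> x \<otimes> z" "x \<in> carrier G" "y \<in> carrier G" "z \<in> carrier G"
  shows "commutator G x y = z"
proof -
  have "commutator G x y = inv x \<otimes> inv y \<otimes> (x \<otimes> y)" using assms(2-4) by (simp add: commutator_def m_assoc)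
  then show ?thesis unfolding assms(1) using assms(2-4) by (simp add: group_word_simps)
qed

text \<open>\<open>\<alpha>\<close> and the \<open>\<alpha>\<^sub>i\<close> act on triples \<open>(i, j, k)\<close> modulo \<open>p\<close>, \<open>p\<close> and \<open>M\<close> by such maps;
  \<open>i\<close> is shifted by \<open>\<alpha>\<close>, \<open>j\<close> by \<open>\<alpha>\<^sub>1\<close>, and \<open>k\<close> by \<open>\<alpha>\<^sub>4\<close>.\<close>

definition shear :: "int \<Rightarrow> int \<Rightarrow> (int \<Rightarrow> int) \<Rightarrow> (int \<Rightarrow> int) \<Rightarrow> int \<times> int \<times> int \<Rightarrow> int \<times> int \<times> int" where
  "shear s b c d = (\<lambda>(i, j, k). (i + s, j + b, k + c i + d i * j))"

locale residue_triples =
  fixes p M :: nat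
  assumes p: "p > 0" and M: "M > 0"
begin

definition triples :: "(int \<times> int \<times> int) set" where
  "triples = {0..<int p} \<times> {0..<int p} \<times> {0..<int M}"

definition tcong :: "int \<times> int \<times> int \<Rightarrow> int \<times> int \<times> int \<Rightarrow> bool" where
  "tcong v w \<longleftrightarrow> int p dvd fst v - fst w \<and> int p dvd fst (snd v) - fst (snd w) \<and> int M dvd snd (snd v) - snd (snd w)"

definition red :: "int \<times> int \<times> int \<Rightarrow> int \<times> int \<times> int" where
  "red v = (fst v mod int p, fst (snd v) mod int p, snd (snd v) mod int M)"

text \<open>The equivalence asks at once that \<open>F\<close> be well defined on residues and
  injective on them, which on a finite set makes it a permutation.\<close>

definition compat :: "(int \<times> int \<times> int \<Rightarrow> int \<times> int \<times> int) \<Rightarrow> bool" where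
  "compat F \<longleftrightarrow> (\<forall>v w. tcong (F v) (F w) \<longleftrightarrow> tcong v w)"

definition elt :: "(int \<times> int \<times> int \<Rightarrow> int \<times> int \<times> int) \<Rightarrow> int \<times> int \<times> int \<Rightarrow> int \<times> int \<times> int" where
  "elt F = (\<lambda>v\<in>triples. red (F v))"

abbreviation "K \<equiv> BijGroup triples"

sublocale K: group K by (rule group_BijGroup)

lemma tcong_iff_red: "tcong v w \<longleftrightarrow> red v = red w"
  by (simp add: tcong_def red_def mod_eq_dvd_iff)

lemma red_in_triples: "red v \<in> triples"
  using p M by (simp add: red_def triples_def)

lemma red_triples: "v \<in> triples \<Longrightarrow> red v = v"
  by (auto simp: red_def triples_def)

lemma red_red: "red (red v) = red v"
  by (simp add: red_in_triples red_triples)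

lemma compatD: "compat F \<Longrightarrow> red (F v) = red (F w) \<longleftrightarrow> red v = red w"
  unfolding compat_def tcong_iff_red by blast

lemma elt_Bij:
  assumes "compat F"
  shows "elt F \<in> carrier K"
proof -
  have "inj_on (elt F) triples"
  proof (rule inj_onI)
    fix v w assume vw: "v \<in> triples" "w \<in> triples" "elt F v = elt F w"
    then have "red v = red w" using compatD[OF assms] by (simp add: elt_def)
    then show "v = w" using vw by (simp add: red_triples)
  qed
  moreover have "elt F ` triples \<subseteq> triples" by (auto simp: elt_def red_in_triples)
  moreover have "finite triples" by (simp add: triples_def)
  ultimately have "bij_betw (elt F) triples triples" by (simp add: bij_betw_def endo_inj_surj)
  then show ?thesis by (simp add: BijGroup_def Bij_def elt_def)
qed

lemma elt_mult:
  assumes "compat F" "compat H"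
  shows "elt F \<otimes>\<^bsub>K\<^esub> elt H = elt (F \<circ> H)" "compat (F \<circ> H)"
proof -
  have "red (F (red v)) = red (F v)" for v
    using compatD[OF assms(1)] red_red by blast
  then show "elt F \<otimes>\<^bsub>K\<^esub> elt H = elt (F \<circ> H)"
    using elt_Bij[OF assms(1)] elt_Bij[OF assms(2)]
    by (simp add: BijGroup_def compose_def) (auto simp: elt_def red_in_triples fun_eq_iff)
  show "compat (F \<circ> H)" using assms unfolding compat_def comp_def by blast
qed

lemma elt_one: "\<one>\<^bsub>K\<^esub> = elt id" "compat id"
  by (auto simp: BijGroup_def elt_def red_triples compat_def)

lemma elt_pow:
  assumes "compat F"
  shows "elt F [^]\<^bsub>K\<^esub> (n::nat) = elt (F ^^ n)" "compat (F ^^ n)"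
proof (induction n)
  case (Suc n)
  have eq: "F ^^ n \<circ> F = F ^^ Suc n" by (simp add: funpow_swap1 fun_eq_iff)
  show "elt F [^]\<^bsub>K\<^esub> Suc n = elt (F ^^ Suc n)" using Suc elt_mult(1)[OF Suc(2) assms] by (simp add: eq)
  show "compat (F ^^ Suc n)" using elt_mult(2)[OF Suc(2) assms] by (simp only: eq)
qed (simp_all add: elt_one)

lemma elt_eqI: "(\<And>v. tcong (F v) (H v)) \<Longrightarrow> elt F = elt H"
  by (simp add: elt_def tcong_iff_red restrict_def)

text \<open>The product \<open>d i * j\<close> has to make sense modulo \<open>M\<close> although
  \<open>j\<close> is known only modulo \<open>p\<close>; hence the condition on
  \<open>d i * int p\<close>.\<close>

lemma shear_compat:
  assumes c: "\<And>i i'. int p dvd i - i' \<Longrightarrow> int M dvd c i - c i'"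
    and d: "\<And>i i'. int p dvd i - i' \<Longrightarrow> int M dvd d i - d i'" "\<And>i. int M dvd d i * int p"
  shows "compat (shear s b c d)"
  unfolding compat_def
proof (intro allI)
  fix v w :: "int \<times> int \<times> int"
  obtain i j k where v: "v = (i, j, k)" by (cases v)
  obtain i' j' k' where w: "w = (i', j', k')" by (cases w)
  show "tcong (shear s b c d v) (shear s b c d w) \<longleftrightarrow> tcong v w"
  proof (cases "int p dvd i - i' \<and> int p dvd j - j'")
    case True
    then obtain t where t: "j - j' = int p * t" by (auto elim: dvdE)
    have "int M dvd (d i - d i') * j" using True d(1) by (intro dvd_mult2) simp
    moreover have "int M dvd d i' * (j - j')"
      using dvd_mult2[OF d(2)[of i'], of t] by (simp add: t mult.assoc)
    ultimately have *: "int M dvd (c i - c i') + ((d i - d i') * j + d i' * (j - j'))"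
      using True c by (intro dvd_add) auto
    have eq: "(k + c i + d i * j) - (k' + c i' + d i' * j')
      = ((c i - c i') + ((d i - d i') * j + d i' * (j - j'))) + (k - k')" by (simp add: algebra_simps)
    have "int M dvd (k + c i + d i * j) - (k' + c i' + d i' * j') \<longleftrightarrow> int M dvd k - k'"
      unfolding eq by (rule dvd_add_right_iff[OF *])
    then show ?thesis using True by (simp add: tcong_def shear_def v w)
  qed (auto simp: tcong_def shear_def v w)
qed

lemma shear_apply: "shear s b c d (i, j, k) = (i + s, j + b, k + c i + d i * j)"
  by (simp add: shear_def)

text \<open>Iteration sums j, j + b, j + 2b and so on, which brings in the binomial
  coefficient.\<close>

lemma shear_pow: "(shear 0 b c d ^^ n) (i, j, k) =
    (i, j + int n * b, k + int n * c i + d i * (int n * j + b * int (n choose 2)))"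
proof (induction n)
  case (Suc n)
  have "Suc n choose 2 = n + (n choose 2)" by (simp add: numeral_2_eq_2)
  then show ?case using Suc by (simp add: shear_def algebra_simps)
qed simp

lemma shift_pow: "(shear 1 0 (\<lambda>_. 0) (\<lambda>_. 0) ^^ n) (i, j, k) = (i + int n, j, k)"
  by (induction n) (simp_all add: shear_def)

end

text \<open>For \<open>p = 3\<close> the corrections \<open>e = 1\<close>, \<open>f = -1\<close> and \<open>M = 9\<close> realise
  \<open>\<alpha>\<^sub>2\<^sup>3 = \<alpha>\<^sub>4\<inverse>\<close> and \<open>\<alpha>\<^sub>1\<^sup>3 \<alpha>\<^sub>2\<^sup>3 \<alpha>\<^sub>3 = 1\<close>.\<close>

locale phi10_model = residue_triples +
  fixes e f :: int
  assumes per1: "\<And>i i'. int p dvd i - i' \<Longrightarrow> int M dvd (i * (i - 1) * (i - 2) + e * i) - (i' * (i' - 1) * (i' - 2) + e * i')"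
    and per2: "\<And>i i'. int p dvd i - i' \<Longrightarrow> int M dvd 3 * i * (i - 1) - 3 * i' * (i' - 1)"
    and per3: "\<And>i i'. int p dvd i - i' \<Longrightarrow> int M dvd 6 * i - 6 * i'"
    and per4: "int M dvd 6 * int p"
begin

text \<open>Taking the commutator with \<open>\<alpha>\<close> is the forward difference in
  \<open>i\<close>: i(i-1)(i-2) has the differences 3i(i-1), 6i and 6, and -6i has the difference
  -6. Leaving the falling factorial undivided avoids denominators and makes
  \<open>\<alpha>\<^sub>4\<close> add 6. The term -6j of \<open>\<alpha>\<^sub>2\<close> reacts to
  the shift of \<open>j\<close> by \<open>\<alpha>\<^sub>1\<close> with the same 6.\<close>

definition gen_map :: "nat \<Rightarrow> int \<times> int \<times> int \<Rightarrow> int \<times> int \<times> int" where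
  "gen_map l =
    (if l = 0 then shear 1 0 (\<lambda>_. 0) (\<lambda>_. 0)
     else if l = 1 then shear 0 1 (\<lambda>i. i * (i - 1) * (i - 2) + e * i + f) (\<lambda>i. - 6 * i)
     else if l = 2 then shear 0 0 (\<lambda>i. 3 * i * (i - 1) + e) (\<lambda>i. - 6)
     else if l = 3 then shear 0 0 (\<lambda>i. 6 * i) (\<lambda>i. 0)
     else shear 0 0 (\<lambda>i. 6) (\<lambda>i. 0))"

lemma gen_map_compat: "compat (gen_map l)"
proof -
  have *: "int M dvd - 6 * i - - 6 * i'" if "int p dvd i - i'" for i i'
  proof -
    have "- 6 * i - - 6 * i' = - (6 * i - 6 * i')" by simp
    then show ?thesis using per3[OF that] by (simp only: dvd_minus_iff)
  qed
  have **: "int M dvd - 6 * i * int p" for i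
    using dvd_mult2[OF per4, of "- i"] by (simp add: ac_simps)
  show ?thesis
    unfolding gen_map_def using per1 per2 per3 * ** per4 by (auto intro!: shear_compat)
qed

abbreviation gen_elt :: "nat \<Rightarrow> int \<times> int \<times> int \<Rightarrow> int \<times> int \<times> int" where
  "gen_elt l \<equiv> elt (gen_map l)"

lemma gen_elt_closed: "gen_elt l \<in> carrier K"
  by (rule elt_Bij[OF gen_map_compat])

lemma gen_elt_comm:
  assumes "gen_map l \<circ> gen_map m = gen_map m \<circ> gen_map l \<circ> gen_map n"
  shows "commutator K (gen_elt l) (gen_elt m) = gen_elt n"
  using assms gen_map_compat
  by (intro K.commutator_eqI gen_elt_closed) (simp add: elt_mult)

lemma gen_elt_commute:
  assumes "gen_map l \<circ> gen_map m = gen_map m \<circ> gen_map l"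
  shows "commutator K (gen_elt l) (gen_elt m) = \<one>\<^bsub>K\<^esub>"
proof (rule K.commutator_eqI[OF _ gen_elt_closed gen_elt_closed K.one_closed])
  have "gen_elt l \<otimes>\<^bsub>K\<^esub> gen_elt m = gen_elt m \<otimes>\<^bsub>K\<^esub> gen_elt l"
    using assms gen_map_compat by (simp add: elt_mult)
  then show "gen_elt l \<otimes>\<^bsub>K\<^esub> gen_elt m = gen_elt m \<otimes>\<^bsub>K\<^esub> gen_elt l \<otimes>\<^bsub>K\<^esub> \<one>\<^bsub>K\<^esub>"
    by (simp add: gen_elt_closed)
qed

lemma gen_elt_commutators:
  "l \<in> {1, 2, 3} \<Longrightarrow> commutator K (gen_elt l) (gen_elt 0) = gen_elt (l + 1)"
  "commutator K (gen_elt 4) (gen_elt 0) = \<one>\<^bsub>K\<^esub>"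
  "commutator K (gen_elt 1) (gen_elt 2) = gen_elt 4"
  "1 \<le> l \<Longrightarrow> l < m \<Longrightarrow> m \<le> 4 \<Longrightarrow> (l, m) \<noteq> (1, 2) \<Longrightarrow> commutator K (gen_elt l) (gen_elt m) = \<one>\<^bsub>K\<^esub>"
proof -
  show "commutator K (gen_elt l) (gen_elt 0) = gen_elt (l + 1)" if "l \<in> {1, 2, 3}"
    using that by (intro gen_elt_comm) (auto simp: gen_map_def shear_def fun_eq_iff algebra_simps)
  show "commutator K (gen_elt 4) (gen_elt 0) = \<one>\<^bsub>K\<^esub>"
    by (intro gen_elt_commute) (auto simp: gen_map_def shear_def fun_eq_iff)
  show "commutator K (gen_elt 1) (gen_elt 2) = gen_elt 4"
    by (intro gen_elt_comm) (auto simp: gen_map_def shear_def fun_eq_iff algebra_simps)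
  assume lm: "1 \<le> l" "l < m" "m \<le> 4" "(l, m) \<noteq> (1, 2)"
  then consider "l = 1" "m = 3 \<or> m = 4" | "l = 2 \<or> l = 3" "m = 3 \<or> m = 4" by fastforce
  then show "commutator K (gen_elt l) (gen_elt m) = \<one>\<^bsub>K\<^esub>"
    by cases (intro gen_elt_commute; auto simp: gen_map_def shear_def fun_eq_iff)+
qed

lemma gen_elt_0_pow: "gen_elt 0 [^]\<^bsub>K\<^esub> p = \<one>\<^bsub>K\<^esub>"
  unfolding elt_pow(1)[OF gen_map_compat] elt_one
  by (rule elt_eqI) (auto simp: gen_map_def shift_pow tcong_def)

end

lemma model_prime_ge_5:
  assumes p: "Factorial_Ring.prime (p::nat)" "p \<ge> 5"
  shows "phi10_model p p 0"
proof
  fix i i' :: int assume "int p dvd i - i'"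
  then obtain t where t: "i = i' + int p * t" by (metis add.commute diff_add_cancel dvdE)
  show "int p dvd (i * (i - 1) * (i - 2) + 0 * i) - (i' * (i' - 1) * (i' - 2) + 0 * i')"
    by (simp add: t algebra_simps)
  show "int p dvd 3 * i * (i - 1) - 3 * i' * (i' - 1)" by (simp add: t algebra_simps)
  show "int p dvd 6 * i - 6 * i'" by (simp add: t algebra_simps)
qed (use p in auto)

text \<open>The modulus 3 would kill the 6 added by \<open>\<alpha>\<^sub>4\<close>, the modulus 9
  does not. With the linear correction the cubic is (i - 1)^3 + 1, and a cube modulo 9 depends only
  on its base modulo 3.\<close>

lemma model_3: "phi10_model 3 9 1"
proof
  fix i i' :: int assume "int 3 dvd i - i'"
  then obtain t where t: "i = i' + 3 * t" by (metis add.commute diff_add_cancel dvdE of_nat_numeral)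
  have "(i * (i - 1) * (i - 2) + 1 * i) - (i' * (i' - 1) * (i' - 2) + 1 * i')
    = 9 * (t * (i' - 1)\<^sup>2 + 3 * t\<^sup>2 * (i' - 1) + 3 * t ^ 3)"
    by (simp add: t algebra_simps power2_eq_square power3_eq_cube)
  then show "int 9 dvd (i * (i - 1) * (i - 2) + 1 * i) - (i' * (i' - 1) * (i' - 2) + 1 * i')" by simp
  have "3 * i * (i - 1) - 3 * i' * (i' - 1) = 9 * (t * (2 * i' - 1) + 3 * t\<^sup>2)"
    by (simp add: t algebra_simps power2_eq_square)
  then show "int 9 dvd 3 * i * (i - 1) - 3 * i' * (i' - 1)" by simp
  have "6 * i - 6 * i' = 9 * (2 * t)" by (simp add: t)
  then show "int 9 dvd 6 * i - 6 * i'" by simp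
qed auto

text \<open>Neither faithfulness nor the order of the model is at stake, only that the relators do
  not force \<open>\<alpha>\<^sub>4\<close> to be trivial.\<close>

lemma phi10_model_group:
  assumes prm: "Factorial_Ring.prime (p::nat)" "odd p"
  shows "\<exists>(K :: (int \<times> int \<times> int \<Rightarrow> int \<times> int \<times> int) monoid) s. group K \<and> group.satisfies_phi10 K p s \<and> s 4 \<noteq> \<one>\<^bsub>K\<^esub>"
proof -
  \<comment> \<open>The 6 added to the last coordinate is visible at the origin unless
    \<open>M\<close> divides it.\<close>
  have ne: "residue_triples.elt p M F \<noteq> \<one>\<^bsub>BijGroup (residue_triples.triples p M)\<^esub>"
    if "residue_triples p M" "F (0, 0, 0) = (0, 0, 6)" "\<not> int M dvd 6" for p M F
  proof -
    interpret residue_triples p M by fact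
    have z: "(0, 0, 0) \<in> triples" using p M by (simp add: triples_def)
    have "(elt F) (0, 0, 0) \<noteq> \<one>\<^bsub>K\<^esub> (0, 0, 0)"
      using that(2,3) z by (simp add: elt_def red_def BijGroup_def dvd_eq_mod_eq_0)
    then show ?thesis by metis
  qed
  show ?thesis
  proof (cases "p \<ge> 5")
    case True
    interpret phi10_model p p 0 0 by (rule model_prime_ge_5[OF prm(1) True])
    have s: "gen_elt ` {0..4} \<subseteq> carrier K" using gen_elt_closed by blast
    have pow: "gen_elt l [^]\<^bsub>K\<^esub> p = \<one>\<^bsub>K\<^esub>" if "l \<in> {1, 2, 3, 4}" for l
    proof -
      have c2: "int p dvd int (p choose 2)" using prm True by (intro int_dvd_int_iff[THEN iffD2] dvd_choose_prime) auto
      have "tcong ((gen_map l ^^ p) (i, j, k)) (i, j, k)" for i j k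
        using that c2 by (auto simp: gen_map_def shear_pow tcong_def intro!: dvd_add dvd_mult)
      then show ?thesis
        unfolding elt_pow(1)[OF gen_map_compat] elt_one by (intro elt_eqI) auto
    qed
    \<comment> \<open>For these \<open>k\<close> the exponents are multiples of \<open>p\<close>, so
      the corrections in the power relators vanish.\<close>
    have powc: "K.ext_gen gen_elt l [^]\<^bsub>K\<^esub> (p choose k) = \<one>\<^bsub>K\<^esub>" if "0 < k" "k < p" "1 \<le> l" for l k
    proof (cases "l \<le> 4")
      case l: True
      have "p dvd p choose k" using prm that by (intro dvd_choose_prime) auto
      then obtain m where "p choose k = p * m" by (rule dvdE)
      moreover have "l \<in> {1, 2, 3, 4}" using l that by auto
      ultimately show ?thesis
        using pow gen_elt_closed l by (simp add: K.ext_gen_def K.nat_pow_pow[symmetric])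
    qed (simp add: K.ext_gen_def)
    have "K.word_eval gen_elt (phi10_ppow p l) = \<one>\<^bsub>K\<^esub>" if "l \<in> {1, 2, 3, 4}" for l
    proof -
      have "l \<ge> 1" "l \<le> 4" using that by auto
      then show ?thesis
        unfolding K.eval_phi10_ppow(1)[OF s \<open>l \<ge> 1\<close> True]
        using powc[of 2 "l + 1"] powc[of 3 "l + 2"] powc[of 4 "l + 3"] pow[OF that] True
        by (simp add: K.ext_gen_def[of _ l])
    qed
    then have "K.satisfies_phi10 p gen_elt"
      unfolding K.satisfies_phi10_iff[OF s] using gen_elt_commutators gen_elt_0_pow by blast
    moreover have "gen_elt 4 \<noteq> \<one>\<^bsub>K\<^esub>"
    proof (rule ne)
      show "\<not> int p dvd 6"
      proof
        assume "int p dvd 6"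
        then have "int p dvd int (2 * 3)" by simp
        then have "p dvd 2 * 3" by (simp only: int_dvd_int_iff)
        then have "p dvd 2 \<or> p dvd 3" by (rule prime_dvd_multD[OF prm(1)])
        then show False using True by (auto dest: dvd_imp_le)
      qed
    qed (auto simp: gen_map_def shear_def residue_triples_axioms)
    ultimately show ?thesis using K.group_axioms by blast
  next
    case False
    have "p \<noteq> 2" "p > 1" using prm prime_gt_1_nat by auto
    moreover have "p \<noteq> 4" using prm(2) by auto
    ultimately have p3: "p = 3" using False by linarith
    interpret phi10_model 3 9 1 "- 1" by (rule model_3)
    have s: "gen_elt ` {0..4} \<subseteq> carrier K" using gen_elt_closed by blast
    have c: "(3::nat) choose 2 = 3" by (simp add: numeral_eq_Suc)
    have prod: "elt F [^]\<^bsub>K\<^esub> (3::nat) \<otimes>\<^bsub>K\<^esub> (elt H [^]\<^bsub>K\<^esub> (3::nat) \<otimes>\<^bsub>K\<^esub> elt J) = \<one>\<^bsub>K\<^esub>"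
      if "compat F" "compat H" "compat J" "\<And>v. tcong ((F ^^ 3 \<circ> (H ^^ 3 \<circ> J)) v) v" for F H J
      using that by (simp only: elt_pow elt_mult elt_one) (simp add: elt_eqI)
    \<comment> \<open>A product of three consecutive integers supplies the factor 3 that
      \<open>r1\<close> lacks for divisibility by 9.\<close>
    have cube: "(3::int) dvd i * (i - 1) * (i - 2)" for i
    proof -
      have "(3::int) dvd i \<or> 3 dvd i - 1 \<or> 3 dvd i - 2" by presburger
      then show ?thesis by (auto intro: dvd_mult dvd_mult2)
    qed
    have r1: "tcong ((gen_map 1 ^^ 3 \<circ> (gen_map 2 ^^ 3 \<circ> gen_map 3)) v) v" for v
    proof -
      obtain i j k where v: "v = (i, j, k)" by (cases v)
      obtain q where q: "i * (i - 1) * (i - 2) = 3 * q" using cube by (rule dvdE)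
      have "(k + 6 * i + 3 * (3 * i * (i - 1) + 1) + - 6 * (3 * j) + 3 * (i * (i - 1) * (i - 2) + i - 1)
          + - 6 * i * (3 * j + 3)) - k = 9 * (i * (i - 1) - 2 * j + q - 2 * i * j - i)"
        unfolding q by (simp add: algebra_simps)
      then have "9 dvd (k + 6 * i + 3 * (3 * i * (i - 1) + 1) + - 6 * (3 * j) + 3 * (i * (i - 1) * (i - 2) + i - 1)
          + - 6 * i * (3 * j + 3)) - k" by (simp only: dvd_triv_left)
      moreover have "(gen_map 1 ^^ 3 \<circ> (gen_map 2 ^^ 3 \<circ> gen_map 3)) v
        = (i, j + 3, k + 6 * i + 3 * (3 * i * (i - 1) + 1) + - 6 * (3 * j) + 3 * (i * (i - 1) * (i - 2) + i - 1)
          + - 6 * i * (3 * j + 3))"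
        by (simp add: v gen_map_def shear_apply shear_pow c)
      ultimately show ?thesis by (simp add: tcong_def v)
    qed
    have r2: "tcong ((gen_map 2 ^^ 3 \<circ> (gen_map 3 ^^ 3 \<circ> gen_map 4)) v) v" for v
    proof -
      obtain i j k where v: "v = (i, j, k)" by (cases v)
      have "(k + 6 + 3 * (6 * i) + 3 * (3 * i * (i - 1) + 1) + - 6 * (3 * j)) - k = 9 * (i * (i - 1) + 2 * i - 2 * j + 1)"
        by (simp add: algebra_simps)
      then have "9 dvd (k + 6 + 3 * (6 * i) + 3 * (3 * i * (i - 1) + 1) + - 6 * (3 * j)) - k" by (simp only: dvd_triv_left)
      moreover have "(gen_map 2 ^^ 3 \<circ> (gen_map 3 ^^ 3 \<circ> gen_map 4)) v
        = (i, j, k + 6 + 3 * (6 * i) + 3 * (3 * i * (i - 1) + 1) + - 6 * (3 * j))"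
        by (simp add: v gen_map_def shear_apply shear_pow)
      ultimately show ?thesis by (simp add: tcong_def v)
    qed
    have r3: "tcong ((gen_map 3 ^^ 3 \<circ> (gen_map 4 ^^ 3 \<circ> id)) v) v" for v
    proof -
      obtain i j k where v: "v = (i, j, k)" by (cases v)
      have "(gen_map 3 ^^ 3 \<circ> (gen_map 4 ^^ 3 \<circ> id)) v = (i, j, k + 18 + 3 * (6 * i))"
        by (simp add: v gen_map_def shear_pow)
      moreover have "18 + 3 * (6 * i) = 9 * (2 + 2 * i)" by simp
      ultimately show ?thesis by (simp add: tcong_def v)
    qed
    have r4: "tcong ((gen_map 4 ^^ 3 \<circ> (id ^^ 3 \<circ> id)) v) v" for v
      by (cases v) (simp add: gen_map_def shear_pow tcong_def)
    note resp = gen_map_compat elt_one(2)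
    have "K.word_eval gen_elt (phi10_ppow 3 l) = \<one>\<^bsub>K\<^esub>" if l4: "l \<in> {1, 2, 3, 4}" for l
    proof -
      have one: "\<one>\<^bsub>K\<^esub> = elt id" by (rule elt_one)
      consider "l = 1" | "l = 2" | "l = 3" | "l = 4" using l4 by blast
      then show ?thesis
      proof cases
        case 1
        show ?thesis
          unfolding 1 K.eval_phi10_ppow_3(1)[OF s] by (rule prod[OF resp(1) resp(1) resp(1) r1])
      next
        case 2
        show ?thesis
          unfolding 2 K.eval_phi10_ppow_3(2)[OF s] by (rule prod[OF resp(1) resp(1) resp(1) r2])
      next
        case 3
        show ?thesis
          unfolding 3 K.eval_phi10_ppow_3(3)[OF s] using prod[OF resp(1) resp(1) resp(2) r3] gen_elt_closed
          by (simp add: one[symmetric])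
      next
        case 4
        show ?thesis
          unfolding 4 K.eval_phi10_ppow_3(4)[OF s] using prod[OF resp(1) resp(2) resp(2) r4] gen_elt_closed
          by (simp add: one[symmetric])
      qed
    qed
    then have "K.satisfies_phi10 3 gen_elt"
      unfolding K.satisfies_phi10_iff[OF s] using gen_elt_commutators gen_elt_0_pow by blast
    moreover have "gen_elt 4 \<noteq> \<one>\<^bsub>K\<^esub>"
      by (rule ne) (auto simp: gen_map_def shear_def residue_triples_axioms)
    ultimately show ?thesis using K.group_axioms p3 by blast
  qed
qed

subsection \<open>Transfer along an isoclinism\<close>

lemma phi10_presentation:
  assumes p: "Factorial_Ring.prime p" "odd p"
  obtains s where "group.satisfies_phi10 (Phi10_1_5 p) p s" "s 4 \<noteq> \<one>\<^bsub>Phi10_1_5 p\<^esub>"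
    "\<And>U. subgroup U (Phi10_1_5 p) \<Longrightarrow> s ` {0..4} \<subseteq> U \<Longrightarrow> carrier (Phi10_1_5 p) \<subseteq> U"
proof -
  let ?S = "{0..4::nat}" and ?R = "phi10_relators p"
  define P where "P = Phi10_1_5 p"
  have P: "P = presented_group ?S ?R" by (simp add: P_def Phi10_1_5_def)
  interpret P: group P unfolding P by (rule group_presented_group)
  let ?c = "\<lambda>w. word_rel ?S ?R `` {w}"
  define s where "s = (\<lambda>x. ?c [(x, True)])"
  have eval: "?c w = P.word_eval s w" if "w \<in> words_over ?S" for w
    using presented_group_eval[OF that, of ?R] by (simp add: P s_def)
  have car: "carrier P = ?c ` words_over ?S" and one: "\<one>\<^bsub>P\<^esub> = ?c []"
    by (auto simp: P presented_group_def quotient_def)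
  have sS: "s ` ?S \<subseteq> carrier P" unfolding car s_def by (auto simp: words_over_def)
  have Rw: "r \<in> words_over ?S" if "r \<in> ?R" for r
  proof -
    have comm: "word_comm u v \<in> words_over ?S" if "u \<in> words_over ?S" "v \<in> words_over ?S" for u v
      using that word_inv_words[OF that(1)] word_inv_words[OF that(2)] by (simp add: word_comm_def words_over_def)
    have app: "u @ v \<in> words_over ?S" if "u \<in> words_over ?S" "v \<in> words_over ?S" for u v
      using that by (simp add: words_over_def)
    have pp: "phi10_ppow p j \<in> words_over ?S" for j
      using word_pow_words[OF P.phi10_gen_words] unfolding phi10_ppow_def words_over_def
      by (auto simp: in_lists_conv_set)
    note g = P.phi10_gen_words
    show ?thesis
      using that unfolding phi10_relators_def
      by (auto intro: comm app word_inv_words g word_pow_words pp)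
  qed
  have sat: "P.satisfies_phi10 p s"
    unfolding P.satisfies_phi10_def
  proof (intro conjI ballI sS)
    fix r assume r: "r \<in> ?R"
    have "word_eq ?S ?R r []" using r Rw[OF r] by (rule word_eq.rel)
    then have "?c r = ?c []" by (intro equiv_class_eq[OF equiv_word_rel]) (simp add: word_rel_def)
    then show "P.word_eval s r = \<one>\<^bsub>P\<^esub>" using eval[OF Rw[OF r]] one by simp
  qed
  \<comment> \<open>Were \<open>\<alpha>\<^sub>4\<close> trivial as a word, it would be trivial in
    every group satisfying the relators, the permutation model included.\<close>
  have ne: "s 4 \<noteq> \<one>\<^bsub>P\<^esub>"
  proof
    assume "s 4 = \<one>\<^bsub>P\<^esub>"
    then have "?c [(4, True)] = ?c []" by (simp add: s_def one)
    moreover have "[] \<in> words_over ?S" by (simp add: words_over_def)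
    ultimately have eq: "word_eq ?S ?R [(4, True)] []"
      using eq_equiv_class[OF _ equiv_word_rel] by (force simp: word_rel_def)
    obtain K :: "(int \<times> int \<times> int \<Rightarrow> int \<times> int \<times> int) monoid" and t
      where K: "group K" "group.satisfies_phi10 K p t" "t 4 \<noteq> \<one>\<^bsub>K\<^esub>"
      using phi10_model_group[OF p] by blast
    interpret K: group K by (rule K(1))
    have t: "t ` ?S \<subseteq> carrier K" "\<And>r. r \<in> ?R \<Longrightarrow> K.word_eval t r = \<one>\<^bsub>K\<^esub>"
      using K(2) unfolding K.satisfies_phi10_def by auto
    have "K.word_eval t [(4, True)] = K.word_eval t []"
      by (rule K.word_eq_eval[OF t(1) _ eq]) (rule t(2))
    moreover have "t 4 \<in> carrier K" using t(1) by auto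
    ultimately show False using K(3) by simp
  qed
  have gen: "carrier P \<subseteq> U" if U: "subgroup U P" "s ` ?S \<subseteq> U" for U
  proof -
    have "P.word_eval s w \<in> U" if "w \<in> words_over ?S" for w
      using that
    proof (induction w)
      case Nil
      then show ?case using U by (simp add: subgroup.one_closed)
    next
      case (Cons a w)
      obtain x b where a: "a = (x, b)" by (cases a)
      have "s x \<in> U" "w \<in> words_over ?S" using Cons.prems U by (auto simp: words_over_def a)
      then show ?case
        using Cons U(1) by (auto simp: a intro: subgroup.m_closed subgroup.m_inv_closed)
    qed
    then show ?thesis unfolding car using eval by auto
  qed
  show thesis
    using that[of s] sat ne gen unfolding P_def by blast
qed

lemma (in group) commutator_rel:
  "x \<in> carrier G \<Longrightarrow> y \<in> carrier G \<Longrightarrow> x \<otimes> y = y \<otimes> x \<otimes> commutator G x y"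
  by (simp add: commutator_def group_word_simps)

lemma (in group) commutator_closed:
  "x \<in> carrier G \<Longrightarrow> y \<in> carrier G \<Longrightarrow> commutator G x y \<in> carrier G"
  by (simp add: commutator_def)

lemma (in group) commutator_in_derived:
  assumes "x \<in> carrier G" "y \<in> carrier G"
  shows "commutator G x y \<in> commutator_subgroup G"
proof -
  have "inv x \<otimes> inv y \<otimes> inv (inv x) \<otimes> inv (inv y) \<in> derived_set G (carrier G)"
    using assms by (intro UN_I[of "inv x"] UN_I[of "inv y"]) auto
  then have "inv x \<otimes> inv y \<otimes> inv (inv x) \<otimes> inv (inv y) \<in> commutator_subgroup G"
    unfolding derived_def by (rule generate.incl)
  then show ?thesis using assms by (simp add: commutator_def)
qed

lemma (in group) commutator_eq_one_iff:
  "x \<in> carrier G \<Longrightarrow> y \<in> carrier G \<Longrightarrow> commutator G x y = \<one> \<longleftrightarrow> x \<otimes> y = y \<otimes> x"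
  using commutator_rel[of x y] commutator_closed[of x y] by (metis l_cancel_one m_closed)

lemma (in group) center_normal: "center G \<lhd> G"
  unfolding normal_inv_iff
proof (intro conjI ballI center_subgroup)
  fix x z assume x: "x \<in> carrier G" and z: "z \<in> center G"
  have zG: "z \<in> carrier G" and "z \<otimes> inv x = inv x \<otimes> z" using z x by (auto simp: center_def)
  then have "x \<otimes> z \<otimes> inv x = x \<otimes> (inv x \<otimes> z)" using x by (simp add: m_assoc)
  also have "\<dots> = z" using x zG by (simp add: inv_cancel)
  finally show "x \<otimes> z \<otimes> inv x \<in> center G" using z by simp
qed

locale isoclinism = G: group G + H: group H
  for G :: "('a, 'b) monoid_scheme" and H :: "('c, 'd) monoid_scheme" +
  fixes \<phi> :: "'a set \<Rightarrow> 'c set" and \<psi> :: "'a \<Rightarrow> 'c"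
  assumes \<phi>: "\<phi> \<in> iso (G Mod center G) (H Mod center H)"
    and \<psi>: "\<psi> \<in> iso (G\<lparr>carrier := commutator_subgroup G\<rparr>) (H\<lparr>carrier := commutator_subgroup H\<rparr>)"
    and compat: "\<And>x y x' y'. x \<in> carrier G \<Longrightarrow> y \<in> carrier G \<Longrightarrow> x' \<in> carrier H \<Longrightarrow> y' \<in> carrier H \<Longrightarrow>
          \<phi> (center G #>\<^bsub>G\<^esub> x) = center H #>\<^bsub>H\<^esub> x' \<Longrightarrow>
          \<phi> (center G #>\<^bsub>G\<^esub> y) = center H #>\<^bsub>H\<^esub> y' \<Longrightarrow>
          \<psi> (commutator G x y) = commutator H x' y'"
begin

text \<open>A relation in place of a map avoids choosing representatives of cosets of the centre;
  partners are unique only up to central factors.\<close>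

definition lift :: "'a \<Rightarrow> 'c \<Rightarrow> bool" where
  "lift x x' \<longleftrightarrow> x \<in> carrier G \<and> x' \<in> carrier H \<and> \<phi> (center G #>\<^bsub>G\<^esub> x) = center H #>\<^bsub>H\<^esub> x'"

lemma lift_closed: "lift x x' \<Longrightarrow> x \<in> carrier G" "lift x x' \<Longrightarrow> x' \<in> carrier H"
  by (auto simp: lift_def)

lemma lift_mult:
  assumes "lift x x'" "lift y y'"
  shows "lift (x \<otimes>\<^bsub>G\<^esub> y) (x' \<otimes>\<^bsub>H\<^esub> y')"
proof -
  interpret GZ: normal "center G" G by (rule G.center_normal)
  interpret HZ: normal "center H" H by (rule H.center_normal)
  have xy: "x \<in> carrier G" "y \<in> carrier G" "x' \<in> carrier H" "y' \<in> carrier H" using assms by (auto simp: lift_def)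
  have "\<phi> (center G #>\<^bsub>G\<^esub> (x \<otimes>\<^bsub>G\<^esub> y)) = \<phi> ((center G #>\<^bsub>G\<^esub> x) \<otimes>\<^bsub>G Mod center G\<^esub> (center G #>\<^bsub>G\<^esub> y))"
    using xy by (simp add: FactGroup_def GZ.rcos_sum)
  also have "\<dots> = \<phi> (center G #>\<^bsub>G\<^esub> x) \<otimes>\<^bsub>H Mod center H\<^esub> \<phi> (center G #>\<^bsub>G\<^esub> y)"
    using xy \<phi> by (intro hom_mult) (auto simp: iso_def FactGroup_def RCOSETS_def)
  also have "\<dots> = center H #>\<^bsub>H\<^esub> (x' \<otimes>\<^bsub>H\<^esub> y')"
    using assms xy by (simp add: lift_def FactGroup_def HZ.rcos_sum)
  finally show ?thesis using xy by (simp add: lift_def)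
qed

lemma lift_commutator: "lift x x' \<Longrightarrow> lift y y' \<Longrightarrow> \<psi> (commutator G x y) = commutator H x' y'"
  using compat by (simp add: lift_def)

lemma lift_ex1:
  assumes "x' \<in> carrier H"
  shows "\<exists>x. lift x x'"
proof -
  have "center H #>\<^bsub>H\<^esub> x' \<in> carrier (H Mod center H)" using assms by (auto simp: FactGroup_def RCOSETS_def)
  then have "center H #>\<^bsub>H\<^esub> x' \<in> \<phi> ` carrier (G Mod center G)" using \<phi> by (auto simp: iso_def bij_betw_def)
  then show ?thesis using assms by (auto simp: lift_def FactGroup_def RCOSETS_def)
qed

lemma lift_ex2:
  assumes "x \<in> carrier G"
  shows "\<exists>x'. lift x x'"
proof -
  have "center G #>\<^bsub>G\<^esub> x \<in> carrier (G Mod center G)" using assms by (auto simp: FactGroup_def RCOSETS_def)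
  then have "\<phi> (center G #>\<^bsub>G\<^esub> x) \<in> carrier (H Mod center H)" using \<phi> by (auto simp: iso_def bij_betw_def)
  then show ?thesis using assms by (auto simp: lift_def FactGroup_def RCOSETS_def)
qed

lemma lift_same:
  assumes "lift x x'" "lift y x'"
  shows "\<exists>z\<in>center G. x = z \<otimes>\<^bsub>G\<^esub> y"
proof -
  have xy: "x \<in> carrier G" "y \<in> carrier G" using assms by (auto simp: lift_def)
  have "inj_on \<phi> (carrier (G Mod center G))" using \<phi> by (auto simp: iso_def bij_betw_def)
  moreover have "center G #>\<^bsub>G\<^esub> x \<in> carrier (G Mod center G)" "center G #>\<^bsub>G\<^esub> y \<in> carrier (G Mod center G)"
    using xy by (auto simp: FactGroup_def RCOSETS_def)
  ultimately have "center G #>\<^bsub>G\<^esub> x = center G #>\<^bsub>G\<^esub> y"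
    using assms by (auto simp: lift_def inj_on_def)
  then have "x \<in> center G #>\<^bsub>G\<^esub> y" using G.rcos_self[OF xy(1) G.center_subgroup] by simp
  then show ?thesis by (auto simp: r_coset_def)
qed

lemma lift_one: "lift \<one>\<^bsub>G\<^esub> \<one>\<^bsub>H\<^esub>"
proof -
  obtain x where x: "lift x \<one>\<^bsub>H\<^esub>" using lift_ex1 by blast
  obtain y where y: "lift \<one>\<^bsub>G\<^esub> y" using lift_ex2 by blast
  \<comment> \<open>A partner \<open>y\<close> of the identity is idempotent modulo the centre,
    hence central.\<close>
  have "lift (\<one>\<^bsub>G\<^esub> \<otimes>\<^bsub>G\<^esub> \<one>\<^bsub>G\<^esub>) (y \<otimes>\<^bsub>H\<^esub> y)" by (rule lift_mult[OF y y])
  then have "center H #>\<^bsub>H\<^esub> y = center H #>\<^bsub>H\<^esub> (y \<otimes>\<^bsub>H\<^esub> y)" using y by (simp add: lift_def)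
  then have "y \<otimes>\<^bsub>H\<^esub> y \<in> center H #>\<^bsub>H\<^esub> y"
    using H.rcos_self[of "y \<otimes>\<^bsub>H\<^esub> y" "center H"] H.center_subgroup y by (auto simp: lift_def)
  then obtain z where z: "z \<in> center H" "y \<otimes>\<^bsub>H\<^esub> y = z \<otimes>\<^bsub>H\<^esub> y" by (auto simp: r_coset_def)
  have "y \<in> carrier H" "z \<in> carrier H" using y z by (auto simp: lift_def center_def)
  then have "y = z" using z(2) by simp
  then have "center H #>\<^bsub>H\<^esub> y = center H"
    using z(1) H.center_subgroup by (intro H.coset_join2) (auto simp: center_def)
  moreover have "center H #>\<^bsub>H\<^esub> \<one>\<^bsub>H\<^esub> = center H"
    by (intro H.coset_mult_one) (auto simp: center_def)
  ultimately show ?thesis using y by (simp add: lift_def)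
qed

lemma lift_pow: "lift x x' \<Longrightarrow> lift (x [^]\<^bsub>G\<^esub> (n::nat)) (x' [^]\<^bsub>H\<^esub> n)"
  by (induction n) (auto intro: lift_one lift_mult)

lemma lift_inv:
  assumes "lift x x'"
  shows "lift (inv\<^bsub>G\<^esub> x) (inv\<^bsub>H\<^esub> x')"
proof -
  obtain y where y: "lift y (inv\<^bsub>H\<^esub> x')" using lift_ex1 assms lift_closed(2) by blast
  have G: "x \<in> carrier G" "x' \<in> carrier H" "y \<in> carrier G" using assms y lift_closed by auto
  have "lift (y \<otimes>\<^bsub>G\<^esub> x) \<one>\<^bsub>H\<^esub>" using lift_mult[OF y assms] G by simp
  then obtain z where z: "z \<in> center G" "\<one>\<^bsub>G\<^esub> = z \<otimes>\<^bsub>G\<^esub> (y \<otimes>\<^bsub>G\<^esub> x)" using lift_same[OF lift_one] by blast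
  have zG: "z \<in> carrier G" using z by (simp add: center_def)
  have "inv\<^bsub>G\<^esub> x = z \<otimes>\<^bsub>G\<^esub> y"
    using z(2) zG G by (intro G.inv_equality) (simp_all add: G.m_assoc)
  moreover have "center G #>\<^bsub>G\<^esub> (z \<otimes>\<^bsub>G\<^esub> y) = center G #>\<^bsub>G\<^esub> y"
    using z(1) G G.center_subgroup by (intro G.repr_independence[symmetric]) (auto simp: r_coset_def)
  ultimately show ?thesis using y zG G by (simp add: lift_def)
qed

text \<open>Commutators correspond twice, exactly through \<open>\<psi>\<close> and modulo the
  centres through \<open>\<phi>\<close>; the latter allows iterated commutators to be
  matched.\<close>

lemma lift_commutator_lift:
  assumes "lift x x'" "lift y y'"
  shows "lift (commutator G x y) (commutator H x' y')"
  unfolding commutator_def by (intro lift_mult lift_inv assms)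

lemma psi_one: "\<psi> \<one>\<^bsub>G\<^esub> = \<one>\<^bsub>H\<^esub>"
  using lift_commutator[OF lift_one lift_one] by (simp add: commutator_def)

lemma psi_pow:
  assumes "x \<in> commutator_subgroup G"
  shows "\<psi> (x [^]\<^bsub>G\<^esub> (n::nat)) = \<psi> x [^]\<^bsub>H\<^esub> n" "x [^]\<^bsub>G\<^esub> n \<in> commutator_subgroup G"
proof -
  have D: "subgroup (commutator_subgroup G) G" by (rule G.derived_is_subgroup) simp
  show pow: "x [^]\<^bsub>G\<^esub> n \<in> commutator_subgroup G" for n :: nat using D assms by (rule G.subgroup_pow_closed)
  have mult: "\<psi> (u \<otimes>\<^bsub>G\<^esub> v) = \<psi> u \<otimes>\<^bsub>H\<^esub> \<psi> v"
    if "u \<in> commutator_subgroup G" "v \<in> commutator_subgroup G" for u v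
    using \<psi> that by (auto simp: iso_def hom_def)
  show "\<psi> (x [^]\<^bsub>G\<^esub> n) = \<psi> x [^]\<^bsub>H\<^esub> n"
    by (induction n) (simp_all add: psi_one mult pow assms)
qed

lemma psi_inj: "x \<in> commutator_subgroup G \<Longrightarrow> y \<in> commutator_subgroup G \<Longrightarrow> \<psi> x = \<psi> y \<Longrightarrow> x = y"
  using \<psi> by (auto simp: iso_def bij_betw_def inj_on_def)

lemma one_derived: "\<one>\<^bsub>G\<^esub> \<in> commutator_subgroup G"
  by (rule subgroup.one_closed[OF G.derived_is_subgroup]) simp

text \<open>Centrality is tested by commutators, and \<open>\<psi>\<close> reflects their triviality
  because it is injective.\<close>

lemma lift_center:
  assumes "lift x x'" "x' \<in> center H"
  shows "x \<in> center G"
  unfolding center_def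
proof (intro CollectI conjI ballI)
  show xG: "x \<in> carrier G" using assms by (simp add: lift_def)
  fix g assume g: "g \<in> carrier G"
  then obtain g' where g': "lift g g'" using lift_ex2 by blast
  have "commutator H x' g' = \<one>\<^bsub>H\<^esub>"
    using assms(2) lift_closed(2)[OF g'] by (subst H.commutator_eq_one_iff) (auto simp: center_def)
  then have "\<psi> (commutator G x g) = \<psi> \<one>\<^bsub>G\<^esub>"
    using lift_commutator[OF assms(1) g'] psi_one by simp
  then have "commutator G x g = \<one>\<^bsub>G\<^esub>"
    using xG g by (intro psi_inj one_derived G.commutator_in_derived)
  then show "x \<otimes>\<^bsub>G\<^esub> g = g \<otimes>\<^bsub>G\<^esub> x" using xG g by (simp add: G.commutator_eq_one_iff)
qed

text \<open>The partners of elements of \<open>U\<close> form a subgroup that contains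
  \<open>b\<close> and \<open>b1\<close>, hence everything. Elements with a common partner differ by
  a central factor, which \<open>U\<close> absorbs.\<close>

lemma generated_lift:
  assumes gen: "\<And>U. subgroup U H \<Longrightarrow> b \<in> U \<Longrightarrow> b1 \<in> U \<Longrightarrow> carrier H \<subseteq> U"
    and ab: "lift a b" "lift a1 b1" and U: "subgroup U G" "a \<in> U" "a1 \<in> U" "center G \<subseteq> U"
  shows "carrier G \<subseteq> U"
proof
  fix g assume g: "g \<in> carrier G"
  define V where "V = {h. \<exists>u\<in>U. lift u h}"
  have "subgroup V H"
  proof (rule H.subgroupI)
    show "V \<subseteq> carrier H" using lift_closed by (auto simp: V_def)
    show "V \<noteq> {}" using ab U by (auto simp: V_def)
    show "inv\<^bsub>H\<^esub> h \<in> V" if "h \<in> V" for h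
      using that lift_inv U(1) by (auto simp: V_def intro: subgroup.m_inv_closed)
    show "h \<otimes>\<^bsub>H\<^esub> k \<in> V" if "h \<in> V" "k \<in> V" for h k
      using that lift_mult U(1) unfolding V_def by (blast intro: subgroup.m_closed)
  qed
  then have "carrier H \<subseteq> V" using ab U by (intro gen) (auto simp: V_def)
  moreover obtain h where h: "lift g h" using lift_ex2[OF g] by blast
  ultimately obtain u where u: "u \<in> U" "lift u h" using lift_closed(2)[OF h] unfolding V_def by blast
  then obtain z where "z \<in> center G" "g = z \<otimes>\<^bsub>G\<^esub> u" using lift_same[OF h] by blast
  then show "g \<in> U" using U u by (auto intro: subgroup.m_closed)
qed

end

lemma (in group) center_commute_gens:
  assumes gen: "\<And>U. subgroup U G \<Longrightarrow> s ` S \<subseteq> U \<Longrightarrow> carrier G \<subseteq> U"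
    and s: "s ` S \<subseteq> carrier G" and x: "x \<in> carrier G" and comm: "\<And>i. i \<in> S \<Longrightarrow> x \<otimes> s i = s i \<otimes> x"
  shows "x \<in> center G"
proof -
  let ?U = "{g \<in> carrier G. x \<otimes> g = g \<otimes> x}"
  have "subgroup ?U G"
  proof (rule subgroupI)
    fix g assume g: "g \<in> ?U"
    then have gG: "g \<in> carrier G" by simp
    have "inv g \<otimes> x = inv g \<otimes> (x \<otimes> g) \<otimes> inv g" using gG x by (simp add: group_word_simps)
    also have "x \<otimes> g = g \<otimes> x" using g by simp
    finally show "inv g \<in> ?U" using gG x by (simp add: group_word_simps)
  next
    fix g h assume gh: "g \<in> ?U" "h \<in> ?U"
    then have G: "g \<in> carrier G" "h \<in> carrier G" by auto
    have "x \<otimes> (g \<otimes> h) = (x \<otimes> g) \<otimes> h" using G x by (simp add: m_assoc)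
    also have "x \<otimes> g = g \<otimes> x" using gh by simp
    also have "g \<otimes> x \<otimes> h = g \<otimes> (x \<otimes> h)" using G x by (simp add: m_assoc)
    also have "x \<otimes> h = h \<otimes> x" using gh by simp
    finally show "g \<otimes> h \<in> ?U" using G x by (simp add: m_assoc)
  qed (use x in auto)
  then have "carrier G \<subseteq> ?U" using s comm by (intro gen) auto
  then show ?thesis using x by (auto simp: center_def)
qed

text \<open>The power relations are solved downwards from \<open>\<alpha>\<^sub>4\<close>. For
  \<open>p \<ge> 5\<close> the corrections vanish because \<open>p\<close> divides the binomial
  coefficients; for \<open>p = 3\<close> what remains is s_2^3 = s_4^-1 and s_1^3 s_3 = s_4.\<close>

lemma (in group) phi10_power_relations:
  assumes sat: "satisfies_phi10 p s" and p: "Factorial_Ring.prime p" "odd p"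
    and gen: "\<And>U. subgroup U G \<Longrightarrow> s ` {0..4} \<subseteq> U \<Longrightarrow> carrier G \<subseteq> U"
  shows "s 4 \<in> center G" "s 4 [^] p = \<one>" "s 3 [^] p = \<one>" "s 2 [^] p \<in> center G"
    "p \<ge> 5 \<Longrightarrow> s 2 [^] p = \<one> \<and> s 1 [^] p = \<one>" "p = 3 \<Longrightarrow> s 1 [^] p \<otimes> s 3 \<in> center G"
proof -
  have s: "s ` {0..4} \<subseteq> carrier G" using sat by (simp add: satisfies_phi10_def)
  have c: "s i \<in> carrier G" if "i \<le> 4" for i using s that by auto
  note rels = sat[unfolded satisfies_phi10_iff[OF s]]
  have ev: "word_eval s (phi10_ppow p j) = \<one>" if "j \<in> {1, 2, 3, 4}" for j using rels that by blast
  have comm4: "s 4 \<otimes> s i = s i \<otimes> s 4" if i: "i \<in> {0..4}" for i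
  proof -
    consider "i = 0" | "i = 4" | "1 \<le> i" "i < 4" using i by fastforce
    then show ?thesis
    proof cases
      case 1
      then show ?thesis using rels c by (simp add: commutator_eq_one_iff)
    next
      case 3
      then have "commutator G (s i) (s 4) = \<one>" using rels by auto
      then show ?thesis using 3 c by (simp add: commutator_eq_one_iff)
    qed simp
  qed
  show Z4: "s 4 \<in> center G"
    by (rule center_commute_gens[OF gen s _ comm4]) (use c in auto)
  have one: "\<one> \<in> center G" by (rule subgroup.one_closed[OF center_subgroup])
  have "s 4 [^] p = \<one> \<and> s 3 [^] p = \<one> \<and> s 2 [^] p \<in> center G \<and>
    (p \<ge> 5 \<longrightarrow> s 2 [^] p = \<one> \<and> s 1 [^] p = \<one>) \<and> (p = 3 \<longrightarrow> s 1 [^] p \<otimes> s 3 \<in> center G)"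
  proof (cases "p \<ge> 5")
    case True
    note e = eval_phi10_ppow_ge_5[OF s True]
    have vanish: "x [^] (p choose k) = \<one>" if x: "x \<in> carrier G" "x [^] p = \<one>" and k: "0 < k" "k < p" for x k
    proof -
      have "p dvd p choose k" using p k by (intro dvd_choose_prime) auto
      then obtain m where "p choose k = p * m" by (rule dvdE)
      then show ?thesis using x by (simp add: nat_pow_pow[symmetric])
    qed
    have p4: "s 4 [^] p = \<one>" using ev[of 4] by (simp add: e)
    have p3: "s 3 [^] p = \<one>"
      using ev[of 3] c vanish[OF _ p4, of 2] True by (simp add: e)
    have p2: "s 2 [^] p = \<one>"
      using ev[of 2] c vanish[OF _ p4, of 3] vanish[OF _ p3, of 2] True by (simp add: e)
    have "s 1 [^] p \<otimes> (s 2 [^] (p choose 2) \<otimes> (s 3 [^] (p choose 3) \<otimes> s 4 [^] (p choose 4))) = \<one>"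
      using ev[of 1] e(1) by simp
    then have "s 1 [^] p = \<one>"
      using c vanish[OF _ p4, of 4] vanish[OF _ p3, of 3] vanish[OF _ p2, of 2] True by simp
    then show ?thesis using p4 p3 p2 one True by simp
  next
    case False
    have "p \<noteq> 2" "p > 1" using p prime_gt_1_nat by auto
    moreover have "p \<noteq> 4" using p(2) by auto
    ultimately have p3: "p = 3" using False by linarith
    note e = eval_phi10_ppow_3[OF s] and ev = ev[unfolded p3]
    have p4: "s 4 [^] (3::nat) = \<one>" using ev[of 4] by (simp add: e)
    have p3': "s 3 [^] (3::nat) = \<one>" using ev[of 3] c by (simp add: e p4)
    have "s 2 [^] (3::nat) \<otimes> s 4 = \<one>" using ev[of 2] c by (simp add: e p3')
    then have "inv s 4 = s 2 [^] (3::nat)" using c by (intro inv_equality) auto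
    then have p2: "s 2 [^] (3::nat) = inv s 4" by (rule HOL.sym)
    have i4: "inv s 4 \<in> center G" using Z4 center_subgroup by (simp add: subgroup.m_inv_closed)
    have "s 1 [^] (3::nat) \<otimes> (s 2 [^] (3::nat) \<otimes> s 3) = \<one>"
      using ev[of 1] e(1) by simp
    moreover have "inv s 4 \<otimes> s 3 = s 3 \<otimes> inv s 4" using i4 c by (simp add: center_def)
    ultimately have "s 1 [^] (3::nat) \<otimes> s 3 \<otimes> inv s 4 = \<one>" using c by (simp add: p2 m_assoc)
    then have "inv (inv s 4) = s 1 [^] (3::nat) \<otimes> s 3" using c by (intro inv_equality) auto
    then have "s 1 [^] (3::nat) \<otimes> s 3 = s 4" using c by simp
    then show ?thesis using p4 p3' p2 i4 Z4 by (simp add: p3)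
  qed
  then show "s 4 [^] p = \<one>" "s 3 [^] p = \<one>" "s 2 [^] p \<in> center G"
    "p \<ge> 5 \<Longrightarrow> s 2 [^] p = \<one> \<and> s 1 [^] p = \<one>" "p = 3 \<Longrightarrow> s 1 [^] p \<otimes> s 3 \<in> center G" by blast+
qed

text \<open>Relations between elements of the derived subgroup transfer exactly, by injectivity of
  \<open>\<psi>\<close>; powers of the lifts of \<open>\<alpha>\<close> and
  \<open>\<alpha>\<^sub>1\<close> are controlled only modulo the centre. Defining \<open>a2\<close>,
  \<open>a3\<close>, \<open>a4\<close> as iterated commutators with \<open>a\<close> puts them into
  the derived subgroup.\<close>

lemma isoclinic_phi10_relations:
  fixes G :: "('a, 'b) monoid_scheme" and p :: nat
  assumes p: "Factorial_Ring.prime p" "odd p"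
    and G: "group G" "Coset.order G = p ^ 5" "in_Phi10 p G"
  shows "\<exists>a a1 a2 a3 a4. phi10_relations G p a a1 a2 a3 a4 \<and>
    (p \<ge> 5 \<longrightarrow> a1 [^]\<^bsub>G\<^esub> p \<in> center G \<and> a2 [^]\<^bsub>G\<^esub> p = \<one>\<^bsub>G\<^esub>) \<and> (p = 3 \<longrightarrow> a1 [^]\<^bsub>G\<^esub> p \<otimes>\<^bsub>G\<^esub> a3 \<in> center G)"
proof -
  define H where "H = Phi10_1_5 p"
  have H: "group H" unfolding H_def Phi10_1_5_def by (rule group_presented_group)
  obtain s where s: "group.satisfies_phi10 H p s" "s 4 \<noteq> \<one>\<^bsub>H\<^esub>"
    and gen: "\<And>U. subgroup U H \<Longrightarrow> s ` {0..4} \<subseteq> U \<Longrightarrow> carrier H \<subseteq> U"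
    using phi10_presentation[OF p] unfolding H_def by metis
  obtain \<phi> \<psi> where iso: "\<phi> \<in> iso (G Mod center G) (H Mod center H)"
    "\<psi> \<in> iso (G\<lparr>carrier := commutator_subgroup G\<rparr>) (H\<lparr>carrier := commutator_subgroup H\<rparr>)"
    "\<forall>x\<in>carrier G. \<forall>y\<in>carrier G. \<forall>x'\<in>carrier H. \<forall>y'\<in>carrier H.
      \<phi> (center G #>\<^bsub>G\<^esub> x) = center H #>\<^bsub>H\<^esub> x' \<longrightarrow> \<phi> (center G #>\<^bsub>G\<^esub> y) = center H #>\<^bsub>H\<^esub> y' \<longrightarrow>
      \<psi> (commutator G x y) = commutator H x' y'"
    using G(3) unfolding in_Phi10_def isoclinic_def H_def by blast
  interpret isoclinism G H \<phi> \<psi>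
    using G(1) H iso by (intro isoclinism.intro isoclinism_axioms.intro) auto
  have sH: "s ` {0..4} \<subseteq> carrier H" using s(1) by (simp add: H.satisfies_phi10_def)
  then have sc: "s i \<in> carrier H" if "i \<le> 4" for i using that by auto
  note rels = s(1)[unfolded H.satisfies_phi10_iff[OF sH]]
  have pows: "s 4 \<in> center H" "s 4 [^]\<^bsub>H\<^esub> p = \<one>\<^bsub>H\<^esub>" "s 3 [^]\<^bsub>H\<^esub> p = \<one>\<^bsub>H\<^esub>" "s 2 [^]\<^bsub>H\<^esub> p \<in> center H"
    "p \<ge> 5 \<Longrightarrow> s 2 [^]\<^bsub>H\<^esub> p = \<one>\<^bsub>H\<^esub> \<and> s 1 [^]\<^bsub>H\<^esub> p = \<one>\<^bsub>H\<^esub>" "p = 3 \<Longrightarrow> s 1 [^]\<^bsub>H\<^esub> p \<otimes>\<^bsub>H\<^esub> s 3 \<in> center H"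
    using H.phi10_power_relations[OF s(1) p] gen by blast+
  obtain a a1 where a: "lift a (s 0)" "lift a1 (s 1)" using lift_ex1 sc by (metis zero_le one_le_numeral)
  define a2 where "a2 = commutator G a1 a"
  define a3 where "a3 = commutator G a2 a"
  define a4 where "a4 = commutator G a3 a"
  have hc: "commutator H (s 1) (s 0) = s 2" "commutator H (s 2) (s 0) = s 3" "commutator H (s 3) (s 0) = s 4"
    "commutator H (s 1) (s 2) = s 4" "commutator H (s 1) (s 3) = \<one>\<^bsub>H\<^esub>" "commutator H (s 2) (s 3) = \<one>\<^bsub>H\<^esub>"
    using rels by (auto simp: numeral_eq_Suc)
  have l2: "lift a2 (s 2)" unfolding a2_def hc(1)[symmetric] by (rule lift_commutator_lift[OF a(2,1)])
  have l3: "lift a3 (s 3)" unfolding a3_def hc(2)[symmetric] by (rule lift_commutator_lift[OF l2 a(1)])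
  have l4: "lift a4 (s 4)" unfolding a4_def hc(3)[symmetric] by (rule lift_commutator_lift[OF l3 a(1)])
  have car: "a \<in> carrier G" "a1 \<in> carrier G" "a2 \<in> carrier G" "a3 \<in> carrier G" "a4 \<in> carrier G"
    using a l2 l3 l4 lift_closed by auto
  have \<psi>s: "\<psi> a2 = s 2" "\<psi> a3 = s 3" "\<psi> a4 = s 4"
    using lift_commutator a l2 l3 hc unfolding a2_def[symmetric] a3_def a4_def by (auto simp: a2_def)
  have D: "a2 \<in> commutator_subgroup G" "a3 \<in> commutator_subgroup G" "a4 \<in> commutator_subgroup G"
    unfolding a2_def a3_def a4_def using car G.commutator_in_derived by (auto simp: a2_def a3_def)
  have c12: "commutator G a1 a2 = a4"
    using lift_commutator[OF a(2) l2] hc(4) \<psi>s(3) car by (intro psi_inj D G.commutator_in_derived) auto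
  have c13: "commutator G a1 a3 = \<one>\<^bsub>G\<^esub>"
    using lift_commutator[OF a(2) l3] hc(5) psi_one car by (intro psi_inj one_derived G.commutator_in_derived) auto
  have c23: "commutator G a2 a3 = \<one>\<^bsub>G\<^esub>"
    using lift_commutator[OF l2 l3] hc(6) psi_one car by (intro psi_inj one_derived G.commutator_in_derived) auto
  have pow_D: "x [^]\<^bsub>G\<^esub> p = \<one>\<^bsub>G\<^esub>" if "x \<in> commutator_subgroup G" "\<psi> x [^]\<^bsub>H\<^esub> p = \<one>\<^bsub>H\<^esub>" for x
    using that psi_pow[OF that(1), of p] psi_one by (intro psi_inj one_derived) auto
  have oneZ: "\<one>\<^bsub>H\<^esub> \<in> center H" by (rule subgroup.one_closed[OF H.center_subgroup])
  have p35: "p \<ge> 5 \<or> p = 3"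
  proof -
    have "p > 1" "p \<noteq> 2" "p \<noteq> 4" using p prime_gt_1_nat by auto
    then show ?thesis by linarith
  qed
  have a1p5: "a1 [^]\<^bsub>G\<^esub> p \<in> center G" if "p \<ge> 5"
    using lift_center[OF lift_pow[OF a(2)]] pows(5)[OF that] oneZ by simp
  have t3: "a1 [^]\<^bsub>G\<^esub> p \<otimes>\<^bsub>G\<^esub> a3 \<in> center G" if "p = 3"
    using lift_center[OF lift_mult[OF lift_pow[OF a(2)] l3]] pows(6)[OF that] by blast
  have a3p: "a3 [^]\<^bsub>G\<^esub> p = \<one>\<^bsub>G\<^esub>" using D(2) \<psi>s(2) pows(3) by (intro pow_D) auto
  have "phi10_relations G p a a1 a2 a3 a4"
  proof (intro phi10_relations.intro phi10_relations_axioms.intro G(1) p(1) car(1-4))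
    have "p > 0" using p by (simp add: prime_gt_0_nat)
    then show "finite (carrier G)" using G(2) by (metis Coset.order_def card.infinite less_irrefl zero_less_power)
    show "card (carrier G) = p ^ 5" using G(2) by (simp add: Coset.order_def)
    show "a1 \<otimes>\<^bsub>G\<^esub> a = a \<otimes>\<^bsub>G\<^esub> a1 \<otimes>\<^bsub>G\<^esub> a2" unfolding a2_def by (rule G.commutator_rel[OF car(2,1)])
    show "a2 \<otimes>\<^bsub>G\<^esub> a = a \<otimes>\<^bsub>G\<^esub> a2 \<otimes>\<^bsub>G\<^esub> a3" unfolding a3_def by (rule G.commutator_rel[OF car(3,1)])
    show "a3 \<otimes>\<^bsub>G\<^esub> a = a \<otimes>\<^bsub>G\<^esub> a3 \<otimes>\<^bsub>G\<^esub> a4" unfolding a4_def by (rule G.commutator_rel[OF car(4,1)])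
    show "a1 \<otimes>\<^bsub>G\<^esub> a2 = a2 \<otimes>\<^bsub>G\<^esub> a1 \<otimes>\<^bsub>G\<^esub> a4" unfolding c12[symmetric] by (rule G.commutator_rel[OF car(2,3)])
    show "a1 \<otimes>\<^bsub>G\<^esub> a3 = a3 \<otimes>\<^bsub>G\<^esub> a1" using c13 car by (simp add: G.commutator_eq_one_iff)
    show "a2 \<otimes>\<^bsub>G\<^esub> a3 = a3 \<otimes>\<^bsub>G\<^esub> a2" using c23 car by (simp add: G.commutator_eq_one_iff)
    show "a4 \<in> center G" by (rule lift_center[OF l4 pows(1)])
    show "a4 \<noteq> \<one>\<^bsub>G\<^esub>" using \<psi>s(3) psi_one s(2) by metis
    show "a4 [^]\<^bsub>G\<^esub> p = \<one>\<^bsub>G\<^esub>" using D(3) \<psi>s(3) pows(2) by (intro pow_D) auto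
    show "a [^]\<^bsub>G\<^esub> p \<in> center G" using lift_center[OF lift_pow[OF a(1)]] rels oneZ by simp
    show "a2 [^]\<^bsub>G\<^esub> p \<in> center G" by (rule lift_center[OF lift_pow[OF l2] pows(4)])
    show "a3 [^]\<^bsub>G\<^esub> p = \<one>\<^bsub>G\<^esub>" by (rule a3p)
    show "a1 [^]\<^bsub>G\<^esub> p \<in> G.pow_ext a3 (center G)"
      using p35
    proof
      assume "p \<ge> 5"
      then show ?thesis using a1p5 G.pow_ext_base[OF G.center_subgroup] by blast
    next
      assume p3: "p = 3"
      \<comment> \<open>Since a_1^3 a_3 is central and a_3^3 = 1, the cube of \<open>a1\<close> is
        a_3^2 times a central element.\<close>
      define z where "z = a1 [^]\<^bsub>G\<^esub> p \<otimes>\<^bsub>G\<^esub> a3"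
      have z: "z \<in> center G" "z \<in> carrier G" using t3[OF p3] by (auto simp: z_def center_def)
      have cube: "a3 \<otimes>\<^bsub>G\<^esub> a3 [^]\<^bsub>G\<^esub> (2::nat) = \<one>\<^bsub>G\<^esub>"
        using a3p car G.nat_pow_Suc2[of a3 2] by (simp add: p3 numeral_eq_Suc)
      have "a3 [^]\<^bsub>G\<^esub> (2::nat) \<otimes>\<^bsub>G\<^esub> z = z \<otimes>\<^bsub>G\<^esub> a3 [^]\<^bsub>G\<^esub> (2::nat)"
        using z(1) car by (simp add: center_def)
      also have "\<dots> = a1 [^]\<^bsub>G\<^esub> p \<otimes>\<^bsub>G\<^esub> (a3 \<otimes>\<^bsub>G\<^esub> a3 [^]\<^bsub>G\<^esub> (2::nat))"
        using car by (simp add: z_def G.m_assoc)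
      also have "\<dots> = a1 [^]\<^bsub>G\<^esub> p" using car by (simp add: cube)
      finally have "a1 [^]\<^bsub>G\<^esub> p = a3 [^]\<^bsub>G\<^esub> (2::nat) \<otimes>\<^bsub>G\<^esub> z" by (rule HOL.sym)
      then show ?thesis using z(1) unfolding G.pow_ext_def by blast
    qed
    fix U assume U: "subgroup U G" "a \<in> U" "a1 \<in> U" "center G \<subseteq> U"
    \<comment> \<open>\<open>\<alpha>\<close> and \<open>\<alpha>\<^sub>1\<close> already generate
      the presented group, the other generators being commutators.\<close>
    have "carrier H \<subseteq> V" if V: "subgroup V H" "s 0 \<in> V" "s 1 \<in> V" for V
    proof (rule gen[OF V(1)])
      have comm: "commutator H x y \<in> V" if "x \<in> V" "y \<in> V" for x y
        using that V(1) unfolding commutator_def by (auto intro: subgroup.m_closed subgroup.m_inv_closed)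
      have "s 2 \<in> V" using comm[OF V(3,2)] hc(1) by simp
      moreover from this have "s 3 \<in> V" using comm[OF _ V(2), of "s 2"] hc(2) by simp
      moreover from this have "s 4 \<in> V" using comm[OF _ V(2), of "s 3"] hc(3) by simp
      moreover have "{0..4} = {0, 1, 2, 3, 4::nat}" by auto
      ultimately show "s ` {0..4} \<subseteq> V" using V by simp
    qed
    then show "carrier G \<subseteq> U" by (rule generated_lift[OF _ a U])
  qed
  moreover have "a2 [^]\<^bsub>G\<^esub> p = \<one>\<^bsub>G\<^esub>" if "p \<ge> 5" using D(1) \<psi>s(1) pows(5)[OF that] by (intro pow_D) auto
  ultimately show ?thesis using a1p5 t3 by blast
qed

theorem theorem39:
  fixes G :: "('a, 'b) monoid_scheme" and p :: nat
  assumes "Factorial_Ring.prime p" and "odd p"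
    and "group G" and "Coset.order G = p ^ 5" and "in_Phi10 p G"
  shows "(p \<ge> 5 \<longrightarrow>
            rat_group_algebra G \<cong>\<^sub>\<rat>
              rat_group_algebra (G Mod commutator_subgroup G)
              \<oplus>\<^sub>\<rat> algebra_copies (p + 1) (matrix_algebra p (cyclotomic_field p))
              \<oplus>\<^sub>\<rat> matrix_algebra (p ^ 2) (cyclotomic_field p))
       \<and> (p = 3 \<longrightarrow>
            rat_group_algebra G \<cong>\<^sub>\<rat>
              rat_group_algebra (G Mod commutator_subgroup G)
              \<oplus>\<^sub>\<rat> matrix_algebra 3 (cyclotomic_field 3)
              \<oplus>\<^sub>\<rat> matrix_algebra 3 (cyclotomic_field 9)
              \<oplus>\<^sub>\<rat> matrix_algebra 9 (cyclotomic_field 3))"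
proof -
  obtain a a1 a2 a3 a4 where rel: "phi10_relations G p a a1 a2 a3 a4"
    and pow: "p \<ge> 5 \<longrightarrow> a1 [^]\<^bsub>G\<^esub> p \<in> center G \<and> a2 [^]\<^bsub>G\<^esub> p = \<one>\<^bsub>G\<^esub>"
      "p = 3 \<longrightarrow> a1 [^]\<^bsub>G\<^esub> p \<otimes>\<^bsub>G\<^esub> a3 \<in> center G"
    using isoclinic_phi10_relations[OF assms] by blast
  interpret phi10_relations G p a a1 a2 a3 a4 by (rule rel)
  show ?thesis using decomposition_exponent_p decomposition_three pow by blast
qed

end
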